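(* Let $\Psi:M^{n\times n}_+\to[0,\infty)$ be continuous. Then the inequality $$\frac{1}{|\Omega_1|}\int_{\Omega_1}\Psi(Dy(x))\,dx\geq\Psi(M)$$ holds for every bounded Lipschitz domain $\Omega_1\subset\mathbb{R}^n$, every $M\in M^{n\times n}_+$, and every orientation-preserving invertible map $y$ on $\Omega_1$ with $y(\Omega_1)=M\Omega_1$, if and only if there is a convex function $H:(0,\infty)\to\mathbb{R}$ such that $$\Psi(A)=H(\det A)\quad\text{for all }A\in M^{n\times n}_+.$$
   Context: $M^{n\times n}_+$ denotes the set of real $n\times n$ matrices with positive determinant. $|\Omega_1|$ is the $n$-dimensional Lebesgue measure of $\Omega_1$, and $M\Omega_1=\{Mx:x\in\Omega_1\}$. $Dy$ is the distributional gradient of $y$. An orientation-preserving invertible map $y$ with $y(\Omega_1)=\Omega_2$ (where $\Omega_2=M\Omega_1$) means a homeomorphism $y:\Omega_1\to\Omega_2$ such that $y\in W^{1,p}(\Omega_1,\mathbb{R}^n)$ and $y^{-1}\in W^{1,p}(\Omega_2,\mathbb{R}^n)$ for some fixed exponent $p>n$, and $\det Dy(x)>0$ for a.e. $x\in\Omega_1$. No boundary values are prescribed for $y$ on $\partial\Omega_1$. The integral may take the value $+\infty$. *)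

theory Defs
  imports "HOL-Analysis.Analysis"
begin

text \<open>
  Open, connected and nonempty, with a boundary that is locally the graph of a Lipschitz function
  over a hyperplane: \<^term>\<open>x - (x \<bullet> e) *\<^sub>R e\<close> is the projection of \<^term>\<open>x\<close> onto the orthogonal
  complement of the unit vector \<^term>\<open>e\<close>, and near the boundary point \<^term>\<open>a\<close> the domain is
  the part of the ball that lies strictly above the graph.
\<close>

definition bounded_lipschitz_domain :: "(real^'n) set \<Rightarrow> bool" where
  "bounded_lipschitz_domain \<Omega> \<longleftrightarrow>
     open \<Omega> \<and> connected \<Omega> \<and> \<Omega> \<noteq> {} \<and> bounded \<Omega> \<and>
     (\<forall>a \<in> frontier \<Omega>. \<exists>r > 0. \<exists>e L g. norm e = 1 \<and> L-lipschitz_on {v. v \<bullet> e = 0} g \<and>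
        \<Omega> \<inter> ball a r = {x \<in> ball a r. g (x - (x \<bullet> e) *\<^sub>R e) < x \<bullet> e})"

definition partial_deriv :: "'n \<Rightarrow> (real^'n \<Rightarrow> real) \<Rightarrow> real^'n \<Rightarrow> real" where
  "partial_deriv j f x = frechet_derivative f (at x) (axis j 1)"

primrec C_k :: "nat \<Rightarrow> (real^'n \<Rightarrow> real) \<Rightarrow> bool" where
  "C_k 0 f \<longleftrightarrow> continuous_on UNIV f"
| "C_k (Suc k) f \<longleftrightarrow> (\<forall>x. f differentiable at x) \<and> (\<forall>j. C_k k (partial_deriv j f))"

definition test_function :: "(real^'n) set \<Rightarrow> (real^'n \<Rightarrow> real) \<Rightarrow> bool" where
  "test_function \<Omega> \<phi> \<longleftrightarrow>
     (\<forall>k. C_k k \<phi>) \<and> compact (closure {x. \<phi> x \<noteq> 0}) \<and> closure {x. \<phi> x \<noteq> 0} \<subseteq> \<Omega>"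

text \<open>The matrix entry \<^term>\<open>F x $ i $ j\<close> is the \<^term>\<open>j\<close>-th partial derivative of \<^term>\<open>u x $ i\<close>.\<close>

definition has_weak_gradient ::
    "(real^'n) set \<Rightarrow> (real^'n \<Rightarrow> real^'n) \<Rightarrow> (real^'n \<Rightarrow> real^'n^'n) \<Rightarrow> bool" where
  "has_weak_gradient \<Omega> u F \<longleftrightarrow>
     (\<forall>\<phi> i j. test_function \<Omega> \<phi> \<longrightarrow>
        (LINT x|lebesgue_on \<Omega>. u x $ i * partial_deriv j \<phi> x) =
        - (LINT x|lebesgue_on \<Omega>. F x $ i $ j * \<phi> x))"

definition in_Lp :: "real \<Rightarrow> (real^'n) set \<Rightarrow> (real^'n \<Rightarrow> 'b::euclidean_space) \<Rightarrow> bool" where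
  "in_Lp p \<Omega> f \<longleftrightarrow>
     f \<in> borel_measurable (lebesgue_on \<Omega>) \<and> integrable (lebesgue_on \<Omega>) (\<lambda>x. norm (f x) powr p)"

text \<open>
  \<open>u\<close> lies in the Sobolev space \<open>W\<^sup>1\<^sup>,\<^sup>p(\<Omega>, \<real>\<^sup>n)\<close> and \<open>F\<close> is a representative of its
  distributional gradient, which is only determined almost everywhere; as with
  \<^const>\<open>has_derivative\<close>, the gradient is an argument of the predicate.
\<close>

definition sobolev_W1 ::
    "real \<Rightarrow> (real^'n) set \<Rightarrow> (real^'n \<Rightarrow> real^'n) \<Rightarrow> (real^'n \<Rightarrow> real^'n^'n) \<Rightarrow> bool" where
  "sobolev_W1 p \<Omega> u F \<longleftrightarrow> in_Lp p \<Omega> u \<and> in_Lp p \<Omega> F \<and> has_weak_gradient \<Omega> u F"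

text \<open>Only the values of \<open>y\<close> on \<open>\<Omega>\<close> matter; \<open>Dy\<close> represents its distributional gradient.\<close>

definition orientation_preserving_invertible ::
    "real \<Rightarrow> (real^'n) set \<Rightarrow> (real^'n) set \<Rightarrow>
     (real^'n \<Rightarrow> real^'n) \<Rightarrow> (real^'n \<Rightarrow> real^'n^'n) \<Rightarrow> bool" where
  "orientation_preserving_invertible p \<Omega> \<Omega>' y Dy \<longleftrightarrow>
     (\<exists>z Dz. homeomorphism \<Omega> \<Omega>' y z \<and> sobolev_W1 p \<Omega> y Dy \<and> sobolev_W1 p \<Omega>' z Dz) \<and>
     (AE x in lebesgue_on \<Omega>. 0 < det (Dy x))"

end

theory Submission
  imports Defs
begin

text \<open>
  If \<open>\<Psi> = H \<circ> det\<close> with \<open>H\<close> convex, the inequality is Jensen's, applied with a supporting line of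
  \<open>H\<close> at \<open>det M\<close>, once \<open>\<integral> det Dy = det M |\<Omega>|\<close> is known. For \<open>p > n\<close> a continuous Sobolev map
  satisfies Morrey's inequality on cubes: it is therefore differentiable at the Lebesgue points of
  \<open>|Dy - q|\<^sup>p\<close> and maps null sets to null sets, so the change of variables formula applies to it.

  Conversely, for a rotation \<open>R\<close> the domains \<open>P B\<close>, with \<open>B\<close> a ball, and the linear maps
  \<open>M P R P\<^sup>-\<^sup>1\<close>, whose image of \<open>P B\<close> is \<open>M P B\<close>, give \<open>\<Psi> (M P R P\<^sup>-\<^sup>1) = \<Psi> M\<close>. Conjugates of
  rotations generate the special linear group, hence \<open>\<Psi>\<close> depends on the determinant only. Testing
  with a map of the unit cube that is piecewise linear in one coordinate gives convexity.
\<close>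

section \<open>Convex domains\<close>

text \<open>Without boundary values, the null Lagrangian property of \<open>det Dy\<close> gives no
  value for its integral; what fixes that integral is the measure of the image, so injectivity and
  an area formula for Sobolev maps carry the sufficiency. In the other direction the same freedom is
  an asset: two linear maps with the same image of a domain compete with each other, which turns the
  inequality into an equality. Balls alone would only give invariance under right multiplication by
  rotations, not by their conjugates, hence the linear images of balls. Weak gradients are
  accessible only through smooth compactly supported functions, so the kernels behind Morrey's
  inequality are explicit product bumps, a family closed under partial differentiation and adapted
  to cubes. Cubes are also what the differentiation and covering theorems deliver. The function
  \<open>H\<close> is \<open>\<Psi>\<close> restricted to the matrices
  \<open>dilation k t\<close>.\<close>

lemma bounded_lipschitz_domain_convex:
  fixes \<Omega> :: "(real^'n) set"
  assumes op: "open \<Omega>" and cv: "convex \<Omega>" and bd: "bounded \<Omega>" and ne: "\<Omega> \<noteq> {}"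
  shows "bounded_lipschitz_domain \<Omega>"
proof -
  obtain c where c: "c \<in> \<Omega>" using ne by blast
  obtain \<rho> where \<rho>: "\<rho> > 0" "ball c \<rho> \<subseteq> \<Omega>" using op c open_contains_ball by blast
  have "\<exists>r > 0. \<exists>e L g. norm e = 1 \<and> L-lipschitz_on {v. v \<bullet> e = 0} g \<and>
        \<Omega> \<inter> ball a r = {x \<in> ball a r. g (x - (x \<bullet> e) *\<^sub>R e) < x \<bullet> e}" if a: "a \<in> frontier \<Omega>" for a
  proof -
    have aO: "a \<notin> \<Omega>" using a op by (auto simp: frontier_def interior_open)
    have acl: "a \<in> closure \<Omega>" using a by (auto simp: frontier_def)
    define d where "d = norm (c - a)"
    have d\<rho>: "\<rho> \<le> d" using \<rho> aO by (force simp: d_def dist_norm)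
    then have d0: "0 < d" using \<rho> by linarith
    \<comment> \<open>The axis points from \<open>a\<close> to the centre of an inscribed ball. With
      \<open>r\<close> and \<open>L\<close> below, a direction of slope at least \<open>L\<close>
      drifts sideways by at most \<open>d / L = \<rho> / 2\<close> over the axial length
      \<open>d\<close>; a start within \<open>r = \<rho> / 2\<close> of \<open>a\<close> uses the
      other half of the inscribed radius.\<close>
    define e where "e = (c - a) /\<^sub>R d"
    have e1: "norm e = 1" using d0 by (simp add: e_def d_def)
    have ee: "e \<bullet> e = 1" using e1 by (simp add: dot_square_norm)
    define r where "r = \<rho> / 2"
    define L where "L = 2 * d / \<rho>"
    have L0: "0 < L" "0 < r" using d0 \<rho> by (auto simp: L_def r_def)
    define P where "P = (\<lambda>x. x - (x \<bullet> e) *\<^sub>R e)"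
    have P_diff: "P x - P y = P (x - y)" for x y by (simp add: P_def algebra_simps inner_diff_left)
    have Pe: "P (x - s *\<^sub>R e) = P x" for x s by (simp add: P_def inner_diff_left ee algebra_simps)
    define W where "W = \<Omega> \<inter> ball a r"
    have Wne: "W \<noteq> {}" using acl L0 unfolding W_def closure_approachable
      by (metis (no_types, lifting) IntI dist_commute emptyE mem_ball)
    \<comment> \<open>\<open>h v w\<close> is the height over \<open>v\<close> of the upward cone of
      slope \<open>L\<close> with apex \<open>w\<close>. The infimum of these cones over the points
      of the domain near \<open>a\<close> inherits the constant \<open>L\<close> from the
      cones.\<close>
    define h where "h = (\<lambda>v w. w \<bullet> e + L * norm (v - P w))"
    define g where "g = (\<lambda>v. INF w\<in>W. h v w)"
    have hlow: "a \<bullet> e - r \<le> h v w" if "w \<in> W" for v w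
    proof -
      have "\<bar>(w - a) \<bullet> e\<bar> \<le> norm (w - a) * norm e" by (rule Cauchy_Schwarz_ineq2)
      also have "\<dots> \<le> r" using that e1 by (simp add: W_def dist_norm norm_minus_commute)
      finally have "a \<bullet> e - r \<le> w \<bullet> e" by (simp add: inner_diff_left)
      moreover have "0 \<le> L * norm (v - P w)" using L0 by simp
      ultimately show ?thesis unfolding h_def by linarith
    qed
    have bdd: "bdd_below (h v ` W)" for v using hlow by (intro bdd_belowI[of _ "a \<bullet> e - r"]) auto
    have gle: "g u \<le> g v + L * norm (u - v)" for u v
    proof -
      have "g u - L * norm (u - v) \<le> g v"
        unfolding g_def
      proof (rule cINF_greatest[OF Wne])
        fix w assume w: "w \<in> W"
        have "(INF w\<in>W. h u w) \<le> h u w" by (rule cINF_lower[OF bdd w])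
        also have "h u w \<le> h v w + L * norm (u - v)"
        proof -
          have "norm (u - P w) \<le> norm (u - v) + norm (v - P w)"
            using norm_triangle_ineq[of "u - v" "v - P w"] by simp
          then have "L * norm (u - P w) \<le> L * (norm (u - v) + norm (v - P w))"
            using L0 by (intro mult_left_mono) auto
          then show ?thesis by (simp add: h_def algebra_simps)
        qed
        finally show "(INF w\<in>W. h u w) - L * norm (u - v) \<le> h v w" by simp
      qed
      then show ?thesis by simp
    qed
    have glip: "L-lipschitz_on {v. v \<bullet> e = 0} g"
    proof (rule lipschitz_onI)
      fix u v
      show "dist (g u) (g v) \<le> L * dist u v"
        using gle[of u v] gle[of v u] by (simp add: dist_norm norm_minus_commute abs_le_iff)
    qed (use L0 in simp)
    text \<open>A point \<open>z\<close> of the cone over \<open>w\<close> lies on a segment from \<open>w\<close> to the inscribed ball.\<close>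
    have cone: "z \<in> \<Omega>" if w: "w \<in> W" and z: "z \<in> ball a r" and zw: "L * norm (P (z - w)) < (z - w) \<bullet> e" for z w
    proof -
      define s where "s = (z - w) \<bullet> e / d"
      have zwpos: "0 < (z - w) \<bullet> e" using zw L0 by (smt (verit) mult_nonneg_nonneg norm_ge_zero)
      have s0: "0 < s" using zwpos d0 by (simp add: s_def)
      have "(z - w) \<bullet> e \<le> norm (z - w) * norm e" by (rule norm_cauchy_schwarz)
      also have "\<dots> \<le> dist a z + dist a w" using e1 by (metis dist_commute dist_norm dist_triangle mult.right_neutral)
      also have "\<dots> < \<rho>" using z w by (simp add: W_def r_def)
      finally have s1: "s < 1" using d\<rho> d0 by (simp add: s_def)
      define c' where "c' = w + (z - w) /\<^sub>R s"
      have zdec: "(z - w) /\<^sub>R s = P (z - w) /\<^sub>R s + d *\<^sub>R e"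
        using zwpos d0 by (simp add: P_def s_def scaleR_diff_right)
      have "c' - c = (w - a) + P (z - w) /\<^sub>R s"
        unfolding c'_def zdec using d0 by (simp add: e_def)
      then have "norm (c' - c) \<le> norm (w - a) + norm (P (z - w)) / s"
        using norm_triangle_ineq[of "w - a" "P (z - w) /\<^sub>R s"] s0 by (simp add: divide_inverse mult.commute)
      also have "norm (P (z - w)) < (s * d) / L" using zw L0 d0 by (simp add: s_def field_simps)
      then have "norm (P (z - w)) / s < d / L" using s0 L0 by (simp add: field_simps)
      also have "d / L = \<rho> / 2" using d0 by (simp add: L_def)
      finally have "norm (c' - c) < \<rho> / 2 + norm (w - a)" by simp
      also have "norm (w - a) < \<rho> / 2" using w by (simp add: W_def r_def dist_norm norm_minus_commute)
      finally have "c' \<in> \<Omega>" using \<rho> by (auto simp: dist_norm norm_minus_commute)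
      moreover have "z = (1 - s) *\<^sub>R w + s *\<^sub>R c'"
        using s0 by (simp add: c'_def algebra_simps)
      ultimately show ?thesis
        using convexD[OF cv, of w c' "1 - s" s] w s0 s1 by (simp add: W_def)
    qed
    have "x \<in> \<Omega> \<longleftrightarrow> g (P x) < x \<bullet> e" if x: "x \<in> ball a r" for x
    proof
      assume xO: "x \<in> \<Omega>"
      have "open W" using op by (auto simp: W_def)
      moreover have "x \<in> W" using x xO by (simp add: W_def)
      ultimately obtain \<epsilon> where \<epsilon>: "\<epsilon> > 0" "ball x \<epsilon> \<subseteq> W" using open_contains_ball by blast
      \<comment> \<open>Openness leaves room below \<open>x\<close> along \<open>e\<close>: this
        point has the same projection and a smaller height, which makes the inequality
        strict.\<close>
      define w where "w = x - (\<epsilon> / 2) *\<^sub>R e"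
      have "w \<in> W" using \<epsilon> e1 by (intro subsetD[OF \<epsilon>(2)]) (simp add: w_def dist_norm)
      then have "g (P x) \<le> h (P x) w" unfolding g_def by (intro cINF_lower bdd)
      also have "h (P x) w = x \<bullet> e - \<epsilon> / 2" by (simp add: h_def w_def Pe inner_diff_left ee)
      finally show "g (P x) < x \<bullet> e" using \<epsilon> by simp
    next
      assume "g (P x) < x \<bullet> e"
      then obtain w where w: "w \<in> W" "h (P x) w < x \<bullet> e"
        unfolding g_def using cINF_less_iff[OF Wne bdd] by auto
      then show "x \<in> \<Omega>" using x by (intro cone[of w x]) (auto simp: h_def P_diff inner_diff_left)
    qed
    then have "\<Omega> \<inter> ball a r = {x \<in> ball a r. g (P x) < x \<bullet> e}" by auto
    then show ?thesis using L0 e1 glip unfolding P_def by blast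
  qed
  then show ?thesis using assms by (auto simp: bounded_lipschitz_domain_def convex_connected)
qed

section \<open>Test functions\<close>

text \<open>For \<open>P = 1\<close> and \<open>k = 0\<close> this is the standard bump on the unit
  interval. The polynomial and the power of \<open>1 / (s * (1 - s))\<close> make the family closed
  under differentiation, so smoothness becomes an induction within the family.\<close>

definition bump :: "real poly \<Rightarrow> nat \<Rightarrow> real \<Rightarrow> real" where
  "bump P k s = (if 0 < s \<and> s < 1
     then poly P s * (1 / (s * (1 - s))) ^ k * exp (- (1 / (s * (1 - s)))) else 0)"

text \<open>With \<open>q = s * (1 - s)\<close>, encoded as \<open>[:0, 1, -1:]\<close>, and
  \<open>q' = 1 - 2 * s\<close>, encoded as \<open>[:1, -2:]\<close>, this is the numerator left
  after the derivative is put over \<open>q ^ (k + 2)\<close>.\<close>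

definition bump_deriv_poly :: "real poly \<Rightarrow> nat \<Rightarrow> real poly" where
  "bump_deriv_poly P k = pderiv P * [:0, 1, -1:] ^ 2
     - of_nat k * P * [:1, -2:] * [:0, 1, -1:] + P * [:1, -2:]"

lemma power_mult_exp_minus_le:
  fixes r :: real assumes "0 \<le> r" shows "r ^ m * exp (- r) \<le> fact m"
proof -
  have "r ^ m / fact m \<le> exp r"
  proof -
    have "(\<Sum>n\<in>{m}. r ^ n /\<^sub>R fact n) \<le> (\<Sum>n. r ^ n /\<^sub>R fact n)"
      using assms by (intro sum_le_suminf summable_exp_generic) auto
    then show ?thesis by (simp add: exp_def divide_inverse mult.commute)
  qed
  then show ?thesis by (simp add: exp_minus divide_simps mult.commute)
qed

text \<open>Flatness at 0 and 1, the points where the defining formula switches, will give the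
  derivatives there. Two additional powers of \<open>r = 1 / (s * (1 - s))\<close> are absorbed by
  the exponential at the cost of \<open>fact (k + 2)\<close> and leave the factor
  \<open>(s * (1 - s))\<^sup>2\<close>.\<close>

lemma bump_quadratic_bound:
  obtains C where "\<And>s. \<bar>bump P k s\<bar> \<le> C * s\<^sup>2" "\<And>s. \<bar>bump P k s\<bar> \<le> C * (s - 1)\<^sup>2"
proof -
  have "compact ((\<lambda>s. poly P s) ` {0..1})"
    by (intro compact_continuous_image continuous_intros) auto
  then obtain B where B: "\<And>s. 0 \<le> s \<Longrightarrow> s \<le> 1 \<Longrightarrow> \<bar>poly P s\<bar> \<le> B"
    by (force dest!: compact_imp_bounded simp: bounded_iff)
  have B0: "0 \<le> B" using B[of 0] by (meson abs_ge_zero order_trans zero_le_one order_refl)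
  define C where "C = B * fact (k + 2)"
  have C0: "0 \<le> C" using B0 by (simp add: C_def)
  have main: "\<bar>bump P k s\<bar> \<le> C * (s * (1 - s))\<^sup>2" if s: "0 < s" "s < 1" for s
  proof -
    define r where "r = 1 / (s * (1 - s))"
    have r: "0 < r" using s by (simp add: r_def)
    have "\<bar>bump P k s\<bar> = \<bar>poly P s\<bar> * (r ^ k * exp (- r))"
      using s r by (simp add: bump_def r_def abs_mult)
    also have "\<dots> \<le> B * (r ^ k * exp (- r))"
      using B[of s] s r by (intro mult_right_mono) auto
    also have "r ^ k * exp (- r) = (r ^ (k + 2) * exp (- r)) * (1 / r)\<^sup>2"
      using r by (simp add: power_add power2_eq_square)
    also have "B * \<dots> \<le> B * (fact (k + 2) * (1 / r)\<^sup>2)"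
      using r B0 by (intro mult_left_mono mult_right_mono power_mult_exp_minus_le) auto
    also have "\<dots> = C * (s * (1 - s))\<^sup>2" by (simp add: C_def r_def)
    finally show ?thesis .
  qed
  have le: "\<bar>bump P k s\<bar> \<le> C * s\<^sup>2 \<and> \<bar>bump P k s\<bar> \<le> C * (s - 1)\<^sup>2" for s
  proof (cases "0 < s \<and> s < 1")
    case True
    have "(s * (1 - s))\<^sup>2 \<le> s\<^sup>2" "(s * (1 - s))\<^sup>2 \<le> (1 - s)\<^sup>2"
      using True by (auto intro!: power_mono mult_left_le mult_left_le_one_le)
    moreover have "(1 - s)\<^sup>2 = (s - 1)\<^sup>2" by (simp add: power2_commute)
    ultimately show ?thesis using main[of s] True C0
      by (metis mult_left_mono order_trans)
  next
    case False
    then show ?thesis using C0 by (auto simp: bump_def)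
  qed
  show ?thesis by (rule that[of C]) (use le in auto)
qed

lemma has_real_derivative_zero_of_quadratic_bound:
  fixes f :: "real \<Rightarrow> real"
  assumes "\<And>s. \<bar>f s\<bar> \<le> C * (s - a)\<^sup>2"
  shows "(f has_real_derivative 0) (at a)"
proof -
  have a: "f a = 0" using assms[of a] by simp
  have "((\<lambda>s. (f s - f a) / (s - a)) \<longlongrightarrow> 0) (at a)"
  proof (rule Lim_null_comparison)
    show "\<forall>\<^sub>F s in at a. norm ((f s - f a) / (s - a)) \<le> C * \<bar>s - a\<bar>"
    proof (rule always_eventually, rule allI)
      fix s show "norm ((f s - f a) / (s - a)) \<le> C * \<bar>s - a\<bar>"
      proof (cases "s = a")
        case False
        have "\<bar>f s\<bar> \<le> C * \<bar>s - a\<bar> * \<bar>s - a\<bar>" using assms[of s] 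
          by (simp add: power2_eq_square mult.assoc)
        then show ?thesis using False a by (simp add: pos_divide_le_eq)
      qed simp
    qed
    have "((\<lambda>s. C * \<bar>s - a\<bar>) \<longlongrightarrow> C * \<bar>a - a\<bar>) (at a)" by (intro tendsto_intros)
    then show "((\<lambda>s. C * \<bar>s - a\<bar>) \<longlongrightarrow> 0) (at a)" by simp
  qed
  then show ?thesis by (simp add: has_field_derivative_iff)
qed

lemma bump_has_derivative:
  "(bump P k has_real_derivative bump (bump_deriv_poly P k) (k + 2) s) (at s)"
proof -
  obtain C where C: "\<And>s. \<bar>bump P k s\<bar> \<le> C * s\<^sup>2" "\<And>s. \<bar>bump P k s\<bar> \<le> C * (s - 1)\<^sup>2"
    using bump_quadratic_bound[of P k] by blast
  consider "s < 0 \<or> 1 < s" | "s = 0" | "s = 1" | "0 < s" "s < 1" by linarith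
  then show ?thesis
  proof cases
    case 1
    have "((\<lambda>s. 0) has_real_derivative 0) (at s)" by simp
    then have "(bump P k has_real_derivative 0) (at s)"
      by (rule has_field_derivative_transform_within_open[where S = "{..<0} \<union> {1<..}"])
         (use 1 in \<open>auto simp: bump_def\<close>)
    then show ?thesis using 1 by (auto simp: bump_def)
  next
    case 2 then show ?thesis
      using has_real_derivative_zero_of_quadratic_bound[of "bump P k" C 0] C by (simp add: bump_def)
  next
    case 3 then show ?thesis
      using has_real_derivative_zero_of_quadratic_bound[of "bump P k" C 1] C by (simp add: bump_def)
  next
    case 4
    define q where "q = s * (1 - s)"
    have q: "q \<noteq> 0" using 4 by (simp add: q_def)
    let ?f = "\<lambda>s. poly P s * (1 / (s * (1 - s))) ^ k * exp (- (1 / (s * (1 - s))))"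
    define r where "r = (\<lambda>s::real. 1 / (s * (1 - s)))"
    have d: "(r has_real_derivative - ((1 - 2 * s) / q\<^sup>2)) (at s)"
      using 4 unfolding q_def r_def
      by (auto intro!: derivative_eq_intros simp: divide_simps power2_eq_square) (simp add: algebra_simps)?
    have "((\<lambda>s. poly P s * r s ^ k * exp (- r s)) has_real_derivative
        (poly (pderiv P) s * r s ^ k + poly P s * (of_nat k * (- ((1 - 2 * s) / q\<^sup>2)) * r s ^ (k - 1)))
          * exp (- r s)
        + poly P s * r s ^ k * (exp (- r s) * ((1 - 2 * s) / q\<^sup>2))) (at s)"
      by (rule derivative_eq_intros d refl poly_DERIV | simp add: algebra_simps)+
    moreover have "r s = 1 / q" by (simp add: r_def q_def)
    ultimately have "(?f has_real_derivative
        (poly (pderiv P) s * (1 / q) ^ k + poly P s * (of_nat k * (- ((1 - 2 * s) / q\<^sup>2)) * (1 / q) ^ (k - 1)))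
          * exp (- (1 / q))
        + poly P s * (1 / q) ^ k * (exp (- (1 / q)) * ((1 - 2 * s) / q\<^sup>2))) (at s)"
      unfolding r_def by simp
    \<comment> \<open>\<open>k - 1\<close> is truncated subtraction; for \<open>k = 0\<close> the
      factor \<open>of_nat k\<close> makes both sides vanish.\<close>
    moreover have "of_nat k * (1 / q) ^ (k - 1) = of_nat k * (1 / q) ^ k * q"
      using q by (cases k) auto
    then have k: "poly P s * (of_nat k * (- ((1 - 2 * s) / q\<^sup>2)) * (1 / q) ^ (k - 1)) =
      - poly P s * (1 - 2 * s) / q\<^sup>2 * (of_nat k * (1 / q) ^ k * q)"
      using q by auto
    have "(poly (pderiv P) s * (1 / q) ^ k + poly P s * (of_nat k * (- ((1 - 2 * s) / q\<^sup>2)) * (1 / q) ^ (k - 1)))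
          * exp (- (1 / q))
        + poly P s * (1 / q) ^ k * (exp (- (1 / q)) * ((1 - 2 * s) / q\<^sup>2))
       = bump (bump_deriv_poly P k) (k + 2) s"
    proof -
      have e: "bump (bump_deriv_poly P k) (k + 2) s =
         poly (bump_deriv_poly P k) s * (1/q)^k * (1/q)\<^sup>2 * exp (- (1 / q))"
        using 4 by (simp add: bump_def q_def power_add power2_eq_square)
      have p: "poly (bump_deriv_poly P k) s =
          poly (pderiv P) s * q\<^sup>2 - of_nat k * poly P s * (1 - 2 * s) * q + poly P s * (1 - 2 * s)"
        by (simp add: bump_deriv_poly_def q_def power2_eq_square algebra_simps)
      show ?thesis unfolding e p k using q
        by (simp add: field_simps power2_eq_square)
    qed
    ultimately have "(?f has_real_derivative bump (bump_deriv_poly P k) (k + 2) s) (at s)" by simp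
    then show ?thesis
      by (rule has_field_derivative_transform_within_open[where S = "{0<..<1}"])
         (use 4 in \<open>auto simp: bump_def\<close>)
  qed
qed

lemma continuous_on_bump [continuous_intros]:
  "continuous_on S f \<Longrightarrow> continuous_on S (\<lambda>x. bump P k (f x))"
  using continuous_on_compose2[of UNIV "bump P k" S f]
  by (meson DERIV_isCont bump_has_derivative continuous_at_imp_continuous_on subset_UNIV)

text \<open>The support lies in the cube with lower corner \<open>a\<close> and side
  \<open>t\<close>. The scalar \<open>c\<close> collects the factors \<open>1 / t\<close> of the
  chain rule, so that every partial derivative has this form again.\<close>

definition bump_prod :: "real \<Rightarrow> ('n \<Rightarrow> real poly) \<Rightarrow> ('n \<Rightarrow> nat) \<Rightarrow> real^'n \<Rightarrow> real \<Rightarrow> real^'n \<Rightarrow> real" where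
  "bump_prod c P k a t x = c * (\<Prod>i\<in>UNIV. bump (P i) (k i) ((x $ i - a $ i) / t))"

lemma bump_prod_has_derivative:
  assumes "t > 0"
  shows "(bump_prod c P k a t has_derivative
    (\<lambda>v. \<Sum>j\<in>UNIV. v $ j * bump_prod (c / t) (P(j := bump_deriv_poly (P j) (k j))) (k(j := k j + 2)) a t x)) (at x)"
proof -
  let ?f = "\<lambda>i x. bump (P i) (k i) ((x $ i - a $ i) / t)"
  let ?d = "\<lambda>i. bump (bump_deriv_poly (P i) (k i)) (k i + 2) ((x $ i - a $ i) / t)"
  have f: "(?f i has_derivative (\<lambda>v. v $ i / t * ?d i)) (at x)" for i
  proof -
    have "((\<lambda>x. (x $ i - a $ i) / t) has_derivative (\<lambda>v. v $ i / t)) (at x)"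
      unfolding divide_inverse
      by (auto intro!: has_derivative_mult_left has_derivative_diff[where g'="\<lambda>_. 0", simplified]
          bounded_linear_imp_has_derivative bounded_linear_vec_nth)
    moreover have "(bump (P i) (k i) has_derivative (*) (?d i)) (at ((x $ i - a $ i) / t))"
      using bump_has_derivative by (simp add: has_field_derivative_def)
    ultimately have "(?f i has_derivative (\<lambda>v. ?d i * (v $ i / t))) (at x)"
      by (rule has_derivative_compose)
    then show ?thesis by (simp only: mult.commute)
  qed
  have "bump_prod c P k a t = (\<lambda>x. c * (\<Prod>i\<in>UNIV. ?f i x))" by (simp add: bump_prod_def fun_eq_iff)
  moreover have "((\<lambda>x. c * (\<Prod>i\<in>UNIV. ?f i x)) has_derivative
     (\<lambda>v. c * (\<Sum>i\<in>UNIV. v $ i / t * ?d i * (\<Prod>j\<in>UNIV - {i}. ?f j x)))) (at x)"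
    by (intro has_derivative_mult_right has_derivative_prod f)
  moreover have "c * (\<Sum>i\<in>UNIV. v $ i / t * ?d i * (\<Prod>j\<in>UNIV - {i}. ?f j x)) =
     (\<Sum>j\<in>UNIV. v $ j * bump_prod (c / t) (P(j := bump_deriv_poly (P j) (k j))) (k(j := k j + 2)) a t x)" for v
  proof -
    have "bump_prod (c / t) (P(i := bump_deriv_poly (P i) (k i))) (k(i := k i + 2)) a t x =
       c / t * (?d i * (\<Prod>j\<in>UNIV - {i}. ?f j x))" for i
      unfolding bump_prod_def by (subst prod.remove[of _ i]) (auto intro!: prod.cong)
    then show ?thesis by (simp add: sum_distrib_left mult_ac)
  qed
  ultimately show ?thesis by simp
qed

lemma sum_axis_mult: "(\<Sum>i\<in>UNIV. axis j (1::real) $ i * g i) = g j"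
proof -
  have "axis j (1::real) $ i * g i = (if i = j then g i else 0)" for i by (simp add: axis_def)
  then show ?thesis by simp
qed

lemma sum_Basis_nth [simp]: "(\<Sum>b\<in>Basis. (b :: real^'n) $ i) = 1"
  using inner_sum_left_Basis[of "axis i 1 :: real^'n" "\<lambda>_. 1"] by (simp add: inner_axis axis_in_Basis_iff)

lemma partial_deriv_bump_prod:
  assumes "t > 0"
  shows "partial_deriv j (bump_prod c P k a t) =
    bump_prod (c / t) (P(j := bump_deriv_poly (P j) (k j))) (k(j := k j + 2)) a t"
proof
  fix x
  have "frechet_derivative (bump_prod c P k a t) (at x) =
    (\<lambda>v. \<Sum>j\<in>UNIV. v $ j * bump_prod (c / t) (P(j := bump_deriv_poly (P j) (k j))) (k(j := k j + 2)) a t x)"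
    by (rule frechet_derivative_at[OF bump_prod_has_derivative[OF assms], symmetric])
  then show "partial_deriv j (bump_prod c P k a t) x =
    bump_prod (c / t) (P(j := bump_deriv_poly (P j) (k j))) (k(j := k j + 2)) a t x"
    by (simp only: partial_deriv_def sum_axis_mult)
qed

lemma continuous_on_bump_prod: "continuous_on S (bump_prod c P k a t)"
proof (cases "t = 0")
  case False
  then show ?thesis unfolding bump_prod_def by (intro continuous_intros) auto
qed (simp add: bump_prod_def)

lemma C_k_bump_prod: "t > 0 \<Longrightarrow> C_k m (bump_prod c P k a t)"
proof (induction m arbitrary: c P k)
  case 0 then show ?case by (simp add: continuous_on_bump_prod)
next
  case (Suc m)
  then show ?case
    by (simp add: partial_deriv_bump_prod differentiableI[OF bump_prod_has_derivative])
qed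

lemma bump_prod_nonzeroD:
  assumes "bump_prod c P k a t x \<noteq> 0" "t > 0"
  shows "a $ i < x $ i" "x $ i < a $ i + t"
proof -
  have "bump (P i) (k i) ((x $ i - a $ i) / t) \<noteq> 0"
    using assms by (auto simp: bump_prod_def)
  then have "0 < (x $ i - a $ i) / t" "(x $ i - a $ i) / t < 1"
    by (auto simp: bump_def split: if_splits)
  then show "a $ i < x $ i" "x $ i < a $ i + t" using assms(2) by (auto simp: field_simps)
qed

lemma test_function_bump_prod:
  assumes "t > 0" "cbox a (a + t *\<^sub>R One) \<subseteq> \<Omega>"
  shows "test_function \<Omega> (bump_prod c P k a t)"
proof -
  have "{x. bump_prod c P k a t x \<noteq> 0} \<subseteq> cbox a (a + t *\<^sub>R One)"
    using bump_prod_nonzeroD[of c P k a t, OF _ assms(1)] by (auto simp: mem_box_cart less_imp_le)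
  then have "closure {x. bump_prod c P k a t x \<noteq> 0} \<subseteq> cbox a (a + t *\<^sub>R One)"
    by (rule closure_minimal) auto
  moreover from this have "compact (closure {x. bump_prod c P k a t x \<noteq> 0})"
    by (meson bounded_cbox bounded_subset closed_closure compact_eq_bounded_closed)
  ultimately show ?thesis using assms by (auto simp: test_function_def C_k_bump_prod)
qed

section \<open>Weak gradients of Lipschitz maps\<close>

lemma test_function_properties:
  fixes \<phi> :: "real^'n \<Rightarrow> real"
  assumes "test_function \<Omega> \<phi>"
  obtains R B where "continuous_on UNIV \<phi>" "continuous_on UNIV (partial_deriv j \<phi>)"
    "\<And>x. (\<phi> has_derivative frechet_derivative \<phi> (at x)) (at x)"
    "\<And>x. x \<notin> \<Omega> \<Longrightarrow> \<phi> x = 0 \<and> partial_deriv j \<phi> x = 0"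
    "\<And>x. x \<notin> cball 0 R \<Longrightarrow> \<phi> x = 0 \<and> partial_deriv j \<phi> x = 0"
    "\<And>x. \<bar>\<phi> x\<bar> \<le> B" "\<And>x. \<bar>partial_deriv j \<phi> x\<bar> \<le> B" "0 \<le> B"
proof -
  let ?K = "closure {x. \<phi> x \<noteq> 0}"
  have C: "C_k k \<phi>" for k using assms by (simp add: test_function_def)
  have K: "compact ?K" "?K \<subseteq> \<Omega>" using assms by (auto simp: test_function_def)
  have diff: "\<phi> differentiable at x" for x using C[of 1] by simp
  have cont: "continuous_on UNIV \<phi>" "continuous_on UNIV (partial_deriv j \<phi>)"
    using C[of 0] C[of 1] by auto
  have zero: "\<phi> x = 0 \<and> partial_deriv j \<phi> x = 0" if "x \<notin> ?K" for x
  proof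
    show "\<phi> x = 0" using that closure_subset[of "{x. \<phi> x \<noteq> 0}"] by auto
    have "((\<lambda>x. 0) has_derivative (\<lambda>v. 0)) (at x)" by simp
    then have "(\<phi> has_derivative (\<lambda>v. 0)) (at x)"
      by (rule has_derivative_transform_within_open[where s = "- ?K"])
         (use that closure_subset[of "{x. \<phi> x \<noteq> 0}"] in auto)
    then show "partial_deriv j \<phi> x = 0"
      by (simp add: partial_deriv_def frechet_derivative_at[symmetric])
  qed
  obtain R where R: "\<And>x. x \<in> ?K \<Longrightarrow> norm x \<le> R"
    using K(1) compact_imp_bounded bounded_iff by metis
  have bd: "\<exists>B. \<forall>x\<in>?K. \<bar>f x\<bar> \<le> B" if "continuous_on UNIV f" for f :: "real^'n \<Rightarrow> real"
    using compact_imp_bounded[OF compact_continuous_image[OF continuous_on_subset[OF that] K(1)]]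
    by (auto simp: bounded_iff)
  obtain B1 B2 where B: "\<And>x. x \<in> ?K \<Longrightarrow> \<bar>\<phi> x\<bar> \<le> B1" "\<And>x. x \<in> ?K \<Longrightarrow> \<bar>partial_deriv j \<phi> x\<bar> \<le> B2"
    using bd cont by metis
  have "\<bar>\<phi> x\<bar> \<le> max 0 (max B1 B2)" "\<bar>partial_deriv j \<phi> x\<bar> \<le> max 0 (max B1 B2)" for x
    by (cases "x \<in> ?K"; use B[of x] zero[of x] in force)+
  moreover have "(\<phi> has_derivative frechet_derivative \<phi> (at x)) (at x)" for x
    using diff frechet_derivative_works by blast
  moreover have "\<phi> x = 0 \<and> partial_deriv j \<phi> x = 0" if "x \<notin> \<Omega>" for x
    using zero K(2) that by blast
  moreover have "\<phi> x = 0 \<and> partial_deriv j \<phi> x = 0" if "x \<notin> cball 0 R" for x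
    using zero R that by (metis mem_cball_0)
  ultimately show thesis
    using cont by (intro that[where R = R and B = "max 0 (max B1 B2)"]) auto
qed

lemma integral_lebesgue_on_eq_of_vanish:
  fixes f :: "real^'n \<Rightarrow> real"
  assumes "\<Omega> \<in> sets lebesgue" "\<And>x. x \<notin> \<Omega> \<Longrightarrow> f x = 0"
  shows "integral\<^sup>L (lebesgue_on \<Omega>) f = integral\<^sup>L lebesgue f"
  using assms by (subst integral_restrict_space) (auto intro!: Bochner_Integration.integral_cong simp: indicator_def)

lemma integral_lebesgue_translate:
  fixes f :: "real^'n \<Rightarrow> real"
  assumes "continuous_on UNIV f"
  shows "(LINT x|lebesgue. f (x + a)) = (LINT x|lebesgue. f x)"
proof -
  have [measurable]: "f \<in> borel_measurable borel" using assms by (rule borel_measurable_continuous_onI)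
  have "(LINT x|lebesgue. f (x + a)) = (LINT x|lborel. f (a + x))"
    by (subst integral_completion) (auto simp: add.commute)
  also have "\<dots> = (LINT x|distr lborel borel ((+) a). f x)" by (subst integral_distr) auto
  also have "\<dots> = (LINT x|lebesgue. f x)"
    by (simp add: lborel_distr_plus integral_completion)
  finally show ?thesis .
qed

lemma borel_measurable_lebesgue_continuous:
  "continuous_on UNIV (f :: 'a::euclidean_space \<Rightarrow> 'b::topological_space) \<Longrightarrow> f \<in> borel_measurable lebesgue"
  by (simp add: borel_measurable_continuous_onI measurable_completion)

text \<open>Integration by parts at the level of difference quotients: translation invariance moves
  the quotient from \<open>\<phi>\<close> to \<open>U\<close>, and both sides pass to the limit by
  dominated convergence. The mean value theorem bounds the quotients of \<open>\<phi>\<close>, the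
  Lipschitz constant those of \<open>U\<close>, so convergence almost everywhere is enough for
  \<open>U\<close>.\<close>

lemma weak_partial_derivative_lipschitz:
  fixes U D :: "real^'n \<Rightarrow> real"
  assumes lip: "L-lipschitz_on UNIV U" and D: "D \<in> borel_measurable lebesgue"
    and ae: "AE x in lebesgue. ((\<lambda>s. (U (x + s *\<^sub>R axis j 1) - U x) / s) \<longlongrightarrow> D x) (at 0)"
    and \<Omega>: "\<Omega> \<in> sets lebesgue" and \<phi>: "test_function \<Omega> \<phi>"
  shows "(LINT x|lebesgue_on \<Omega>. U x * partial_deriv j \<phi> x) = - (LINT x|lebesgue_on \<Omega>. D x * \<phi> x)"
proof -
  define e :: "real^'n" where "e = axis j 1"
  have e1: "norm e = 1" by (simp add: e_def)
  obtain R B where \<phi>p: "continuous_on UNIV \<phi>" "continuous_on UNIV (partial_deriv j \<phi>)"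
    "\<And>x. (\<phi> has_derivative frechet_derivative \<phi> (at x)) (at x)"
    "\<And>x. x \<notin> \<Omega> \<Longrightarrow> \<phi> x = 0 \<and> partial_deriv j \<phi> x = 0"
    "\<And>x. x \<notin> cball 0 R \<Longrightarrow> \<phi> x = 0 \<and> partial_deriv j \<phi> x = 0"
    and B: "\<And>x. \<bar>\<phi> x\<bar> \<le> B" "\<And>x. \<bar>partial_deriv j \<phi> x\<bar> \<le> B" "0 \<le> B"
    using test_function_properties[OF \<phi>, of j] by blast
  have L0: "0 \<le> L" using lip by (rule lipschitz_on_nonneg)
  have Uc: "continuous_on UNIV U" using lip by (rule lipschitz_on_continuous_on)
  \<comment> \<open>Steps bounded by 1 keep every shifted test function supported in
    \<open>cball 0 (R + 1)\<close>.\<close>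
  define s where "s = (\<lambda>k. 1 / real (Suc k))"
  have s: "0 < s k" "s k \<le> 1" for k by (auto simp: s_def)
  have slim: "s \<longlonglongrightarrow> 0" unfolding s_def using LIMSEQ_inverse_real_of_nat by (simp add: inverse_eq_divide)
  have deriv: "((\<lambda>t. \<phi> (x + t *\<^sub>R e)) has_real_derivative partial_deriv j \<phi> (x + t *\<^sub>R e)) (at t)" for x t
  proof -
    have "((\<lambda>t. x + t *\<^sub>R e) has_derivative (\<lambda>t. t *\<^sub>R e)) (at t)"
      by (auto intro!: derivative_eq_intros)
    from has_derivative_compose[OF this \<phi>p(3)]
    have "((\<lambda>t. \<phi> (x + t *\<^sub>R e)) has_derivative (\<lambda>h. frechet_derivative \<phi> (at (x + t *\<^sub>R e)) (h *\<^sub>R e))) (at t)" .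
    moreover have "frechet_derivative \<phi> (at (x + t *\<^sub>R e)) (h *\<^sub>R e) = partial_deriv j \<phi> (x + t *\<^sub>R e) * h" for h
      using linear_cmul[OF has_derivative_linear[OF \<phi>p(3)]] by (simp add: partial_deriv_def e_def)
    ultimately show ?thesis by (simp add: has_field_derivative_def)
  qed
  obtain UB where UB: "\<And>x. x \<in> cball 0 (R + 1) \<Longrightarrow> \<bar>U x\<bar> \<le> UB"
    using compact_imp_bounded[OF compact_continuous_image[OF continuous_on_subset[OF Uc] compact_cball[of 0 "R + 1"]]]
    by (force simp: bounded_iff)
  have ind [simp]: "integrable lebesgue (indicator (cball 0 r) :: real^'n \<Rightarrow> real)" for r
    using lmeasurable_cball[of "0::real^'n" r] by (auto simp: fmeasurable_def intro!: integrable_real_indicator)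
  then have fin: "integrable lebesgue (\<lambda>x::real^'n. c * indicator (cball 0 r) x :: real)" for c r
    by simp
  have nR: "\<phi> (x + s k *\<^sub>R e) = 0" "\<phi> x = 0" if "x \<notin> cball 0 (R + 1)" for x k
  proof -
    have "norm x \<le> norm (x + s k *\<^sub>R e) + s k"
      using norm_triangle_ineq4[of "x + s k *\<^sub>R e" "s k *\<^sub>R e"] s[of k] e1 by simp
    then have "x + s k *\<^sub>R e \<notin> cball 0 R" "x \<notin> cball 0 R" using that s[of k] by auto
    then show "\<phi> (x + s k *\<^sub>R e) = 0" "\<phi> x = 0" using \<phi>p(5) by auto
  qed
  have I: "(\<lambda>k. LINT x|lebesgue. U x * ((\<phi> (x + s k *\<^sub>R e) - \<phi> x) / s k))
      \<longlonglongrightarrow> (LINT x|lebesgue. U x * partial_deriv j \<phi> x)"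
  proof (rule integral_dominated_convergence[where w = "\<lambda>x. (UB * B) * indicator (cball 0 (R + 1)) x"])
    show "AE x in lebesgue. (\<lambda>k. U x * ((\<phi> (x + s k *\<^sub>R e) - \<phi> x) / s k)) \<longlonglongrightarrow> U x * partial_deriv j \<phi> x"
    proof (intro always_eventually allI tendsto_mult_left)
      fix x
      have "((\<lambda>h. (\<phi> (x + h *\<^sub>R e) - \<phi> x) / h) \<longlongrightarrow> partial_deriv j \<phi> x) (at 0)"
        using deriv[of x 0] by (simp add: has_field_derivative_iff)
      then show "(\<lambda>k. (\<phi> (x + s k *\<^sub>R e) - \<phi> x) / s k) \<longlonglongrightarrow> partial_deriv j \<phi> x"
        by (rule filterlim_compose) (use slim s in \<open>auto simp: filterlim_at intro!: always_eventually less_imp_neq[symmetric]\<close>)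
    qed
    show "AE x in lebesgue. norm (U x * ((\<phi> (x + s k *\<^sub>R e) - \<phi> x) / s k)) \<le> UB * B * indicator (cball 0 (R + 1)) x" for k
    proof (rule always_eventually, rule allI)
      fix x
      show "norm (U x * ((\<phi> (x + s k *\<^sub>R e) - \<phi> x) / s k)) \<le> UB * B * indicator (cball 0 (R + 1)) x"
      proof (cases "x \<in> cball 0 (R + 1)")
        case True
        have "\<exists>z. z > 0 \<and> z < s k \<and> \<phi> (x + s k *\<^sub>R e) - \<phi> (x + 0 *\<^sub>R e) = (s k - 0) * partial_deriv j \<phi> (x + z *\<^sub>R e)"
          using s deriv by (intro MVT2) auto
        then obtain z where "\<phi> (x + s k *\<^sub>R e) - \<phi> x = s k * partial_deriv j \<phi> (x + z *\<^sub>R e)" by auto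
        then have "\<bar>(\<phi> (x + s k *\<^sub>R e) - \<phi> x) / s k\<bar> \<le> B" using s[of k] B(2) by simp
        then have "\<bar>U x\<bar> * \<bar>(\<phi> (x + s k *\<^sub>R e) - \<phi> x) / s k\<bar> \<le> UB * B"
          using UB[OF True] by (intro mult_mono) auto
        then show ?thesis using True by (simp add: abs_mult)
      next
        case False
        then show ?thesis by (simp add: nR)
      qed
    qed
  qed (use s in \<open>auto intro!: borel_measurable_lebesgue_continuous continuous_intros Uc \<phi>p fin
         continuous_on_compose2[OF \<phi>p(1)] less_imp_neq[symmetric]\<close>)
  \<comment> \<open>The quotient of \<open>U\<close> runs backwards, since a shift of
    \<open>\<phi>\<close> by \<open>s k\<close> becomes a shift of \<open>U\<close> by
    \<open>- s k\<close>; hence the limit \<open>- D x\<close>.\<close>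
  have J: "(\<lambda>k. LINT x|lebesgue. ((U (x - s k *\<^sub>R e) - U x) / s k) * \<phi> x)
      \<longlonglongrightarrow> (LINT x|lebesgue. - (D x) * \<phi> x)"
  proof (rule integral_dominated_convergence[where w = "\<lambda>x. (L * B) * indicator (cball 0 R) x"])
    show "AE x in lebesgue. (\<lambda>k. (U (x - s k *\<^sub>R e) - U x) / s k * \<phi> x) \<longlonglongrightarrow> - (D x) * \<phi> x"
      using ae
    proof eventually_elim
      case (elim x)
      have "filterlim (\<lambda>k. - s k) (at 0) sequentially"
        using tendsto_minus[OF slim] s by (auto simp: filterlim_at intro!: always_eventually less_imp_neq[symmetric])
      from tendsto_minus[OF filterlim_compose[OF elim this]]
      have "(\<lambda>k. (U (x - s k *\<^sub>R e) - U x) / s k) \<longlonglongrightarrow> - D x" by (simp add: e_def)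
      then show ?case by (intro tendsto_mult tendsto_const)
    qed
    show "AE x in lebesgue. norm ((U (x - s k *\<^sub>R e) - U x) / s k * \<phi> x) \<le> L * B * indicator (cball 0 R) x" for k
    proof (rule always_eventually, rule allI)
      fix x
      have "\<bar>U (x - s k *\<^sub>R e) - U x\<bar> \<le> L * s k"
        using lipschitz_onD[OF lip, of "x - s k *\<^sub>R e" x] e1 s[of k] by (simp add: dist_norm)
      then have "\<bar>(U (x - s k *\<^sub>R e) - U x) / s k\<bar> \<le> L" using s[of k] by (simp add: field_simps)
      then have "\<bar>(U (x - s k *\<^sub>R e) - U x) / s k\<bar> * \<bar>\<phi> x\<bar> \<le> L * B"
        using B(1) L0 by (intro mult_mono) auto
      then show "norm ((U (x - s k *\<^sub>R e) - U x) / s k * \<phi> x) \<le> L * B * indicator (cball 0 R) x"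
        using \<phi>p(5)[of x] by (cases "x \<in> cball 0 R") (simp_all add: abs_mult)
    qed
    show "(\<lambda>x. - D x * \<phi> x) \<in> borel_measurable lebesgue"
      by (intro borel_measurable_times borel_measurable_uminus D borel_measurable_lebesgue_continuous \<phi>p)
  qed (use s in \<open>auto intro!: borel_measurable_lebesgue_continuous continuous_intros Uc \<phi>p fin
         continuous_on_compose2[OF Uc] less_imp_neq[symmetric]\<close>)
  have eq: "(LINT x|lebesgue. U x * ((\<phi> (x + s k *\<^sub>R e) - \<phi> x) / s k)) =
      (LINT x|lebesgue. ((U (x - s k *\<^sub>R e) - U x) / s k) * \<phi> x)" for k
  proof -
    have i: "integrable lebesgue g" if gc: "continuous_on UNIV g" and gz: "\<And>x. x \<notin> cball 0 (R + 1) \<Longrightarrow> g x = 0"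
      for g :: "real^'n \<Rightarrow> real"
    proof -
      obtain GB where GB: "\<And>x. x \<in> cball 0 (R + 1) \<Longrightarrow> \<bar>g x\<bar> \<le> GB"
        using compact_imp_bounded[OF compact_continuous_image[OF continuous_on_subset[OF gc] compact_cball[of 0 "R + 1"]]]
        by (force simp: bounded_iff)
      show ?thesis
        by (rule Bochner_Integration.integrable_bound[OF fin[of GB "R + 1"]])
           (use GB gc gz in \<open>auto intro!: borel_measurable_lebesgue_continuous always_eventually
             order_trans[OF _ abs_ge_self] simp: indicator_def\<close>)
    qed
    have c: "continuous_on UNIV (\<lambda>x. U x * \<phi> (x + s k *\<^sub>R e))" "continuous_on UNIV (\<lambda>x. U x * \<phi> x)"
      "continuous_on UNIV (\<lambda>x. U (x - s k *\<^sub>R e) * \<phi> x)"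
      by (auto intro!: continuous_intros Uc \<phi>p(1) continuous_on_compose2[OF Uc] continuous_on_compose2[OF \<phi>p(1)])
    have i3: "integrable lebesgue (\<lambda>x. U x * \<phi> (x + s k *\<^sub>R e))" "integrable lebesgue (\<lambda>x. U x * \<phi> x)"
      "integrable lebesgue (\<lambda>x. U (x - s k *\<^sub>R e) * \<phi> x)"
      by (intro i c; simp add: nR)+
    have t: "(LINT x|lebesgue. U x * \<phi> (x + s k *\<^sub>R e)) = (LINT x|lebesgue. U (x - s k *\<^sub>R e) * \<phi> x)"
      using integral_lebesgue_translate[OF c(3), of "s k *\<^sub>R e"] by simp
    have "(LINT x|lebesgue. U x * ((\<phi> (x + s k *\<^sub>R e) - \<phi> x) / s k)) =
      (LINT x|lebesgue. (U x * \<phi> (x + s k *\<^sub>R e) - U x * \<phi> x) / s k)"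
      by (simp add: algebra_simps)
    also have "\<dots> = ((LINT x|lebesgue. U x * \<phi> (x + s k *\<^sub>R e)) - (LINT x|lebesgue. U x * \<phi> x)) / s k"
      using i3 by simp
    also have "\<dots> = (LINT x|lebesgue. (U (x - s k *\<^sub>R e) * \<phi> x - U x * \<phi> x) / s k)"
      using i3 by (simp add: t)
    also have "\<dots> = (LINT x|lebesgue. ((U (x - s k *\<^sub>R e) - U x) / s k) * \<phi> x)"
      by (simp add: algebra_simps)
    finally show ?thesis .
  qed
  have "(LINT x|lebesgue. U x * partial_deriv j \<phi> x) = - (LINT x|lebesgue. D x * \<phi> x)"
    using LIMSEQ_unique[OF I J[folded eq]] by simp
  then show ?thesis
    using \<phi>p(4) \<Omega> by (simp add: integral_lebesgue_on_eq_of_vanish)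
qed

section \<open>Generating the special linear group\<close>

definition diag_matrix :: "('n \<Rightarrow> real) \<Rightarrow> real^'n^'n" where
  "diag_matrix a = (\<chi> i j. if i = j then a i else 0)"

text \<open>The chosen matrix of determinant \<open>t\<close>: every invertible matrix will be
  reduced to one of these, and \<open>H\<close> is read off along them.\<close>

definition dilation :: "'n \<Rightarrow> real \<Rightarrow> real^'n^'n" where
  "dilation k t = diag_matrix (\<lambda>i. if i = k then t else 1)"

lemma diag_matrix_mult_left: "diag_matrix a ** A = (\<chi> i j. a i * A $ i $ j)"
  by (simp add: diag_matrix_def matrix_matrix_mult_def mult_delta_left)

lemma diag_matrix_mult_right: "A ** diag_matrix a = (\<chi> i j. A $ i $ j * a j)"
  by (simp add: diag_matrix_def matrix_matrix_mult_def mult_delta_right)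

lemma diag_matrix_mult: "diag_matrix a ** diag_matrix b = diag_matrix (\<lambda>i. a i * b i)"
  by (simp add: diag_matrix_mult_left) (simp add: diag_matrix_def vec_eq_iff)

lemma diag_matrix_eq_mat_1: "diag_matrix (\<lambda>i. 1) = mat 1"
  by (simp add: diag_matrix_def mat_def)

lemma det_diag_matrix: "det (diag_matrix a) = (\<Prod>i\<in>UNIV. a i)"
  by (subst det_diagonal) (auto simp: diag_matrix_def)

lemma det_dilation [simp]: "det (dilation k t) = t"
  by (simp add: dilation_def det_diag_matrix)

lemma dilation_mult: "dilation k s ** dilation k t = dilation k (s * t)"
  unfolding dilation_def diag_matrix_mult by (rule arg_cong[where f = diag_matrix]) auto

lemma dilation_1: "dilation k 1 = mat 1"
  by (simp add: dilation_def diag_matrix_eq_mat_1)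

lemma dilation_inverse: "t \<noteq> 0 \<Longrightarrow> dilation k t ** dilation k (1 / t) = mat 1"
  by (simp add: dilation_mult dilation_1)

text \<open>This and \<open>transvection\<close> are written in the exact shape of the generators in
  \<open>induct_matrix_elementary\<close>, so that its cases can be folded.
  \<open>Transposition.transpose\<close> is the permutation exchanging two indices, not the matrix
  transpose.\<close>

definition swap_matrix :: "'n \<Rightarrow> 'n \<Rightarrow> real^'n^'n" where
  "swap_matrix m n = (\<chi> i j. mat 1 $ i $ Transposition.transpose m n j)"

definition transvection :: "'n \<Rightarrow> 'n \<Rightarrow> real \<Rightarrow> real^'n^'n" where
  "transvection m n c = (\<chi> i j. if i = m \<and> j = n then c else of_bool (i = j))"

lemma swap_matrix_mult_right: "A ** swap_matrix m n = (\<chi> i j. A $ i $ Transposition.transpose m n j)"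
  by (simp add: swap_matrix_def mat_def matrix_matrix_mult_def mult_delta_right)

lemma swap_matrix_mult_left: "swap_matrix m n ** A = (\<chi> i j. A $ Transposition.transpose m n i $ j)"
proof -
  have "swap_matrix m n $ i $ k = (if k = Transposition.transpose m n i then 1 else 0)" for i k
    by (auto simp: swap_matrix_def mat_def)
  then show ?thesis by (simp add: matrix_matrix_mult_def mult_delta_left)
qed

lemma swap_matrix_involution: "swap_matrix m n ** swap_matrix m n = mat 1"
  unfolding swap_matrix_mult_right by (simp add: swap_matrix_def vec_eq_iff)

lemma swap_diag_swap:
  "swap_matrix m n ** diag_matrix a ** swap_matrix m n = diag_matrix (\<lambda>i. a (Transposition.transpose m n i))"
  unfolding swap_matrix_mult_right swap_matrix_mult_left
  by (simp add: diag_matrix_def vec_eq_iff) (metis transpose_involutory)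

lemma det_swap_matrix: "m \<noteq> n \<Longrightarrow> det (swap_matrix m n :: real^'n^'n) = - 1"
  unfolding swap_matrix_def by (subst det_permute_columns) (auto simp: permutes_swap_id sign_swap_id)

lemma transpose_swap_matrix: "transpose (swap_matrix m n) = swap_matrix m n"
  by (auto simp: transpose_def swap_matrix_def mat_def vec_eq_iff)

lemma transpose_diag_matrix: "transpose (diag_matrix a) = diag_matrix a"
  by (auto simp: transpose_def diag_matrix_def vec_eq_iff)

lemma transvection_mult_left:
  "m \<noteq> n \<Longrightarrow> transvection m n c ** A = (\<chi> i j. A $ i $ j + (if i = m then c * A $ n $ j else 0))"
proof -
  assume mn: "m \<noteq> n"
  have "(\<Sum>k\<in>UNIV. transvection m n c $ i $ k * A $ k $ j) = A $ i $ j + (if i = m then c * A $ n $ j else 0)" for i j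
  proof -
    have "transvection m n c $ i $ k * A $ k $ j =
      (if k = i then A $ k $ j else 0) + (if k = n then (if i = m then c * A $ k $ j else 0) else 0)" for k
      using mn by (auto simp: transvection_def)
    then show ?thesis by (simp add: sum.distrib)
  qed
  then show ?thesis by (simp add: matrix_matrix_mult_def)
qed

lemma transvection_mult:
  "m \<noteq> n \<Longrightarrow> transvection m n c ** transvection m n d = transvection m n (c + d)"
  by (subst transvection_mult_left) (auto simp: transvection_def vec_eq_iff)

lemma transvection_inverse: "m \<noteq> n \<Longrightarrow> transvection m n c ** transvection m n (- c) = mat 1"
  by (subst transvection_mult) (auto simp: transvection_def mat_def vec_eq_iff)

lemma det_transvection: "m \<noteq> n \<Longrightarrow> det (transvection m n c :: real^'n^'n) = 1"
proof -
  assume mn: "m \<noteq> n"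
  have "transvection m n c = (\<chi> k. if k = m then row m (mat 1) + c *s row n (mat 1) else row k (mat 1) :: real^'n^'n)"
    using mn by (auto simp: transvection_def vec_eq_iff row_def mat_def)
  then show ?thesis using det_row_operation[OF mn, of "mat 1 :: real^'n^'n" c] by simp
qed

text \<open>The conjugates of rotations generate the special linear group: conjugating a quarter turn by a
  dilation gives the matrices \<open>diag(c, 1/c)\<close>, and their commutators with transvections are
  transvections.\<close>
proposition normal_closure_of_rotations:
  fixes G :: "(real^'n^'n) set" and A :: "real^'n^'n"
  assumes mult: "\<And>A B. A \<in> G \<Longrightarrow> B \<in> G \<Longrightarrow> A ** B \<in> G"
    and inv: "\<And>A B. A \<in> G \<Longrightarrow> A ** B = mat 1 \<Longrightarrow> B \<in> G"
    and conj: "\<And>A P Q. A \<in> G \<Longrightarrow> P ** Q = mat 1 \<Longrightarrow> P ** A ** Q \<in> G"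
    and rot: "\<And>A. rotation_matrix A \<Longrightarrow> A \<in> G"
    and A: "det A \<noteq> 0"
  shows "\<exists>S\<in>G. A = S ** dilation k (det A)"
proof -
  \<comment> \<open>A quarter turn in the plane of the coordinates \<open>m\<close> and
    \<open>n\<close>: the sign change repairs the determinant -1 of the swap.\<close>
  define J :: "'n \<Rightarrow> 'n \<Rightarrow> real^'n^'n"
    where "J = (\<lambda>m n. swap_matrix m n ** dilation n (- 1))"
  have one: "mat 1 \<in> G" by (intro rot) (simp add: rotation_matrix_def orthogonal_matrix_id)
  have J: "J m n \<in> G" if "m \<noteq> n" for m n
  proof (intro rot)
    have "orthogonal_matrix (swap_matrix m n :: real^'n^'n)"
      by (simp add: orthogonal_matrix_def transpose_swap_matrix swap_matrix_involution)
    moreover have "orthogonal_matrix (dilation n (- 1) :: real^'n^'n)"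
      using dilation_inverse[of "- 1" n] by (simp add: orthogonal_matrix_def dilation_def transpose_diag_matrix)
    ultimately show "rotation_matrix (J m n)"
      using that by (simp add: rotation_matrix_def J_def orthogonal_matrix_mul det_mul det_swap_matrix)
  qed
  define D2 :: "'n \<Rightarrow> 'n \<Rightarrow> real \<Rightarrow> real^'n^'n"
    where "D2 = (\<lambda>m n c. diag_matrix (\<lambda>i. if i = m then c else if i = n then 1 / c else 1))"
  have D2: "D2 m n c \<in> G" if mn: "m \<noteq> n" and c: "c \<noteq> 0" for m n c
  proof -
    have JJ: "J m n ** (dilation n (- 1) ** swap_matrix m n) = mat 1"
    proof -
      have "J m n ** (dilation n (- 1) ** swap_matrix m n) =
        swap_matrix m n ** (dilation n (- 1) ** dilation n (- 1)) ** swap_matrix m n"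
        by (simp add: J_def matrix_mul_assoc)
      then show ?thesis by (simp add: dilation_mult dilation_1 swap_matrix_involution)
    qed
    \<comment> \<open>A conjugate of \<open>J m n\<close> times its inverse. Conjugation by the swap
      moves \<open>1 / c\<close> from position \<open>m\<close> to position \<open>n\<close>, and
      the two sign changes cancel.\<close>
    have "dilation m c ** J m n ** dilation m (1 / c) ** (dilation n (- 1) ** swap_matrix m n) \<in> G"
      using mn c by (intro mult[OF conj[OF J]] inv[OF J JJ] dilation_inverse)
    also have "dilation m c ** J m n ** dilation m (1 / c) ** (dilation n (- 1) ** swap_matrix m n) =
      dilation m c ** (swap_matrix m n ** (dilation n (- 1) ** dilation m (1 / c) ** dilation n (- 1)) ** swap_matrix m n)"
      by (simp add: J_def matrix_mul_assoc)
    also have "\<dots> = D2 m n c"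
      unfolding dilation_def diag_matrix_mult swap_diag_swap D2_def
      using mn by (intro arg_cong[where f = diag_matrix] ext) (auto simp: Transposition.transpose_def)
    finally show ?thesis .
  qed
  \<comment> \<open>As an implication, the claim is vacuous for singular matrices, which occur among
    the generators of the induction.\<close>
  define P where "P = (\<lambda>A::real^'n^'n. det A \<noteq> 0 \<longrightarrow> (\<exists>S\<in>G. A = S ** dilation k (det A)))"
  have Pmult: "P (A ** B)" if "P A" "P B" for A B
    unfolding P_def
  proof
    assume "det (A ** B) \<noteq> 0"
    then have AB: "det A \<noteq> 0" "det B \<noteq> 0" by (auto simp: det_mul)
    then obtain S T where ST: "S \<in> G" "A = S ** dilation k (det A)" "T \<in> G" "B = T ** dilation k (det B)"
      using \<open>P A\<close> \<open>P B\<close> by (auto simp: P_def)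
    let ?D = "dilation k (det A) :: real^'n^'n" and ?E = "dilation k (1 / det A) :: real^'n^'n"
    have ED: "?E ** ?D = mat 1" using AB by (simp add: dilation_mult dilation_1)
    \<comment> \<open>To merge the two dilations, \<open>?D\<close> is moved past \<open>T\<close>;
      this replaces \<open>T\<close> by a conjugate, which stays in \<open>G\<close>.\<close>
    have "S ** (?D ** T ** ?E) \<in> G" using AB ST by (intro mult conj dilation_inverse)
    moreover have "S ** (?D ** T ** ?E) ** dilation k (det (A ** B)) = A ** B"
    proof -
      have "S ** (?D ** T ** ?E) ** dilation k (det (A ** B)) =
         (S ** ?D) ** T ** (?E ** ?D) ** dilation k (det B)"
        by (simp add: matrix_mul_assoc[symmetric] det_mul dilation_mult)
      also have "\<dots> = (S ** ?D) ** (T ** dilation k (det B))" by (simp add: ED matrix_mul_assoc)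
      finally show ?thesis using ST by simp
    qed
    ultimately show "\<exists>S\<in>G. A ** B = S ** dilation k (det (A ** B))" by metis
  qed
  have Pdet1: "P A" if "A \<in> G" "det A = 1" for A
    using that by (auto simp: P_def dilation_1)
  have Pdiag: "P (diag_matrix a)" for a
    unfolding P_def
  proof
    assume "det (diag_matrix a) \<noteq> 0"
    then have a: "a i \<noteq> 0" for i by (auto simp: det_diag_matrix)
    \<comment> \<open>The prescribed entries are filled in one index at a time, position
      \<open>k\<close> holding the inverse of their product so that the determinant remains 1. With
      all indices except \<open>k\<close> filled in, only position \<open>k\<close> has to be
      corrected, and the dilation does that.\<close>
    have "diag_matrix (\<lambda>i. if i \<in> X then a i else if i = k then 1 / (\<Prod>i\<in>X. a i) else 1) \<in> G"
      if "finite X" "k \<notin> X" for X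
      using that
    proof (induction X)
      case empty
      then show ?case using one by (simp add: diag_matrix_eq_mat_1 cong: if_cong)
    next
      case (insert m X)
      let ?d = "\<lambda>i. if i \<in> X then a i else if i = k then 1 / (\<Prod>i\<in>X. a i) else 1"
      have "D2 m k (a m) ** diag_matrix ?d \<in> G"
        using insert a by (intro mult D2) auto
      also have "D2 m k (a m) ** diag_matrix ?d =
          diag_matrix (\<lambda>i. if i \<in> insert m X then a i else if i = k then 1 / (\<Prod>i\<in>insert m X. a i) else 1)"
        unfolding D2_def diag_matrix_mult using insert
        by (intro arg_cong[where f = diag_matrix] ext) auto
      finally show ?case .
    qed
    from this[of "UNIV - {k}"]
    have S: "diag_matrix (\<lambda>i. if i = k then 1 / (\<Prod>i\<in>UNIV - {k}. a i) else a i) \<in> G" (is "?S \<in> G")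
      by (simp add: if_distrib cong: if_cong)
    have nz: "(\<Prod>i\<in>UNIV - {k}. a i) \<noteq> 0" using a by simp
    have "(\<Prod>i\<in>UNIV. a i) = a k * (\<Prod>i\<in>UNIV - {k}. a i)" by (subst prod.remove[of _ k]) auto
    then have "?S ** dilation k (det (diag_matrix a)) = diag_matrix a"
      unfolding dilation_def diag_matrix_mult det_diag_matrix
      using nz by (intro arg_cong[where f = diag_matrix] ext) auto
    then show "\<exists>S\<in>G. diag_matrix a = S ** dilation k (det (diag_matrix a))" using S by metis
  qed
  have "P A"
  proof (rule induct_matrix_elementary)
    show "P (A ** B)" if "P A" "P B" for A B using Pmult that .
    show "P A" if "row i A = 0" for A i using that by (simp add: P_def det_zero_row)
    show "P A" if "\<And>i j. i \<noteq> j \<Longrightarrow> A $ i $ j = 0" for A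
    proof -
      have "A = diag_matrix (\<lambda>i. A $ i $ i)" using that by (auto simp: diag_matrix_def vec_eq_iff)
      then show ?thesis using Pdiag by metis
    qed
    show "P (\<chi> i j. mat 1 $ i $ Transposition.transpose m n j)" if mn: "m \<noteq> n" for m n
    proof -
      have "swap_matrix m n = J m n ** dilation n (- 1)"
        by (simp add: J_def matrix_mul_assoc[symmetric] dilation_mult dilation_1)
      moreover have "P (J m n)"
        using mn by (intro Pdet1 J) (simp_all add: J_def det_mul det_swap_matrix)
      moreover have "P (dilation n (- 1))" unfolding dilation_def by (rule Pdiag)
      ultimately show ?thesis unfolding swap_matrix_def[symmetric] using Pmult by simp
    qed
    show "P (\<chi> i j. if i = m \<and> j = n then c else of_bool (i = j))" if mn: "m \<noteq> n" for m n c
    proof -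
      let ?T = "\<lambda>c. transvection m n c :: real^'n^'n"
      \<comment> \<open>Conjugation by \<open>diag(2, 1/2)\<close> multiplies the entry of the
        transvection by 4, so the commutator has entry \<open>(4 - 1) * (c / 3) = c\<close>.\<close>
      have "D2 m n 2 ** (?T (c / 3) ** D2 m n (1 / 2) ** ?T (- (c / 3))) \<in> G"
        using mn by (intro mult conj D2 transvection_inverse) auto
      also have "D2 m n 2 ** (?T (c / 3) ** D2 m n (1 / 2) ** ?T (- (c / 3))) =
          D2 m n 2 ** ?T (c / 3) ** D2 m n (1 / 2) ** ?T (- (c / 3))"
        by (simp add: matrix_mul_assoc)
      also have "D2 m n 2 ** ?T (c / 3) ** D2 m n (1 / 2) = ?T (4 * c / 3)"
        unfolding D2_def diag_matrix_mult_left diag_matrix_mult_right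
        using mn by (auto simp: transvection_def vec_eq_iff)
      also have "?T (4 * c / 3) ** ?T (- (c / 3)) = ?T c"
        using mn by (simp add: transvection_mult)
      finally have "?T c \<in> G" .
      moreover have "det (?T c) = 1" using mn by (rule det_transvection)
      ultimately show ?thesis unfolding transvection_def[symmetric] by (rule Pdet1)
    qed
  qed
  then show ?thesis using A by (simp add: P_def)
qed

section \<open>Necessity\<close>

lemma bounded_measurable_in_Lp:
  fixes f :: "real^'n \<Rightarrow> 'b::euclidean_space"
  assumes f: "f \<in> borel_measurable (lebesgue_on \<Omega>)" and B: "\<And>x. x \<in> \<Omega> \<Longrightarrow> norm (f x) \<le> B"
    and \<Omega>: "\<Omega> \<in> lmeasurable" and p: "0 \<le> p"
  shows "in_Lp p \<Omega> f"
  unfolding in_Lp_def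
proof
  show "integrable (lebesgue_on \<Omega>) (\<lambda>x. norm (f x) powr p)"
  proof (rule finite_measure.integrable_const_bound[where B = "B powr p"])
    show "finite_measure (lebesgue_on \<Omega>)" using \<Omega> by (rule finite_measure_lebesgue_on)
    show "AE x in lebesgue_on \<Omega>. norm (norm (f x) powr p) \<le> B powr p"
      using B p by (intro AE_I2) (simp add: powr_mono2)
  qed (use f in measurable)
qed (rule f)

text \<open>Supplies the Sobolev regularity of every map used as a competitor, and of its inverse.
  Componentwise, the derivative along each axis is the almost everywhere limit of difference
  quotients, and these determine the weak gradient.\<close>

lemma sobolev_W1_lipschitz:
  fixes u :: "real^'n \<Rightarrow> real^'n"
  assumes lip: "L-lipschitz_on UNIV u" and F: "F \<in> borel_measurable lebesgue" and B: "\<And>x. norm (F x) \<le> B"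
    and der: "AE x in lebesgue. (u has_derivative (*v) (F x)) (at x)"
    and \<Omega>: "\<Omega> \<in> lmeasurable" "bounded \<Omega>" and p: "0 \<le> p"
  shows "sobolev_W1 p \<Omega> u F"
  unfolding sobolev_W1_def
proof (intro conjI)
  have uc: "continuous_on UNIV u" using lip by (rule lipschitz_on_continuous_on)
  have \<Omega>s: "\<Omega> \<in> sets lebesgue" using \<Omega> by (simp add: fmeasurableD)
  have "compact (closure \<Omega>)" using \<Omega> by (simp add: compact_closure)
  then have "bounded (u ` closure \<Omega>)"
    using uc by (intro compact_imp_bounded compact_continuous_image) (auto intro: continuous_on_subset)
  then obtain C where C: "\<And>x. x \<in> \<Omega> \<Longrightarrow> norm (u x) \<le> C"
    using closure_subset[of \<Omega>] by (auto simp: bounded_iff)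
  have m: "f \<in> borel_measurable lebesgue \<Longrightarrow> f \<in> borel_measurable (lebesgue_on \<Omega>)"
    for f :: "real^'n \<Rightarrow> 'b::topological_space"
    by (rule measurable_restrict_space1)
  show "in_Lp p \<Omega> u"
    using C \<Omega> p by (intro bounded_measurable_in_Lp m borel_measurable_lebesgue_continuous uc)
  show "in_Lp p \<Omega> F"
    using B \<Omega> p F by (intro bounded_measurable_in_Lp m) auto
  show "has_weak_gradient \<Omega> u F"
    unfolding has_weak_gradient_def
  proof (intro allI impI)
    fix \<phi> i j assume \<phi>: "test_function \<Omega> \<phi>"
    show "(LINT x|lebesgue_on \<Omega>. u x $ i * partial_deriv j \<phi> x) = - (LINT x|lebesgue_on \<Omega>. F x $ i $ j * \<phi> x)"
    proof (rule weak_partial_derivative_lipschitz[OF _ _ _ \<Omega>s \<phi>])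
      show "L-lipschitz_on UNIV (\<lambda>x. u x $ i)"
      proof (rule lipschitz_onI)
        fix x y
        have "dist (u x $ i) (u y $ i) \<le> dist (u x) (u y)" by (rule dist_vec_nth_le)
        also have "\<dots> \<le> L * dist x y" using lipschitz_onD[OF lip] by simp
        finally show "dist (u x $ i) (u y $ i) \<le> L * dist x y" .
      qed (rule lipschitz_on_nonneg[OF lip])
      have "(\<lambda>A::real^'n^'n. A $ i $ j) \<in> borel_measurable borel"
        by (intro borel_measurable_continuous_onI continuous_intros)
      from measurable_compose[OF F this] show "(\<lambda>x. F x $ i $ j) \<in> borel_measurable lebesgue" .
      show "AE x in lebesgue. ((\<lambda>s. (u (x + s *\<^sub>R axis j 1) $ i - u x $ i) / s) \<longlongrightarrow> F x $ i $ j) (at 0)"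
        using der
      proof eventually_elim
        case (elim x)
        have "((\<lambda>t. x + t *\<^sub>R axis j 1) has_derivative (\<lambda>t. t *\<^sub>R axis j 1)) (at 0)"
          by (auto intro!: derivative_eq_intros)
        moreover have "(u has_derivative (*v) (F x)) (at (x + 0 *\<^sub>R axis j 1))" using elim by simp
        ultimately have "((\<lambda>t. u (x + t *\<^sub>R axis j 1)) has_derivative (\<lambda>t. F x *v (t *\<^sub>R axis j 1))) (at 0)"
          by (rule has_derivative_compose)
        from bounded_linear.has_derivative[OF bounded_linear_vec_nth[of i] this]
        have "((\<lambda>t. u (x + t *\<^sub>R axis j 1) $ i) has_derivative (\<lambda>t. (F x *v (t *\<^sub>R axis j 1)) $ i)) (at 0)" .
        moreover have "(F x *v (t *\<^sub>R axis j 1)) $ i = F x $ i $ j * t" for t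
          by (simp add: matrix_vector_mul_component inner_axis row_def matrix_vector_mult_scaleR)
        ultimately have "((\<lambda>t. u (x + t *\<^sub>R axis j 1) $ i) has_real_derivative F x $ i $ j) (at 0)"
          by (simp add: has_field_derivative_def)
        then show ?case by (simp add: has_field_derivative_iff)
      qed
    qed
  qed
qed

lemma lipschitz_on_matrix: "\<exists>L. L-lipschitz_on UNIV ((*v) (A :: real^'n^'n))"
proof -
  obtain L where L: "\<And>x. norm (A *v x) \<le> norm x * L" "0 < L"
    using bounded_linear.pos_bounded[OF matrix_vector_mul_bounded_linear[of A]] by blast
  have "L-lipschitz_on UNIV ((*v) A)"
    by (rule lipschitz_onI) (use L in \<open>auto simp: dist_norm mult.commute simp flip: matrix_vector_mult_diff_distrib\<close>)
  then show ?thesis by blast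
qed

lemma has_derivative_matrix: "((*v) (A :: real^'n^'n) has_derivative (*v) A) (at x)"
  by (simp add: bounded_linear_imp_has_derivative)

lemma sobolev_W1_matrix:
  fixes A :: "real^'n^'n"
  assumes "\<Omega> \<in> lmeasurable" "bounded \<Omega>" "0 \<le> p"
  shows "sobolev_W1 p \<Omega> ((*v) A) (\<lambda>x. A)"
  using lipschitz_on_matrix[of A] assms has_derivative_matrix
  by (auto intro!: sobolev_W1_lipschitz[where B = "norm A"])

lemma homeomorphism_matrix:
  fixes A B :: "real^'n^'n"
  assumes "A ** B = mat 1"
  shows "homeomorphism \<Omega> ((*v) A ` \<Omega>) ((*v) A) ((*v) B)"
proof -
  have "B ** A = mat 1" using assms by (simp add: matrix_left_right_inverse)
  then show ?thesis using assms
    by (auto simp: homeomorphism_def matrix_vector_mul_assoc image_image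
        intro!: continuous_intros linear_continuous_on)
qed

lemma det_nonzero_inverse:
  fixes A :: "real^'n^'n"
  assumes "det A \<noteq> 0" obtains B where "A ** B = mat 1" "B ** A = mat 1"
  using assms invertible_det_nz[of A] by (auto simp: invertible_def)

lemma lmeasurable_matrix_image_open:
  fixes M :: "real^'n^'n"
  assumes "open \<Omega>" "bounded \<Omega>" "det M \<noteq> 0"
  shows "open ((*v) M ` \<Omega>)" "bounded ((*v) M ` \<Omega>)" "(*v) M ` \<Omega> \<in> lmeasurable"
proof -
  obtain N where "M ** N = mat 1" using assms(3) by (rule det_nonzero_inverse)
  then have "surj ((*v) M)"
    by (intro surjI[of _ "(*v) N"]) (simp add: matrix_vector_mul_assoc)
  then show o: "open ((*v) M ` \<Omega>)"
    using assms by (intro open_surjective_linear_image) auto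
  show b: "bounded ((*v) M ` \<Omega>)" using assms by (intro bounded_linear_image) auto
  show "(*v) M ` \<Omega> \<in> lmeasurable" using o b by (rule lmeasurable_open[rotated])
qed

section \<open>Linear competitors\<close>

definition mean_inequality :: "real \<Rightarrow> (real^'n^'n \<Rightarrow> real) \<Rightarrow> bool" where
  "mean_inequality p \<Psi> \<longleftrightarrow> (\<forall>\<Omega> M y Dy.
     bounded_lipschitz_domain \<Omega> \<and> 0 < det M \<and>
     orientation_preserving_invertible p \<Omega> ((*v) M ` \<Omega>) y Dy \<longrightarrow>
     1 / emeasure lebesgue \<Omega> * (\<integral>\<^sup>+ x. ennreal (\<Psi> (Dy x)) \<partial>lebesgue_on \<Omega>) \<ge> ennreal (\<Psi> M))"

lemma mean_inequalityD:
  "mean_inequality p \<Psi> \<Longrightarrow> bounded_lipschitz_domain \<Omega> \<Longrightarrow> 0 < det M \<Longrightarrow>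
     orientation_preserving_invertible p \<Omega> ((*v) M ` \<Omega>) y Dy \<Longrightarrow>
     ennreal (\<Psi> M) \<le> 1 / emeasure lebesgue \<Omega> * (\<integral>\<^sup>+ x. ennreal (\<Psi> (Dy x)) \<partial>lebesgue_on \<Omega>)"
  unfolding mean_inequality_def by simp

lemma emeasure_open_bounded:
  fixes \<Omega> :: "(real^'n) set"
  assumes "open \<Omega>" "bounded \<Omega>" "\<Omega> \<noteq> {}"
  shows "emeasure lebesgue \<Omega> = ennreal (measure lebesgue \<Omega>)" "0 < measure lebesgue \<Omega>"
proof -
  have l: "\<Omega> \<in> lmeasurable" using assms by (simp add: lmeasurable_open)
  then show "emeasure lebesgue \<Omega> = ennreal (measure lebesgue \<Omega>)"
    by (rule emeasure_eq_measure2)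
  have "\<not> negligible \<Omega>" using assms open_not_negligible by blast
  then have "measure lebesgue \<Omega> \<noteq> 0" using l negligible_iff_measure by blast
  then show "0 < measure lebesgue \<Omega>" by (simp add: zero_less_measure_iff)
qed

text \<open>Multiplication by \<open>B\<close> is an admissible map for \<open>M\<close> because
  only the image of the domain is prescribed; its gradient is constant, so the average is
  \<open>\<Psi> B\<close>.\<close>

lemma mean_inequality_linear:
  fixes \<Psi> :: "real^'n^'n \<Rightarrow> real"
  assumes ineq: "mean_inequality p \<Psi>" and p: "0 \<le> p" and nonneg: "\<And>A. 0 < det A \<Longrightarrow> 0 \<le> \<Psi> A"
    and M: "0 < det M" and B: "0 < det B"
    and \<Omega>: "open \<Omega>" "bounded \<Omega>" "convex \<Omega>" "\<Omega> \<noteq> {}" and img: "(*v) B ` \<Omega> = (*v) M ` \<Omega>"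
  shows "\<Psi> M \<le> \<Psi> B"
proof -
  have l: "\<Omega> \<in> lmeasurable" using \<Omega> by (simp add: lmeasurable_open)
  obtain C where C: "B ** C = mat 1" using B by (metis det_nonzero_inverse less_irrefl)
  have "homeomorphism \<Omega> ((*v) M ` \<Omega>) ((*v) B) ((*v) C)"
    using homeomorphism_matrix[OF C] img by metis
  moreover have "sobolev_W1 p \<Omega> ((*v) B) (\<lambda>x. B)" using sobolev_W1_matrix l \<Omega>(2) p by blast
  moreover have "sobolev_W1 p ((*v) M ` \<Omega>) ((*v) C) (\<lambda>x. C)"
    using M lmeasurable_matrix_image_open[OF \<Omega>(1,2), of M] p by (intro sobolev_W1_matrix) auto
  ultimately have "orientation_preserving_invertible p \<Omega> ((*v) M ` \<Omega>) ((*v) B) (\<lambda>x. B)"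
    using B unfolding orientation_preserving_invertible_def by auto
  moreover have "bounded_lipschitz_domain \<Omega>" using \<Omega> by (simp add: bounded_lipschitz_domain_convex)
  ultimately have "ennreal (\<Psi> M) \<le> 1 / emeasure lebesgue \<Omega> * (\<integral>\<^sup>+ x. ennreal (\<Psi> B) \<partial>lebesgue_on \<Omega>)"
    using M by (intro mean_inequalityD[OF ineq])
  also have "(\<integral>\<^sup>+ x. ennreal (\<Psi> B) \<partial>lebesgue_on \<Omega>) = ennreal (\<Psi> B) * emeasure lebesgue \<Omega>"
    using l by (simp add: emeasure_restrict_space fmeasurableD)
  also have "1 / emeasure lebesgue \<Omega> * (ennreal (\<Psi> B) * emeasure lebesgue \<Omega>) = ennreal (\<Psi> B)"
  proof -
    have m: "emeasure lebesgue \<Omega> = ennreal (measure lebesgue \<Omega>)" "0 < measure lebesgue \<Omega>"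
      using emeasure_open_bounded[OF \<Omega>(1,2,4)] .
    show ?thesis unfolding m(1) ennreal_1[symmetric] using m(2) nonneg[OF B]
      by (simp add: divide_ennreal ennreal_mult[symmetric] del: ennreal_1)
  qed
  finally show ?thesis using nonneg[OF B] by simp
qed

text \<open>The hypotheses are symmetric in \<open>M\<close> and \<open>B\<close>, so each is a
  competitor for the other.\<close>

lemma mean_inequality_linear_eq:
  fixes \<Psi> :: "real^'n^'n \<Rightarrow> real"
  assumes "mean_inequality p \<Psi>" "0 \<le> p" "\<And>A. 0 < det A \<Longrightarrow> 0 \<le> \<Psi> A" "0 < det M" "0 < det B"
    "open \<Omega>" "bounded \<Omega>" "convex \<Omega>" "\<Omega> \<noteq> {}" "(*v) B ` \<Omega> = (*v) M ` \<Omega>"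
  shows "\<Psi> B = \<Psi> M"
  using mean_inequality_linear[of p \<Psi> M B \<Omega>] mean_inequality_linear[of p \<Psi> B M \<Omega>] assms
  by (metis order_antisym)

lemma orthogonal_matrix_image_ball:
  fixes R :: "real^'n^'n"
  assumes "orthogonal_matrix R"
  shows "(*v) R ` ball 0 r = ball 0 r"
proof -
  have n: "norm (R *v x) = norm x" for x
    using assms orthogonal_transformation_matrix[of "(*v) R"]
    by (simp add: orthogonal_transformation_norm)
  have "x \<in> (*v) R ` ball 0 r" if "x \<in> ball 0 r" for x
  proof -
    have t: "R *v (transpose R *v x) = x" using assms
      by (simp add: matrix_vector_mul_assoc orthogonal_matrix_def del: transpose_matrix_vector)
    then have "norm (transpose R *v x) = norm x" by (metis n)
    then show ?thesis using t that by (intro image_eqI[of _ _ "transpose R *v x"]) auto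
  qed
  then show ?thesis using n by auto
qed

text \<open>\<open>G\<close> collects the matrices of determinant 1 all of whose conjugates can be
  absorbed to the right of every \<open>M\<close>. Quantifying over all \<open>M\<close>,
  \<open>P\<close> and \<open>Q\<close> makes it closed under products, inverses and conjugation, so
  it is enough that it contains the rotations; for these the image of a ball under \<open>P\<close>
  serves as domain.\<close>

lemma mean_inequality_depends_on_det:
  fixes \<Psi> :: "real^'n^'n \<Rightarrow> real"
  assumes ineq: "mean_inequality p \<Psi>" and p: "0 \<le> p" and nonneg: "\<And>A. 0 < det A \<Longrightarrow> 0 \<le> \<Psi> A"
    and A: "0 < det A"
  shows "\<Psi> A = \<Psi> (dilation k (det A))"
proof -
  define G :: "(real^'n^'n) set" where "G = {S. det S = 1 \<and>
    (\<forall>P Q M. P ** Q = mat 1 \<longrightarrow> 0 < det M \<longrightarrow> \<Psi> (M ** (P ** S ** Q)) = \<Psi> M)}"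
  have Gdet: "det S = 1" if "S \<in> G" for S using that by (simp add: G_def)
  have GI: "S \<in> G" if "det S = 1"
    "\<And>P Q M. P ** Q = mat 1 \<Longrightarrow> 0 < det M \<Longrightarrow> \<Psi> (M ** (P ** S ** Q)) = \<Psi> M" for S
    using that by (auto simp: G_def)
  have GD: "\<Psi> (M ** (P ** S ** Q)) = \<Psi> M" if "S \<in> G" "P ** Q = mat 1" "0 < det M" for P Q S M
    using that by (auto simp: G_def)
  have detPQ: "det (P ** S ** Q) = det S" if "P ** Q = mat 1" for P Q S :: "real^'n^'n"
  proof -
    have "det P * det Q = 1" using that by (metis det_mul det_I)
    then show ?thesis by (simp add: det_mul)
  qed
  have "\<exists>S\<in>G. A = S ** dilation k (det A)"
  proof (rule normal_closure_of_rotations)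
    fix S T assume S: "S \<in> G" and T: "T \<in> G"
    show "S ** T \<in> G"
    proof (rule GI)
      show "det (S ** T) = 1" using S T by (simp add: Gdet det_mul)
      fix P Q M :: "real^'n^'n" assume PQ: "P ** Q = mat 1" and M: "0 < det M"
      have QP: "Q ** P = mat 1" using PQ by (simp add: matrix_left_right_inverse)
      have "M ** (P ** (S ** T) ** Q) = M ** (P ** S ** (Q ** P) ** T ** Q)"
        by (simp add: QP matrix_mul_assoc)
      also have "\<dots> = (M ** (P ** S ** Q)) ** (P ** T ** Q)" by (simp add: matrix_mul_assoc)
      also have "\<Psi> \<dots> = \<Psi> (M ** (P ** S ** Q))"
        using M S T PQ by (intro GD) (auto simp: det_mul[of M] detPQ Gdet)
      also have "\<dots> = \<Psi> M" using GD[OF S PQ M] .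
      finally show "\<Psi> (M ** (P ** (S ** T) ** Q)) = \<Psi> M" .
    qed
  next
    fix S T assume S: "S \<in> G" and ST: "S ** T = mat 1"
    have dT: "det T = 1" using ST Gdet[OF S] by (metis det_mul det_I mult_1)
    have TS: "T ** S = mat 1" using ST by (simp add: matrix_left_right_inverse)
    show "T \<in> G"
    proof (rule GI[OF dT])
      fix P Q M :: "real^'n^'n" assume PQ: "P ** Q = mat 1" and M: "0 < det M"
      have QP: "Q ** P = mat 1" using PQ by (simp add: matrix_left_right_inverse)
      have "\<Psi> (M ** (P ** T ** Q)) = \<Psi> (M ** (P ** T ** Q) ** (P ** S ** Q))"
        using M PQ S by (intro GD[symmetric]) (auto simp: det_mul[of M] detPQ dT)
      also have "M ** (P ** T ** Q) ** (P ** S ** Q) = M ** (P ** (T ** (Q ** P) ** S) ** Q)"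
        by (simp add: matrix_mul_assoc)
      also have "\<dots> = M" by (simp add: QP TS PQ)
      finally show "\<Psi> (M ** (P ** T ** Q)) = \<Psi> M" .
    qed
  next
    fix S P Q :: "real^'n^'n" assume S: "S \<in> G" and PQ: "P ** Q = mat 1"
    show "P ** S ** Q \<in> G"
    proof (rule GI)
      show "det (P ** S ** Q) = 1" using S PQ by (simp add: detPQ Gdet)
      fix P' Q' M :: "real^'n^'n" assume PQ': "P' ** Q' = mat 1" and M: "0 < det M"
      have "(P' ** P) ** (Q ** Q') = P' ** (P ** Q) ** Q'" by (simp add: matrix_mul_assoc)
      also have "\<dots> = mat 1" by (simp add: PQ PQ')
      finally have "\<Psi> (M ** ((P' ** P) ** S ** (Q ** Q'))) = \<Psi> M" using S M by (intro GD)
      then show "\<Psi> (M ** (P' ** (P ** S ** Q) ** Q')) = \<Psi> M" by (simp add: matrix_mul_assoc)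
    qed
  next
    fix R :: "real^'n^'n" assume R: "rotation_matrix R"
    show "R \<in> G"
    proof (rule GI)
      show "det R = 1" using R by (simp add: rotation_matrix_def)
      fix P Q M :: "real^'n^'n" assume PQ: "P ** Q = mat 1" and M: "0 < det M"
      have QP: "Q ** P = mat 1" using PQ by (simp add: matrix_left_right_inverse)
      let ?\<Omega> = "(*v) P ` ball 0 1"
      have dP: "det P \<noteq> 0" using PQ by (metis det_I det_mul mult_zero_left zero_neq_one)
      show "\<Psi> (M ** (P ** R ** Q)) = \<Psi> M"
      proof (rule mean_inequality_linear_eq[OF ineq p nonneg M])
        show "0 < det (M ** (P ** R ** Q))"
          using M PQ \<open>det R = 1\<close> by (simp add: det_mul[of M] detPQ)
        show "open ?\<Omega>" "bounded ?\<Omega>" using lmeasurable_matrix_image_open[OF open_ball bounded_ball dP] by auto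
        show "convex ?\<Omega>" by (intro convex_linear_image) auto
        show "?\<Omega> \<noteq> {}" by simp
        have "(*v) (M ** (P ** R ** Q)) ` ?\<Omega> = (*v) (M ** P ** R ** (Q ** P)) ` ball 0 1"
          by (simp add: image_image matrix_vector_mul_assoc matrix_mul_assoc)
        also have "\<dots> = (*v) (M ** P) ` ((*v) R ` ball 0 1)"
          by (simp add: image_image matrix_vector_mul_assoc matrix_mul_assoc QP)
        also have "\<dots> = (*v) M ` ?\<Omega>"
          using R by (simp add: orthogonal_matrix_image_ball rotation_matrix_def image_image matrix_vector_mul_assoc)
        finally show "(*v) (M ** (P ** R ** Q)) ` ?\<Omega> = (*v) M ` ?\<Omega>" .
      qed
    qed
  qed (use A in simp)
  then obtain S where S: "S \<in> G" "A = S ** dilation k (det A)" by blast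
  let ?D = "dilation k (det A) :: real^'n^'n" and ?E = "dilation k (1 / det A) :: real^'n^'n"
  have "?D ** ?E = mat 1" "?E ** ?D = mat 1" using A by (simp_all add: dilation_mult dilation_1)
  \<comment> \<open>Factors are absorbed on the right, but \<open>S\<close> stands to the left of
    the dilation; conjugation by the dilation moves it to the other side.\<close>
  then have "?D ** (?E ** S ** ?D) = A" using S by (metis matrix_mul_assoc matrix_mul_lid)
  moreover have "\<Psi> (?D ** (?E ** S ** ?D)) = \<Psi> ?D" using S A by (intro GD) (auto simp: dilation_mult dilation_1)
  ultimately show ?thesis by simp
qed

text \<open>In coordinate \<open>k\<close> this is the continuous piecewise linear function through
  0 with slope \<open>a\<close> below the level \<open>l\<close> and slope \<open>b\<close> above
  it. The form with \<open>min\<close> makes Lipschitz continuity immediate; the inverse has the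
  same form, with slopes \<open>1 / a\<close> and \<open>1 / b\<close> and break point
  \<open>a * l\<close>.\<close>

definition stretch :: "'n \<Rightarrow> real \<Rightarrow> real \<Rightarrow> real \<Rightarrow> real^'n \<Rightarrow> real^'n" where
  "stretch k a b l x = x + ((b - 1) * x $ k + (a - b) * min (x $ k) l) *\<^sub>R axis k 1"

text \<open>On the hyperplane where the slopes meet, a null set, the value
  \<open>dilation k b\<close> is a mere convention.\<close>

definition stretch_gradient :: "'n \<Rightarrow> real \<Rightarrow> real \<Rightarrow> real \<Rightarrow> real^'n \<Rightarrow> real^'n^'n" where
  "stretch_gradient k a b l x = (if x $ k < l then dilation k a else dilation k b)"

lemma stretch_nth:
  "stretch k a b l x $ i = (if i = k then b * x $ k + (a - b) * min (x $ k) l else x $ i)"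
  by (simp add: stretch_def axis_def algebra_simps)

lemma dilation_mult_vec: "(dilation k t *v x) $ i = (if i = k then t * x $ i else x $ i)"
  by (simp add: dilation_def diag_matrix_def matrix_vector_mult_def mult_delta_left)

lemma stretch_inverse:
  assumes "0 < a" "0 < b"
  shows "stretch k (1 / a) (1 / b) (a * l) (stretch k a b l x) = x"
proof -
  have "1 / b * (b * s + (a - b) * min s l) + (1 / a - 1 / b) * min (b * s + (a - b) * min s l) (a * l) = s" for s
  proof (cases "s \<le> l")
    case True
    then have "b * s + (a - b) * min s l = a * s" by (simp add: algebra_simps)
    moreover have "a * s \<le> a * l" using True assms by simp
    ultimately show ?thesis using assms by (simp add: min_absorb1 field_simps)
  next
    case False
    then have e: "b * s + (a - b) * min s l = b * (s - l) + a * l" by (simp add: algebra_simps)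
    have "0 \<le> b * (s - l)" using False assms by simp
    then have "min (b * (s - l) + a * l) (a * l) = a * l" by simp
    then show ?thesis using assms unfolding e by (simp add: field_simps)
  qed
  then show ?thesis by (simp add: vec_eq_iff stretch_nth)
qed

lemma stretch_lipschitz:
  fixes k :: "'n::finite"
  shows "(1 + \<bar>b - 1\<bar> + \<bar>a - b\<bar>)-lipschitz_on UNIV (stretch k a b l)"
proof (rule lipschitz_onI)
  fix x y :: "real^'n"
  define d where "d = dist x y"
  have k: "\<bar>x $ k - y $ k\<bar> \<le> d" using dist_vec_nth_le[of x k y] by (simp add: dist_real_def d_def)
  have m: "\<bar>min (x $ k) l - min (y $ k) l\<bar> \<le> d" using k by (auto simp: min_def)
  have "stretch k a b l x - stretch k a b l y =
    (x - y) + ((b - 1) * (x $ k - y $ k) + (a - b) * (min (x $ k) l - min (y $ k) l)) *\<^sub>R axis k 1"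
    by (simp add: stretch_def algebra_simps)
  then have "dist (stretch k a b l x) (stretch k a b l y) \<le>
     norm (x - y) + \<bar>(b - 1) * (x $ k - y $ k) + (a - b) * (min (x $ k) l - min (y $ k) l)\<bar>"
    unfolding dist_norm by (metis (no_types, lifting) norm_axis_1 norm_scaleR mult.right_neutral norm_triangle_ineq)
  also have "\<dots> \<le> d + (\<bar>b - 1\<bar> * d + \<bar>a - b\<bar> * d)"
  proof -
    have "\<bar>(b - 1) * (x $ k - y $ k)\<bar> \<le> \<bar>b - 1\<bar> * d" "\<bar>(a - b) * (min (x $ k) l - min (y $ k) l)\<bar> \<le> \<bar>a - b\<bar> * d"
      using k m by (auto simp: abs_mult intro!: mult_left_mono)
    moreover have "norm (x - y) = d" by (simp add: d_def dist_norm)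
    ultimately show ?thesis by (intro add_mono order_trans[OF abs_triangle_ineq add_mono]) auto
  qed
  finally show "dist (stretch k a b l x) (stretch k a b l y) \<le> (1 + \<bar>b - 1\<bar> + \<bar>a - b\<bar>) * dist x y"
    by (simp add: d_def algebra_simps)
qed simp

lemma stretch_has_derivative:
  fixes x :: "real^'n"
  assumes "x $ k \<noteq> l"
  shows "(stretch k a b l has_derivative (*v) (stretch_gradient k a b l x)) (at x)"
proof (cases "x $ k < l")
  case True
  have "((*v) (dilation k a) has_derivative (*v) (dilation k a)) (at x)" by (rule has_derivative_matrix)
  then have "(stretch k a b l has_derivative (*v) (dilation k a)) (at x)"
  proof (rule has_derivative_transform_within_open)
    show "open {y :: real^'n. y $ k < l}" by (rule open_halfspace_component_lt_cart)
  qed (use True in \<open>auto simp: vec_eq_iff stretch_nth dilation_mult_vec min_def algebra_simps\<close>)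
  then show ?thesis using True by (simp add: stretch_gradient_def)
next
  case False
  have "((\<lambda>y. dilation k b *v y + ((a - b) * l) *\<^sub>R axis k 1) has_derivative (*v) (dilation k b)) (at x)"
    using has_derivative_add_const[OF has_derivative_matrix] .
  then have "(stretch k a b l has_derivative (*v) (dilation k b)) (at x)"
  proof (rule has_derivative_transform_within_open)
    show "open {y :: real^'n. y $ k > l}" by (rule open_halfspace_component_gt_cart)
  qed (use False assms in \<open>auto simp: vec_eq_iff stretch_nth dilation_mult_vec min_def axis_def\<close>)
  then show ?thesis using False by (simp add: stretch_gradient_def)
qed

lemma sobolev_W1_stretch:
  fixes \<Omega> :: "(real^'n) set"
  assumes "\<Omega> \<in> lmeasurable" "bounded \<Omega>" "0 \<le> p"
  shows "sobolev_W1 p \<Omega> (stretch k a b l) (stretch_gradient k a b l)"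
proof (rule sobolev_W1_lipschitz[OF stretch_lipschitz])
  show "norm (stretch_gradient k a b l x) \<le> norm (dilation k a :: real^'n^'n) + norm (dilation k b :: real^'n^'n)" for x :: "real^'n"
    by (simp add: stretch_gradient_def)
  have "{x :: real^'n. x $ k < l} \<in> sets lebesgue"
    by (simp add: open_halfspace_component_lt_cart)
  then show "stretch_gradient k a b l \<in> borel_measurable lebesgue"
    unfolding stretch_gradient_def by (intro measurable_If) auto
  have "negligible {x :: real^'n. x $ k = l}" 
    using negligible_standard_hyperplane[of "axis k 1 :: real^'n" l] by (simp add: inner_axis axis_in_Basis_iff)
  then have "AE x in lebesgue. x \<notin> {x :: real^'n. x $ k = l}"
    by (intro AE_not_in) (simp add: negligible_iff_null_sets)
  then show "AE x in lebesgue. (stretch k a b l has_derivative (*v) (stretch_gradient k a b l x)) (at (x :: real^'n))"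
    by eventually_elim (simp add: stretch_has_derivative)
qed (use assms in auto)

text \<open>In direction \<open>k\<close> the pieces of length \<open>l\<close> and
  \<open>1 - l\<close> acquire the lengths \<open>a * l\<close> and \<open>b * (1 - l)\<close>,
  which add up to \<open>m\<close>. The unit cube therefore has the same image as under the dilation
  by \<open>m\<close>, although the two maps may differ on the boundary.\<close>

lemma stretch_box:
  fixes k :: "'n::finite"
  assumes ab: "0 < a" "0 < b" and l: "0 < l" "l < 1" and m: "m = a * l + b * (1 - l)"
  shows "homeomorphism (box 0 One) ((*v) (dilation k m) ` box 0 One) (stretch k a b l) (stretch k (1 / a) (1 / b) (a * l))"
proof -
  let ?B = "box 0 (\<chi> i. if i = k then m else 1) :: (real^'n) set"
  have m0: "0 < m" unfolding m using ab l by (intro add_pos_pos) auto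
  have "(*v) (dilation k m) ` box 0 One = ?B"
  proof (intro set_eqI iffI)
    fix x assume "x \<in> (*v) (dilation k m) ` box 0 One"
    then show "x \<in> ?B" using m0 by (auto simp: mem_box_cart dilation_mult_vec)
  next
    fix x assume "x \<in> ?B"
    then have "x = dilation k m *v (dilation k (1 / m) *v x)" "dilation k (1 / m) *v x \<in> box 0 One"
      using m0 by (auto simp: mem_box_cart dilation_mult_vec vec_eq_iff split: if_splits)
    then show "x \<in> (*v) (dilation k m) ` box 0 One" by (rule image_eqI)
  qed
  moreover have "stretch k a b l x \<in> ?B" if x: "x \<in> box 0 One" for x
  proof -
    have x': "0 < x $ i" "x $ i < 1" for i using x by (auto simp: mem_box_cart)
    have "0 < b * x $ k + (a - b) * min (x $ k) l \<and> b * x $ k + (a - b) * min (x $ k) l < m"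
    proof (cases "x $ k \<le> l")
      case True
      have "a * x $ k \<le> a * l" "0 < b * (1 - l)" "0 < a * x $ k" using True x' ab l by auto
      then show ?thesis using True unfolding m by (simp add: min_absorb1 algebra_simps)
    next
      case False
      have "b * (x $ k - l) < b * (1 - l)" "0 < b * (x $ k - l)" "0 < a * l" using False x' ab l by auto
      then show ?thesis using False unfolding m by (simp add: min_absorb2 algebra_simps)
    qed
    then show ?thesis using x' by (simp add: mem_box_cart stretch_nth)
  qed
  moreover have "stretch k (1 / a) (1 / b) (a * l) x \<in> box 0 One" if x: "x \<in> ?B" for x
  proof -
    have xk: "0 < x $ k" "x $ k < m" and x': "0 < x $ i" "i \<noteq> k \<Longrightarrow> x $ i < 1" for i
      using x by (auto simp: mem_box_cart split: if_splits)
    have "0 < 1 / b * x $ k + (1 / a - 1 / b) * min (x $ k) (a * l) \<and>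
       1 / b * x $ k + (1 / a - 1 / b) * min (x $ k) (a * l) < 1"
    proof (cases "x $ k \<le> a * l")
      case True
      then have e: "1 / b * x $ k + (1 / a - 1 / b) * min (x $ k) (a * l) = x $ k / a"
        by (simp add: min_absorb1 algebra_simps)
      have "x $ k / a \<le> l" using True ab by (simp add: field_simps)
      moreover have "0 < x $ k / a" using xk ab by simp
      ultimately show ?thesis unfolding e using l by linarith
    next
      case False
      then have "1 / b * x $ k + (1 / a - 1 / b) * min (x $ k) (a * l) = (x $ k - a * l) / b + l"
        using ab by (simp add: min_absorb2 field_simps)
      moreover have "0 < (x $ k - a * l) / b" using False ab by simp
      moreover have "(x $ k - a * l) / b < 1 - l" using xk ab unfolding m by (simp add: field_simps)
      ultimately show ?thesis using l by auto
    qed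
    then show ?thesis using x' by (simp add: mem_box_cart stretch_nth)
  qed
  moreover have "stretch k a b l (stretch k (1 / a) (1 / b) (a * l) x) = x" for x :: "real^'n"
    using stretch_inverse[of "1 / a" "1 / b" k "a * l" x] ab by simp
  moreover have "continuous_on S (stretch k a b l)" for a b l and S :: "(real^'n) set"
    using lipschitz_on_continuous_on[OF stretch_lipschitz] by (rule continuous_on_subset) simp
  ultimately show ?thesis
    using ab by (intro homeomorphismI) (auto simp: stretch_inverse)
qed

lemma mean_inequality_convex:
  fixes \<Psi> :: "real^'n^'n \<Rightarrow> real"
  assumes ineq: "mean_inequality p \<Psi>" and p: "0 \<le> p" and nonneg: "\<And>A. 0 < det A \<Longrightarrow> 0 \<le> \<Psi> A"
  shows "convex_on {0<..} (\<lambda>t. \<Psi> (dilation k t))"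
proof (rule convex_onI)
  fix t a b :: real
  assume t: "0 < t" "t < 1" and ab: "a \<in> {0<..}" "b \<in> {0<..}"
  \<comment> \<open>\<open>convex_onI\<close> gives \<open>a\<close> the weight
    \<open>1 - t\<close>; this becomes the volume of the part of the cube with gradient
    \<open>dilation k a\<close>.\<close>
  define l where "l = 1 - t"
  have l: "0 < l" "l < 1" using t by (auto simp: l_def)
  have ab0: "0 < a" "0 < b" using ab by auto
  define m where "m = a * l + b * (1 - l)"
  have m0: "0 < m" unfolding m_def using ab0 l by (intro add_pos_pos) auto
  let ?\<Omega> = "box 0 One :: (real^'n) set"
  let ?\<Omega>1 = "box 0 (\<chi> i. if i = k then l else 1) :: (real^'n) set"
  let ?F = "stretch_gradient k a b l :: real^'n \<Rightarrow> real^'n^'n"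
  have e1: "emeasure lborel ?\<Omega> = 1"
    using emeasure_lborel_box[of "0 :: real^'n" One] by simp
  have bne: "?\<Omega> \<noteq> {}" using e1 by force
  have em: "open ?\<Omega>" "bounded ?\<Omega>" "convex ?\<Omega>" "?\<Omega> \<noteq> {}"
    by (auto simp: open_box bounded_box bne)
  have OPI: "orientation_preserving_invertible p ?\<Omega> ((*v) (dilation k m) ` ?\<Omega>) (stretch k a b l) ?F"
    unfolding orientation_preserving_invertible_def
  proof (intro conjI exI)
    show "homeomorphism ?\<Omega> ((*v) (dilation k m) ` ?\<Omega>) (stretch k a b l) (stretch k (1 / a) (1 / b) (a * l))"
      using ab0 l by (intro stretch_box) (simp_all add: m_def)
    show "sobolev_W1 p ?\<Omega> (stretch k a b l) ?F"
      using em p by (intro sobolev_W1_stretch) auto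
    show "sobolev_W1 p ((*v) (dilation k m) ` ?\<Omega>) (stretch k (1 / a) (1 / b) (a * l)) (stretch_gradient k (1 / a) (1 / b) (a * l))"
      using lmeasurable_matrix_image_open[OF em(1,2), of "dilation k m"] m0 p
      by (intro sobolev_W1_stretch) auto
    show "AE x in lebesgue_on ?\<Omega>. 0 < det (?F x)"
      using ab0 by (intro AE_I2) (simp add: stretch_gradient_def)
  qed
  have "ennreal (\<Psi> (dilation k m)) \<le> 1 / emeasure lebesgue ?\<Omega> * (\<integral>\<^sup>+ x. ennreal (\<Psi> (?F x)) \<partial>lebesgue_on ?\<Omega>)"
    using m0 em OPI by (intro mean_inequalityD[OF ineq] bounded_lipschitz_domain_convex) auto
  also have "1 / emeasure lebesgue ?\<Omega> = 1" using e1 by simp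
  also have "1 * (\<integral>\<^sup>+ x. ennreal (\<Psi> (?F x)) \<partial>lebesgue_on ?\<Omega>) = (\<integral>\<^sup>+ x. ennreal (\<Psi> (?F x)) \<partial>lebesgue_on ?\<Omega>)"
    by simp
  also have "\<dots> = (\<integral>\<^sup>+ x. ennreal (\<Psi> (?F x)) * indicator ?\<Omega> x \<partial>lebesgue)"
    by (rule nn_integral_restrict_space) simp
  also have "\<dots> = (\<integral>\<^sup>+ x. ennreal (\<Psi> (dilation k a)) * indicator ?\<Omega>1 x + ennreal (\<Psi> (dilation k b)) * indicator (?\<Omega> - ?\<Omega>1) x \<partial>lebesgue)"
  proof (intro nn_integral_cong)
    fix x :: "real^'n"
    have "x \<in> ?\<Omega>1 \<longleftrightarrow> x \<in> ?\<Omega> \<and> x $ k < l"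
      using l by (auto simp: mem_box_cart split: if_splits intro: less_trans[of _ l])
    then show "ennreal (\<Psi> (?F x)) * indicator ?\<Omega> x =
      ennreal (\<Psi> (dilation k a)) * indicator ?\<Omega>1 x + ennreal (\<Psi> (dilation k b)) * indicator (?\<Omega> - ?\<Omega>1) x"
      by (auto simp: indicator_def stretch_gradient_def)
  qed
  also have "\<dots> = ennreal (\<Psi> (dilation k a)) * emeasure lebesgue ?\<Omega>1 + ennreal (\<Psi> (dilation k b)) * emeasure lebesgue (?\<Omega> - ?\<Omega>1)"
    by (subst nn_integral_add)
       (auto simp: nn_integral_cmult_indicator intro!: borel_measurable_times_ennreal borel_measurable_indicator)
  also have "emeasure lebesgue ?\<Omega>1 = ennreal l"
  proof -
    have "emeasure lborel ?\<Omega>1 = ennreal (\<Prod>i\<in>UNIV. if i = k then l else 1)"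
    proof -
      have "emeasure lborel ?\<Omega>1 = ennreal (\<Prod>b\<in>Basis. ((\<chi> i. if i = k then l else 1) - 0 :: real^'n) \<bullet> b)"
        using l by (intro emeasure_lborel_box) (auto simp: Basis_vec_def inner_axis)
      also have "(\<Prod>b\<in>Basis. ((\<chi> i. if i = k then l else 1) - 0 :: real^'n) \<bullet> b) = (\<Prod>i\<in>UNIV. if i = k then l else 1)"
        unfolding Basis_vec_def
        by (subst prod.UNION_disjoint) (auto simp: axis_eq_axis inner_axis)
      finally show ?thesis .
    qed
    then show ?thesis by simp
  qed
  also have "emeasure lebesgue (?\<Omega> - ?\<Omega>1) = ennreal (1 - l)"
  proof -
    have "?\<Omega>1 \<subseteq> ?\<Omega>" using l by (auto simp: mem_box_cart split: if_splits) (metis less_trans)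
    then have "emeasure lebesgue (?\<Omega> - ?\<Omega>1) = emeasure lebesgue ?\<Omega> - emeasure lebesgue ?\<Omega>1"
      using \<open>emeasure lebesgue ?\<Omega>1 = ennreal l\<close> by (intro emeasure_Diff) auto
    then show ?thesis using \<open>emeasure lebesgue ?\<Omega>1 = ennreal l\<close> e1 l
      by (simp add: ennreal_minus flip: ennreal_1)
  qed
  also have "ennreal (\<Psi> (dilation k a)) * ennreal l + ennreal (\<Psi> (dilation k b)) * ennreal (1 - l) =
      ennreal (\<Psi> (dilation k a) * l + \<Psi> (dilation k b) * (1 - l))"
    using nonneg[of "dilation k a"] nonneg[of "dilation k b"] ab0 l
    by (simp add: ennreal_mult ennreal_plus)
  finally have "ennreal (\<Psi> (dilation k m)) \<le> ennreal (\<Psi> (dilation k a) * l + \<Psi> (dilation k b) * (1 - l))" .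
  then have "\<Psi> (dilation k m) \<le> \<Psi> (dilation k a) * l + \<Psi> (dilation k b) * (1 - l)"
    by (subst (asm) ennreal_le_iff) (use nonneg[of "dilation k a"] nonneg[of "dilation k b"] ab0 l in simp)
  then show "\<Psi> (dilation k ((1 - t) *\<^sub>R a + t *\<^sub>R b)) \<le> (1 - t) * \<Psi> (dilation k a) + t * \<Psi> (dilation k b)"
    by (simp add: m_def l_def mult.commute)
qed simp

section \<open>Morrey's inequality\<close>

text \<open>The kernel on the cube with lower corner \<open>z + t *\<^sub>R e\<close> and side
  \<open>t\<close>: as \<open>t\<close> decreases, these cubes contract towards \<open>z\<close>.
  One factor \<open>1 / t\<close> per coordinate keeps the mass independent of
  \<open>t\<close>.\<close>

definition mollifier :: "real^'n \<Rightarrow> real^'n \<Rightarrow> real \<Rightarrow> real^'n \<Rightarrow> real" where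
  "mollifier z e t x = (\<Prod>i\<in>UNIV. bump 1 0 ((x $ i - z $ i) / t - e $ i) / t)"

text \<open>The \<open>j\<close>-th component of the velocity times the mollifier: in the rescaled
  variable \<open>s = (x $ j - z $ j) / t - e $ j\<close>, the polynomial
  \<open>[:e $ j, 1:]\<close> takes the value \<open>(x $ j - z $ j) / t\<close>. As a
  \<open>bump_prod\<close> it is a legitimate test function.\<close>

definition mollifier_flux :: "real^'n \<Rightarrow> real^'n \<Rightarrow> real \<Rightarrow> 'n \<Rightarrow> real^'n \<Rightarrow> real" where
  "mollifier_flux z e t j =
     bump_prod ((1 / t) ^ CARD('n)) ((\<lambda>_. 1)(j := [:e $ j, 1:])) (\<lambda>_. 0) (z + t *\<^sub>R e) t"

text \<open>A closed form of the \<open>j\<close>-th partial derivative of the flux, in which the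
  joint continuity in \<open>t\<close> and \<open>x\<close> required for differentiation under the
  integral is visible.\<close>

definition mollifier_flux_deriv :: "real^'n \<Rightarrow> real^'n \<Rightarrow> real \<Rightarrow> 'n \<Rightarrow> real^'n \<Rightarrow> real" where
  "mollifier_flux_deriv z e t j x =
     (1 / t) * (bump (bump_deriv_poly [:e $ j, 1:] 0) 2 ((x $ j - z $ j) / t - e $ j) / t) *
     (\<Prod>i\<in>UNIV - {j}. bump 1 0 ((x $ i - z $ i) / t - e $ i) / t)"

lemma bump_has_derivative_0: "(bump P 0 has_real_derivative bump (bump_deriv_poly P 0) 2 s) (at s)"
  using bump_has_derivative[of P 0 s] by (simp only: add_0)

text \<open>The bump with linear polynomial is differentiated by the general formula and by the
  product rule; uniqueness of derivatives replaces a computation with polynomials.\<close>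

lemma bump_linear_deriv:
  "bump (bump_deriv_poly [:c, 1:] 0) 2 s = bump 1 0 s + (s + c) * bump (bump_deriv_poly 1 0) 2 s"
proof (rule DERIV_unique)
  show "(bump [:c, 1:] 0 has_real_derivative bump (bump_deriv_poly [:c, 1:] 0) 2 s) (at s)"
    by (rule bump_has_derivative_0)
  have "bump [:c, 1:] 0 = (\<lambda>s. (s + c) * bump 1 0 s)"
    by (auto simp: bump_def fun_eq_iff)
  moreover have "((\<lambda>s. (s + c) * bump 1 0 s) has_real_derivative
      bump 1 0 s + (s + c) * bump (bump_deriv_poly 1 0) 2 s) (at s)"
    using bump_has_derivative_0[of 1 s] by (auto intro!: derivative_eq_intros)
  ultimately show "(bump [:c, 1:] 0 has_real_derivative bump 1 0 s + (s + c) * bump (bump_deriv_poly 1 0) 2 s) (at s)"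
    by simp
qed

text \<open>The mollifiers solve the continuity equation with velocity \<open>(x - z) / t\<close>.\<close>
lemma mollifier_has_derivative:
  assumes t: "t > 0"
  shows "((\<lambda>t. mollifier z e t x) has_real_derivative - (\<Sum>j\<in>UNIV. mollifier_flux_deriv z e t j x)) (at t)"
proof -
  let ?s = "\<lambda>i t. (x $ i - z $ i) / t - e $ i"
  let ?f = "\<lambda>i t. bump 1 0 (?s i t) / t"
  let ?c = "\<lambda>i t. - ((1 / t) * (bump (bump_deriv_poly [:e $ i, 1:] 0) 2 (?s i t) / t))"
  have "(?f i has_real_derivative ?c i t) (at t)" for i
  proof -
    have "(?s i has_real_derivative - ((x $ i - z $ i) / t\<^sup>2)) (at t)"
      using t by (auto intro!: derivative_eq_intros simp: power2_eq_square minus_divide_left)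
    moreover have "(bump 1 0 has_real_derivative bump (bump_deriv_poly 1 0) 2 (?s i t)) (at (?s i t))"
      by (rule bump_has_derivative_0)
    ultimately have "((\<lambda>t. bump 1 0 (?s i t)) has_real_derivative
        bump (bump_deriv_poly 1 0) 2 (?s i t) * - ((x $ i - z $ i) / t\<^sup>2)) (at t)"
      by (rule DERIV_chain2[rotated])
    then have "(?f i has_real_derivative
       (bump (bump_deriv_poly 1 0) 2 (?s i t) * - ((x $ i - z $ i) / t\<^sup>2) * t - bump 1 0 (?s i t) * 1) / (t * t)) (at t)"
      using t by (intro DERIV_divide DERIV_ident) auto
    \<comment> \<open>Since \<open>(x $ i - z $ i) / t = ?s i t + e $ i\<close>, the quotient rule
      yields minus the right-hand side of \<open>bump_linear_deriv\<close> over
      \<open>t * t\<close>, hence the derivative of the corresponding flux factor.\<close>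
    moreover have "(bump (bump_deriv_poly 1 0) 2 (?s i t) * - ((x $ i - z $ i) / t\<^sup>2) * t - bump 1 0 (?s i t) * 1) / (t * t) = ?c i t"
    proof -
      have "(x $ i - z $ i) / t\<^sup>2 * t = ?s i t + e $ i" using t by (simp add: power2_eq_square)
      moreover have alg: "B * - A * t = - ((A * t) * B)" for A B :: real by (simp add: mult_ac)
      ultimately have "bump (bump_deriv_poly 1 0) 2 (?s i t) * - ((x $ i - z $ i) / t\<^sup>2) * t =
          - ((?s i t + e $ i) * bump (bump_deriv_poly 1 0) 2 (?s i t))"
        by (simp only: alg)
      moreover have alg2: "X = - Y \<Longrightarrow> (X - c * 1) / (t * t) = - ((1 / t) * ((c + Y) / t))" for X Y c
        by (simp add: diff_divide_distrib add_divide_distrib)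
      ultimately show ?thesis unfolding bump_linear_deriv by (intro alg2)
    qed
    ultimately show ?thesis by simp
  qed
  then have fd: "\<And>i. (?f i has_derivative (\<lambda>h. ?c i t * h)) (at t)"
    by (simp only: has_field_derivative_def)
  have "((\<lambda>t. \<Prod>i\<in>UNIV. ?f i t) has_derivative
      (\<lambda>h. \<Sum>i\<in>UNIV. ?c i t * h * (\<Prod>j\<in>UNIV - {i}. ?f j t))) (at t)"
    by (intro has_derivative_prod fd)
  moreover have "(\<Sum>i\<in>UNIV. ?c i t * h * (\<Prod>j\<in>UNIV - {i}. ?f j t)) = - (\<Sum>j\<in>UNIV. mollifier_flux_deriv z e t j x) * h" for h
    unfolding sum_negf[symmetric] sum_distrib_right mollifier_flux_deriv_def
    by (intro sum.cong refl) (simp add: mult_ac)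
  ultimately have "((\<lambda>t. \<Prod>i\<in>UNIV. ?f i t) has_derivative
      (\<lambda>h. - (\<Sum>j\<in>UNIV. mollifier_flux_deriv z e t j x) * h)) (at t)" by simp
  then show ?thesis unfolding mollifier_def has_field_derivative_def .
qed

lemma partial_deriv_mollifier_flux:
  fixes z :: "real^'n"
  assumes t: "t > 0"
  shows "partial_deriv j (mollifier_flux z e t j) x = mollifier_flux_deriv z e t j x"
proof -
  have s: "(x $ i - (z + t *\<^sub>R e) $ i) / t = (x $ i - z $ i) / t - e $ i" for i
    using t by (simp add: field_simps)
  have "(\<Prod>i\<in>UNIV - {j}. bump 1 0 ((x $ i - z $ i) / t - e $ i) / t) =
     (\<Prod>i\<in>UNIV - {j}. bump 1 0 ((x $ i - z $ i) / t - e $ i)) * (1 / t) ^ (CARD('n) - 1)"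
    by (simp add: prod_dividef power_one_over)
  moreover have "(1 / t) ^ CARD('n) = (1 / t) ^ (CARD('n) - 1) * (1 / t)"
    by (metis One_nat_def Suc_pred power_Suc2 zero_less_card_finite)
  moreover have "partial_deriv j (mollifier_flux z e t j) x =
     (1 / t) ^ CARD('n) / t * (bump (bump_deriv_poly [:e $ j, 1:] 0) 2 ((x $ j - z $ j) / t - e $ j) *
      (\<Prod>i\<in>UNIV - {j}. bump 1 0 ((x $ i - z $ i) / t - e $ i)))"
    unfolding mollifier_flux_def partial_deriv_bump_prod[OF t] bump_prod_def s
    by (subst prod.remove[of _ j]) (auto intro!: prod.cong simp del: add_2_eq_Suc add_2_eq_Suc')
  ultimately show ?thesis unfolding mollifier_flux_deriv_def by simp
qed

lemma mollifier_eq_bump_prod: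
  fixes z :: "real^'n"
  assumes "t > 0"
  shows "mollifier z e t = bump_prod ((1 / t) ^ CARD('n)) (\<lambda>_. 1) (\<lambda>_. 0) (z + t *\<^sub>R e) t"
proof
  fix x
  have s: "(x $ i - (z + t *\<^sub>R e) $ i) / t = (x $ i - z $ i) / t - e $ i" for i
    using assms by (simp add: field_simps)
  show "mollifier z e t x = bump_prod ((1 / t) ^ CARD('n)) (\<lambda>_. 1) (\<lambda>_. 0) (z + t *\<^sub>R e) t x"
    unfolding bump_prod_def s mollifier_def by (simp add: prod_dividef power_divide)
qed

lemma bump_1_0_bounds: "0 \<le> bump 1 0 s" "bump 1 0 s \<le> 1"
  by (auto simp: bump_def)

lemma mollifier_nonneg: "t > 0 \<Longrightarrow> 0 \<le> mollifier z e t x"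
  unfolding mollifier_def by (intro prod_nonneg) (auto simp: bump_1_0_bounds)

text \<open>The velocity factor \<open>e $ j + s\<close>, with \<open>e $ j\<close> in
  \<open>[-1, 0]\<close> and \<open>s\<close> in \<open>(0, 1)\<close>, has absolute value at most
  1, so the flux is no larger than the height of the scaled kernel.\<close>

lemma mollifier_flux_bound:
  fixes e :: "real^'n"
  assumes t: "t > 0" and e: "- 1 \<le> e $ j" "e $ j \<le> 0"
  shows "\<bar>mollifier_flux z e t j x\<bar> \<le> (1 / t) ^ CARD('n) * indicator (cbox (z + t *\<^sub>R e) (z + t *\<^sub>R e + t *\<^sub>R One)) x"
proof (cases "mollifier_flux z e t j x = 0")
  case False
  then have "x \<in> cbox (z + t *\<^sub>R e) (z + t *\<^sub>R e + t *\<^sub>R One)"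
    using bump_prod_nonzeroD[OF False[unfolded mollifier_flux_def] t] t
    by (auto simp: mem_box_cart less_imp_le)
  moreover have "\<bar>bump (((\<lambda>_. 1)(j := [:e $ j, 1:])) i) 0 s\<bar> \<le> 1" for i s
  proof (cases "0 < s \<and> s < 1")
    case True
    have "\<bar>e $ j + s\<bar> * exp (- (1 / (s * (1 - s)))) \<le> 1 * 1"
      using True e by (intro mult_mono) auto
    then show ?thesis using bump_1_0_bounds[of s] True by (auto simp: bump_def abs_mult)
  qed (auto simp: bump_def)
  then have "\<bar>\<Prod>i\<in>UNIV. bump (((\<lambda>_. 1)(j := [:e $ j, 1:])) i) 0 ((x $ i - (z + t *\<^sub>R e) $ i) / t)\<bar> \<le> 1"
    unfolding abs_prod by (intro prod_le_1) auto
  ultimately show ?thesis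
    using t by (simp add: mollifier_flux_def bump_prod_def abs_mult mult_left_le)
qed (use t in simp)

text \<open>Only positivity and independence of \<open>z\<close>, \<open>e\<close> and
  \<open>t\<close> matter, so the kernel is not normalised. The type argument records that the
  constant depends on the dimension.\<close>

definition mollifier_mass :: "'n::finite itself \<Rightarrow> real" where
  "mollifier_mass _ = integral (cbox 0 One) (\<lambda>x::real^'n. \<Prod>i\<in>UNIV. bump 1 0 (x $ i))"

lemma mollifier_mass_pos: "0 < mollifier_mass TYPE('n::finite)"
proof -
  let ?f = "\<lambda>x::real^'n. \<Prod>i\<in>UNIV. bump 1 0 (x $ i)"
  have c: "continuous_on (cbox 0 One) ?f" by (intro continuous_intros)
  have nn: "0 \<le> ?f x" for x by (intro prod_nonneg) (auto simp: bump_1_0_bounds)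
  have "integral (cbox 0 One) ?f \<noteq> 0"
  proof
    assume "integral (cbox 0 One) ?f = 0"
    then have "(?f has_integral 0) (cbox 0 One)" using integrable_continuous[OF c] by (metis integrable_integral)
    moreover have "((\<chi> i. 1 / 2) :: real^'n) \<in> cbox 0 One" by (simp add: mem_box_cart)
    ultimately have "?f ((\<chi> i. 1 / 2) :: real^'n) = 0"
      by (intro has_integral_0_cbox_imp_0[OF c nn]) (simp_all add: box_ne_empty)
    then show False by (simp add: bump_def)
  qed
  moreover have "0 \<le> integral (cbox 0 One) ?f" using nn by (intro integral_nonneg integrable_continuous c) auto
  ultimately show ?thesis by (simp add: mollifier_mass_def)
qed

lemma integral_mollifier:
  fixes z :: "real^'n"
  assumes t: "t > 0" and sub: "cbox (z + t *\<^sub>R e) (z + t *\<^sub>R e + t *\<^sub>R One) \<subseteq> cbox a b"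
  shows "(mollifier z e t has_integral mollifier_mass TYPE('n)) (cbox a b)"
proof -
  let ?q = "z + t *\<^sub>R e"
  let ?f = "\<lambda>x::real^'n. \<Prod>i\<in>UNIV. bump 1 0 (x $ i)"
  have "(?f has_integral mollifier_mass TYPE('n)) (cbox 0 One)"
    unfolding mollifier_mass_def by (intro integrable_integral integrable_continuous continuous_intros)
  from has_integral_affinity[OF this, of "1 / t" "- (1 / t) *\<^sub>R ?q"] t
  have "((\<lambda>x. ?f ((1 / t) *\<^sub>R x + - (1 / t) *\<^sub>R ?q)) has_integral t ^ CARD('n) * mollifier_mass TYPE('n))
     ((\<lambda>x. t *\<^sub>R x + ?q) ` cbox 0 One)"
    by (simp add: power_divide add.commute)
  also have "(\<lambda>x. t *\<^sub>R x + ?q) ` cbox 0 One = cbox ?q (?q + t *\<^sub>R One)"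
    using t by (subst image_affinity_cbox) (auto simp: add.commute box_ne_empty)
  finally have "((\<lambda>x. (1 / t) ^ CARD('n) * ?f ((1 / t) *\<^sub>R x + - (1 / t) *\<^sub>R ?q)) has_integral
     (1 / t) ^ CARD('n) * (t ^ CARD('n) * mollifier_mass TYPE('n))) (cbox ?q (?q + t *\<^sub>R One))"
    by (rule has_integral_mult_right)
  moreover have "(1 / t) ^ CARD('n) * (t ^ CARD('n) * mollifier_mass TYPE('n)) = mollifier_mass TYPE('n)"
    using t by (simp add: power_divide)
  moreover have "(1 / t) ^ CARD('n) * ?f ((1 / t) *\<^sub>R x + - (1 / t) *\<^sub>R ?q) = mollifier z e t x" for x
  proof -
    have "(1 / t) *\<^sub>R x + - (1 / t) *\<^sub>R ?q = (\<chi> i. (x $ i - z $ i) / t - e $ i)"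
      using t by (simp add: vec_eq_iff field_simps)
    then show ?thesis by (simp add: mollifier_def prod_dividef power_divide)
  qed
  ultimately have "(mollifier z e t has_integral mollifier_mass TYPE('n)) (cbox ?q (?q + t *\<^sub>R One))"
    by simp
  moreover have "mollifier z e t x = 0" if "x \<notin> cbox ?q (?q + t *\<^sub>R One)" for x
  proof (rule ccontr)
    assume nz: "mollifier z e t x \<noteq> 0"
    show False
      using that bump_prod_nonzeroD[OF nz[unfolded mollifier_eq_bump_prod[OF t]] t]
      by (auto simp: mem_box_cart less_imp_le)
  qed
  ultimately show ?thesis using sub has_integral_on_superset by blast
qed

text \<open>Takes the place of Hoelder's inequality: the threshold \<open>s\<close> is free and is
  balanced against the integral later.\<close>

lemma le_powr_add:
  fixes f s p :: real
  assumes "0 \<le> f" "0 < s" "1 < p"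
  shows "f \<le> s powr (1 - p) * f powr p + s"
proof (cases "f \<le> s")
  case False
  then have f: "s < f" "0 < f" using assms by auto
  have "f = f powr (1 - p) * f powr p" using f by (simp add: powr_add[symmetric])
  also have "\<dots> \<le> s powr (1 - p) * f powr p"
    using f assms by (intro mult_right_mono powr_mono2') auto
  finally show ?thesis using assms by linarith
qed (use assms in \<open>simp add: add_increasing\<close>)

lemma content_cube: "t \<ge> 0 \<Longrightarrow> measure lborel (cbox q (q + t *\<^sub>R One :: real^'n)) = t ^ CARD('n)"
  by (simp add: content_cbox' box_ne_empty inner_add_left)

text \<open>The flux has height at most \<open>(1 / t) ^ n\<close> on a cube of volume
  \<open>t ^ n\<close>. The resulting exponent \<open>- n / p\<close> is greater than -1 because
  \<open>p > n\<close>, so the bound is integrable in \<open>t\<close> near 0; Morrey's inequality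
  rests on this.\<close>

lemma mollifier_flux_integral_bound:
  fixes F :: "real^'n \<Rightarrow> real^'n"
  assumes p: "real CARD('n) < p" and t: "0 < t" and e: "- 1 \<le> e $ j" "e $ j \<le> 0"
    and sub: "cbox (z + t *\<^sub>R e) (z + t *\<^sub>R e + t *\<^sub>R One) \<subseteq> cbox a b"
    and F: "(\<lambda>x. F x $ j) absolutely_integrable_on cbox a b"
    and Fp: "(\<lambda>x. norm (F x) powr p) integrable_on cbox a b"
    and J: "0 < J" "integral (cbox a b) (\<lambda>x. norm (F x) powr p) \<le> J"
  shows "\<bar>integral (cbox a b) (\<lambda>x. F x $ j * mollifier_flux z e t j x)\<bar>
     \<le> 2 * J powr (1 / p) * t powr (- (real CARD('n) / p))"
proof -
  let ?n = "real CARD('n)"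
  let ?q = "z + t *\<^sub>R e"
  let ?B = "cbox ?q (?q + t *\<^sub>R One)"
  have n1: "1 \<le> ?n" by (simp add: Suc_leI)
  then have p1: "1 < p" using p by linarith
  \<comment> \<open>The threshold at which both terms of \<open>le_powr_add\<close> contribute
    \<open>\<sigma>\<close>: it solves
    \<open>(1 / t) ^ n * \<sigma> powr (1 - p) * J = \<sigma>\<close>. This is the origin of the
    factor 2.\<close>
  define \<sigma> where "\<sigma> = J powr (1 / p) * t powr (- (?n / p))"
  have \<sigma>: "0 < \<sigma>" using J t by (simp add: \<sigma>_def)
  let ?g = "\<lambda>x. ((1 / t) ^ CARD('n) * \<sigma> powr (1 - p)) * norm (F x) powr p + ((1 / t) ^ CARD('n) * \<sigma>) * indicator ?B x"
  have "((\<lambda>x. 1) has_integral t ^ CARD('n)) ?B"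
    using has_integral_const[of "1::real" ?q "?q + t *\<^sub>R One"] content_cube[of t ?q] t by simp
  then have "((\<lambda>x. if x \<in> ?B then 1 else 0) has_integral t ^ CARD('n)) (cbox a b)"
    using has_integral_restrict[OF sub, of "\<lambda>x. 1::real"] by simp
  then have ind: "((\<lambda>x. indicator ?B x :: real) has_integral t ^ CARD('n)) (cbox a b)"
    by (simp add: indicator_def of_bool_def)
  have g: "(?g has_integral ((1 / t) ^ CARD('n) * \<sigma> powr (1 - p)) * integral (cbox a b) (\<lambda>x. norm (F x) powr p)
      + ((1 / t) ^ CARD('n) * \<sigma>) * t ^ CARD('n)) (cbox a b)"
    by (intro has_integral_add has_integral_mult_right ind integrable_integral Fp)
  have Vc: "continuous_on S (mollifier_flux z e t j)" for S
    unfolding mollifier_flux_def by (rule continuous_on_bump_prod)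
  have "(\<lambda>x. mollifier_flux z e t j x * F x $ j) absolutely_integrable_on cbox a b"
    by (rule absolutely_integrable_bounded_measurable_product[OF bilinear_times _ _ _ F])
       (auto intro!: continuous_imp_measurable_on_sets_lebesgue Vc compact_imp_bounded compact_continuous_image)
  then have i: "(\<lambda>x. F x $ j * mollifier_flux z e t j x) integrable_on cbox a b"
    by (simp add: absolutely_integrable_on_def mult.commute)
  have "norm (integral (cbox a b) (\<lambda>x. F x $ j * mollifier_flux z e t j x)) \<le> integral (cbox a b) ?g"
  proof (rule integral_norm_bound_integral[OF i])
    show "?g integrable_on cbox a b" using g by blast
    fix x
    have "\<bar>F x $ j\<bar> \<le> norm (F x)" by (rule component_le_norm_cart)
    also have "\<dots> \<le> \<sigma> powr (1 - p) * norm (F x) powr p + \<sigma>" using \<sigma> p1 by (intro le_powr_add) auto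
    finally have "\<bar>F x $ j\<bar> * \<bar>mollifier_flux z e t j x\<bar> \<le>
      (\<sigma> powr (1 - p) * norm (F x) powr p + \<sigma>) * ((1 / t) ^ CARD('n) * indicator ?B x)"
      using mollifier_flux_bound[OF t e, of z x] by (intro mult_mono) auto
    also have "\<dots> \<le> ?g x" using t \<sigma> by (auto simp: indicator_def algebra_simps)
    finally show "norm (F x $ j * mollifier_flux z e t j x) \<le> ?g x" by (simp add: abs_mult)
  qed
  also have "integral (cbox a b) ?g = ((1 / t) ^ CARD('n) * \<sigma> powr (1 - p)) * integral (cbox a b) (\<lambda>x. norm (F x) powr p)
      + ((1 / t) ^ CARD('n) * \<sigma>) * t ^ CARD('n)" using g by (rule integral_unique)
  also have "\<dots> \<le> ((1 / t) ^ CARD('n) * \<sigma> powr (1 - p)) * J + \<sigma>"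
    using J t by (intro add_mono mult_left_mono) (auto simp: power_one_over)
  also have "((1 / t) ^ CARD('n) * \<sigma> powr (1 - p)) * J = \<sigma>"
  proof -
    have e1: "(1 / t) ^ CARD('n) = t powr (- ?n)"
      using t by (simp add: powr_minus powr_realpow power_one_over inverse_eq_divide)
    have e2: "\<sigma> powr (1 - p) = J powr ((1 - p) / p) * t powr (- (?n / p) * (1 - p))"
      using J t by (simp add: \<sigma>_def powr_mult powr_powr)
    have "((1 / t) ^ CARD('n) * \<sigma> powr (1 - p)) * J =
        (J powr ((1 - p) / p) * J powr 1) * (t powr (- ?n) * t powr (- (?n / p) * (1 - p)))"
      unfolding e1 e2 using J by simp
    also have "\<dots> = J powr ((1 - p) / p + 1) * t powr (- ?n + - (?n / p) * (1 - p))"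
      by (simp only: powr_add)
    also have "(1 - p) / p + 1 = 1 / p" using p1 by (simp add: field_simps)
    also have "- ?n + - (?n / p) * (1 - p) = - (?n / p)" using p1 by (simp add: field_simps)
    finally show ?thesis by (simp only: \<sigma>_def)
  qed
  finally show ?thesis by (simp add: \<sigma>_def)
qed

lemma continuous_on_mollifier_flux_deriv:
  fixes a b :: "real^'n"
  shows "continuous_on ({0<..} \<times> cbox a b) (\<lambda>w. mollifier_flux_deriv z e (fst w) j (snd w))"
  unfolding mollifier_flux_deriv_def by (intro continuous_intros) auto

text \<open>All differentiation falls on the kernel, so continuity of \<open>u\<close> is enough.
  The parameter ranges over the open half line because the kernel is singular at
  \<open>t = 0\<close>.\<close>

lemma mollified_has_derivative:
  fixes z :: "real^'n"
  assumes t: "0 < t" and u: "continuous_on (cbox a b) u"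
  shows "((\<lambda>t. integral (cbox a b) (\<lambda>x. u x * mollifier z e t x)) has_real_derivative
     - (\<Sum>j\<in>UNIV. integral (cbox a b) (\<lambda>x. u x * mollifier_flux_deriv z e t j x))) (at t)"
proof -
  let ?Q = "cbox a b"
  let ?D = "\<lambda>t x. u x * - (\<Sum>j\<in>UNIV. mollifier_flux_deriv z e t j x)"
  have "((\<lambda>t. integral ?Q (\<lambda>x. u x * mollifier z e t x)) has_field_derivative integral ?Q (?D t)) (at t within {0<..})"
  proof (rule leibniz_rule_field_derivative)
    fix s x assume s: "s \<in> {0::real<..}"
    then show "((\<lambda>s. u x * mollifier z e s x) has_field_derivative ?D s x) (at s within {0<..})"
      by (intro DERIV_cmult has_field_derivative_at_within[OF mollifier_has_derivative]) auto
  next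
    fix s assume s: "s \<in> {0::real<..}"
    show "(\<lambda>x. u x * mollifier z e s x) integrable_on ?Q"
      using s by (intro integrable_continuous continuous_intros u)
        (auto simp: mollifier_eq_bump_prod continuous_on_bump_prod)
  next
    show "continuous_on ({0<..} \<times> ?Q) (\<lambda>(s, x). ?D s x)"
      unfolding split_beta
      by (intro continuous_intros continuous_on_mollifier_flux_deriv continuous_on_compose2[OF u]) auto
  qed (use t in auto)
  then have "((\<lambda>t. integral ?Q (\<lambda>x. u x * mollifier z e t x)) has_field_derivative integral ?Q (?D t)) (at t)"
    using t by (simp add: at_within_open[of t "{0<..}"])
  moreover have "integral ?Q (?D t) = - (\<Sum>j\<in>UNIV. integral ?Q (\<lambda>x. u x * mollifier_flux_deriv z e t j x))"
  proof -
    have "(\<lambda>x. u x * mollifier_flux_deriv z e t j x) integrable_on ?Q" for j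
      unfolding mollifier_flux_deriv_def using t
      by (intro integrable_continuous continuous_intros u) auto
    then have "integral ?Q (\<lambda>x. \<Sum>j\<in>UNIV. u x * mollifier_flux_deriv z e t j x)
        = (\<Sum>j\<in>UNIV. integral ?Q (\<lambda>x. u x * mollifier_flux_deriv z e t j x))"
      by (intro integral_sum) auto
    then show ?thesis by (simp add: sum_distrib_left)
  qed
  ultimately show ?thesis by simp
qed

lemma mollified_approximates:
  fixes z e :: "real^'n"
  assumes e: "\<And>i. - 1 \<le> e $ i" "\<And>i. e $ i \<le> 0" and h: "0 < h"
    and sub: "\<And>t. 0 < t \<Longrightarrow> t \<le> h \<Longrightarrow> cbox (z + t *\<^sub>R e) (z + t *\<^sub>R e + t *\<^sub>R One) \<subseteq> cbox a b"
    and u: "continuous_on (cbox a b) u" and z: "z \<in> cbox a b" and \<epsilon>: "0 < \<epsilon>"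
  obtains t where "0 < t" "t < h"
    "\<bar>integral (cbox a b) (\<lambda>x. u x * mollifier z e t x) - mollifier_mass TYPE('n) * u z\<bar> \<le> \<epsilon> * mollifier_mass TYPE('n)"
proof -
  let ?Q = "cbox a b" and ?I = "mollifier_mass TYPE('n)"
  obtain \<delta> where \<delta>: "0 < \<delta>" "\<And>x. x \<in> ?Q \<Longrightarrow> dist x z < \<delta> \<Longrightarrow> dist (u x) (u z) < \<epsilon>"
    using u z \<epsilon> unfolding continuous_on_iff by metis
  \<comment> \<open>The kernel lives within distance \<open>t\<close> of \<open>z\<close> in every
    coordinate, hence within \<open>CARD('n) * t < \<delta>\<close> in norm; \<open>h / 2\<close>
    ensures \<open>t < h\<close>.\<close>
  define t where "t = min (h / 2) (\<delta> / (2 * CARD('n)))"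
  have t: "0 < t" "t < h" using h \<delta> by (auto simp: t_def)
  have "CARD('n) * t \<le> CARD('n) * (\<delta> / (2 * CARD('n)))" by (intro mult_left_mono) (auto simp: t_def)
  then have nt: "CARD('n) * t < \<delta>" using \<delta> by simp
  have K: "(mollifier z e t has_integral ?I) ?Q"
    using t sub by (intro integral_mollifier) auto
  have kc: "continuous_on ?Q (mollifier z e t)"
    using t by (simp add: mollifier_eq_bump_prod continuous_on_bump_prod)
  have i: "(\<lambda>x. u x * mollifier z e t x) integrable_on ?Q" "(\<lambda>x. (u x - u z) * mollifier z e t x) integrable_on ?Q"
    by (intro integrable_continuous continuous_intros u kc)+
  have "integral ?Q (\<lambda>x. u x * mollifier z e t x) - ?I * u z =
     integral ?Q (\<lambda>x. u x * mollifier z e t x) - integral ?Q (\<lambda>x. u z * mollifier z e t x)"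
    using integral_unique[OF has_integral_mult_right[OF K, of "u z"]] by (simp only: mult.commute)
  also have "\<dots> = integral ?Q (\<lambda>x. (u x - u z) * mollifier z e t x)"
    using i K by (subst integral_diff[symmetric]) (auto simp: algebra_simps intro!: integrable_on_mult_right)
  finally have "\<bar>integral ?Q (\<lambda>x. u x * mollifier z e t x) - ?I * u z\<bar> = norm (integral ?Q (\<lambda>x. (u x - u z) * mollifier z e t x))"
    by simp
  also have "\<dots> \<le> integral ?Q (\<lambda>x. \<epsilon> * mollifier z e t x)"
  proof (rule integral_norm_bound_integral[OF i(2)])
    show "(\<lambda>x. \<epsilon> * mollifier z e t x) integrable_on ?Q"
      by (intro integrable_continuous continuous_intros kc)
    fix x assume x: "x \<in> ?Q"
    show "norm ((u x - u z) * mollifier z e t x) \<le> \<epsilon> * mollifier z e t x"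
    proof (cases "mollifier z e t x = 0")
      case False
      have "\<bar>(x - z) $ i\<bar> \<le> t" for i
      proof -
        have "(z + t *\<^sub>R e) $ i < x $ i" "x $ i < (z + t *\<^sub>R e) $ i + t"
          using bump_prod_nonzeroD[OF False[unfolded mollifier_eq_bump_prod[OF t(1)]] t(1)] by auto
        moreover have "t * (- 1) \<le> t * e $ i" "t * e $ i \<le> t * 0"
          using e[of i] t by (intro mult_left_mono; simp)+
        ultimately show ?thesis by auto
      qed
      then have "(\<Sum>i\<in>UNIV. \<bar>(x - z) $ i\<bar>) \<le> (\<Sum>i\<in>(UNIV::'n set). t)" by (intro sum_mono)
      then have "norm (x - z) < \<delta>" using norm_le_l1_cart[of "x - z"] nt by simp
      then have "\<bar>u x - u z\<bar> \<le> \<epsilon>" using \<delta>(2)[OF x] by (simp add: dist_norm)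
      then show ?thesis using mollifier_nonneg[OF t(1), of z e x] by (simp add: abs_mult mult_right_mono)
    qed simp
  qed
  also have "\<dots> = \<epsilon> * ?I" using integral_unique[OF has_integral_mult_right[OF K]] .
  finally show ?thesis using t that by blast
qed

text \<open>Each of the two points contributes \<open>M / \<alpha>\<close> with
  \<open>M = 2 * n * J powr (1 / p)\<close> and \<open>\<alpha> = 1 - n / p\<close>; the total is
  divided by the mass of the kernel.\<close>

definition morrey_const :: "'n::finite itself \<Rightarrow> real \<Rightarrow> real" where
  "morrey_const _ p = 4 * real CARD('n) / (1 - real CARD('n) / p) / mollifier_mass TYPE('n)"

lemma morrey_const_pos: "real CARD('n::finite) < p \<Longrightarrow> 0 < morrey_const TYPE('n) p"
  unfolding morrey_const_def
  by (intro divide_pos_pos mollifier_mass_pos) (auto simp: field_simps intro: le_less_trans[of 0])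

text \<open>Morrey's inequality on a cube \<open>Q\<close>. For \<open>z\<close> in \<open>Q\<close> the averages of \<open>u\<close> over the cubes
  obtained by contracting \<open>Q\<close> towards \<open>z\<close> interpolate between an average over \<open>Q\<close>, which does not
  depend on \<open>z\<close>, and the value \<open>u z\<close>; their derivative in the contraction parameter is an integral of
  the weak gradient.\<close>
proposition morrey_cube:
  fixes u :: "real^'n \<Rightarrow> real" and F :: "real^'n \<Rightarrow> real^'n"
  assumes p: "real CARD('n) < p" and h: "0 < h" and Q: "Q = cbox a (a + h *\<^sub>R One)"
    and u: "continuous_on Q u"
    and F: "\<And>j. (\<lambda>x. F x $ j) absolutely_integrable_on Q"
    and Fp: "(\<lambda>x. norm (F x) powr p) integrable_on Q"
    and J: "0 < J" "integral Q (\<lambda>x. norm (F x) powr p) \<le> J"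
    and weak: "\<And>c P k q t j. 0 < t \<Longrightarrow> cbox q (q + t *\<^sub>R One) \<subseteq> Q \<Longrightarrow>
       integral Q (\<lambda>x. u x * partial_deriv j (bump_prod c P k q t) x) =
       - integral Q (\<lambda>x. F x $ j * bump_prod c P k q t x)"
    and xy: "x \<in> Q" "y \<in> Q"
  shows "\<bar>u x - u y\<bar> \<le> morrey_const TYPE('n) p * h powr (1 - real CARD('n) / p) * J powr (1 / p)"
proof -
  let ?n = "real CARD('n)" and ?I = "mollifier_mass TYPE('n)"
  define \<alpha> where "\<alpha> = 1 - ?n / p"
  define M where "M = 2 * ?n * J powr (1 / p)"
  have p0: "0 < p" using p by (meson le_less_trans of_nat_0_le_iff)
  have \<alpha>: "0 < \<alpha>" using p p0 by (simp add: \<alpha>_def)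
  have M0: "0 \<le> M" by (simp add: M_def)
  define A where "A = integral Q (\<lambda>x. u x * bump_prod ((1 / h) ^ CARD('n)) (\<lambda>_. 1) (\<lambda>_. 0) a h x)"
  have main: "\<bar>A - ?I * u z\<bar> \<le> M / \<alpha> * h powr \<alpha>" if z: "z \<in> Q" for z
  proof -
    \<comment> \<open>Chosen so that the kernel cube at parameter \<open>h\<close> is
      \<open>Q\<close> itself; as \<open>z\<close> lies in \<open>Q\<close>, the components of
      \<open>e\<close> lie between -1 and 0.\<close>
    define e where "e = (a - z) /\<^sub>R h"
    have zi: "a $ i \<le> z $ i" "z $ i \<le> a $ i + h" for i using z by (auto simp: Q mem_box_cart)
    have e: "- 1 \<le> e $ i" "e $ i \<le> 0" for i
      using zi[of i] h by (auto simp: e_def field_simps)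
    have he: "z + h *\<^sub>R e = a" using h by (simp add: e_def)
    have sub: "cbox (z + t *\<^sub>R e) (z + t *\<^sub>R e + t *\<^sub>R One) \<subseteq> Q" if t: "0 < t" "t \<le> h" for t
    proof -
      have "a $ i \<le> z $ i + t * e $ i \<and> z $ i + t * e $ i + t \<le> a $ i + h" for i
      proof -
        have he': "z $ i = a $ i - h * e $ i" using h by (simp add: e_def field_simps)
        have "0 \<le> (h - t) * (- e $ i)" "0 \<le> (h - t) * (1 + e $ i)"
          using t e[of i] by (auto intro!: mult_nonneg_nonneg mult_nonneg_nonpos)
        then show ?thesis unfolding he' by (auto simp: algebra_simps)
      qed
      then show ?thesis unfolding Q by (auto simp: mem_box_cart) (meson order_trans)+
    qed
    define G where "G = (\<lambda>t. integral Q (\<lambda>x. u x * mollifier z e t x))"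
    have GA: "G h = A" using h he by (simp add: G_def A_def mollifier_eq_bump_prod)
    define G' where "G' = (\<lambda>t. - (\<Sum>j\<in>UNIV. integral Q (\<lambda>x. u x * mollifier_flux_deriv z e t j x)))"
    have dG: "(G has_real_derivative G' t) (at t)" if "0 < t" for t
      using mollified_has_derivative[OF that u[unfolded Q]] by (simp add: G_def G'_def Q)
    have bG: "\<bar>G' t\<bar> \<le> M * t powr (\<alpha> - 1)" if t: "0 < t" "t \<le> h" for t
    proof -
      have "integral Q (\<lambda>x. u x * mollifier_flux_deriv z e t j x) = - integral Q (\<lambda>x. F x $ j * mollifier_flux z e t j x)" for j
        using weak[OF t(1) sub[OF t]] unfolding partial_deriv_mollifier_flux[OF t(1), symmetric] mollifier_flux_def .
      then have "\<bar>G' t\<bar> = \<bar>\<Sum>j\<in>UNIV. integral Q (\<lambda>x. F x $ j * mollifier_flux z e t j x)\<bar>"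
        by (simp add: G'_def sum_negf)
      also have "\<dots> \<le> (\<Sum>j\<in>UNIV. \<bar>integral Q (\<lambda>x. F x $ j * mollifier_flux z e t j x)\<bar>)"
        by (rule sum_abs)
      also have "\<dots> \<le> (\<Sum>j\<in>(UNIV::'n set). 2 * J powr (1 / p) * t powr (- (?n / p)))"
        using sub[OF t] F Fp J e t unfolding Q
        by (intro sum_mono mollifier_flux_integral_bound p) auto
      finally show ?thesis by (simp add: M_def \<alpha>_def)
    qed
    have dp: "((\<lambda>t. M / \<alpha> * t powr \<alpha>) has_real_derivative M * t powr (\<alpha> - 1)) (at t)" if "0 < t" for t
      using that \<alpha> by (auto intro!: derivative_eq_intros)
    have "\<bar>G h - G t\<bar> \<le> M / \<alpha> * h powr \<alpha>" if t: "0 < t" "t < h" for t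
    proof -
      \<comment> \<open>\<open>M / \<alpha> * t powr \<alpha>\<close> is an antiderivative of the
        bound on the derivative of \<open>G\<close>: subtracting it makes \<open>G\<close>
        nonincreasing, adding it makes \<open>G\<close> nondecreasing.\<close>
      have "G h - M / \<alpha> * h powr \<alpha> \<le> G t - M / \<alpha> * t powr \<alpha>"
      proof (rule DERIV_nonpos_imp_nonincreasing[of t h "\<lambda>t. G t - M / \<alpha> * t powr \<alpha>"])
        fix s assume s: "t \<le> s" "s \<le> h"
        then have "((\<lambda>t. G t - M / \<alpha> * t powr \<alpha>) has_real_derivative G' s - M * s powr (\<alpha> - 1)) (at s)"
          using t by (intro DERIV_diff dG dp) auto
        moreover have "G' s - M * s powr (\<alpha> - 1) \<le> 0" using bG[of s] s t by linarith
        ultimately show "\<exists>y. ((\<lambda>t. G t - M / \<alpha> * t powr \<alpha>) has_real_derivative y) (at s) \<and> y \<le> 0" by blast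
      qed (use t in simp)
      moreover have "G t + M / \<alpha> * t powr \<alpha> \<le> G h + M / \<alpha> * h powr \<alpha>"
      proof (rule DERIV_nonneg_imp_nondecreasing[of t h "\<lambda>t. G t + M / \<alpha> * t powr \<alpha>"])
        fix s assume s: "t \<le> s" "s \<le> h"
        then have "((\<lambda>t. G t + M / \<alpha> * t powr \<alpha>) has_real_derivative G' s + M * s powr (\<alpha> - 1)) (at s)"
          using t by (intro DERIV_add dG dp) auto
        moreover have "0 \<le> G' s + M * s powr (\<alpha> - 1)" using bG[of s] s t by linarith
        ultimately show "\<exists>y. ((\<lambda>t. G t + M / \<alpha> * t powr \<alpha>) has_real_derivative y) (at s) \<and> 0 \<le> y" by blast
      qed (use t in simp)
      moreover have "0 \<le> M / \<alpha> * t powr \<alpha>" using M0 \<alpha> by simp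
      ultimately show ?thesis by linarith
    qed
    note Gt = this
    show ?thesis
    proof (rule field_le_epsilon)
      fix \<epsilon> :: real assume \<epsilon>: "0 < \<epsilon>"
      have "0 < \<epsilon> / ?I" using \<epsilon> mollifier_mass_pos[where 'n='n] by simp
      moreover note e h
      moreover have "cbox (z + t *\<^sub>R e) (z + t *\<^sub>R e + t *\<^sub>R One) \<subseteq> cbox a (a + h *\<^sub>R One)"
        if "0 < t" "t \<le> h" for t using sub[OF that] by (simp only: Q)
      moreover have "continuous_on (cbox a (a + h *\<^sub>R One)) u" "z \<in> cbox a (a + h *\<^sub>R One)"
        using u z by (simp_all only: Q)
      ultimately obtain t where t: "0 < t" "t < h"
        "\<bar>integral (cbox a (a + h *\<^sub>R One)) (\<lambda>x. u x * mollifier z e t x) - ?I * u z\<bar> \<le> \<epsilon> / ?I * ?I"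
        using mollified_approximates[of e h z a "a + h *\<^sub>R One" u "\<epsilon> / ?I"] by blast
      then have "\<bar>G t - ?I * u z\<bar> \<le> \<epsilon>" using mollifier_mass_pos[where 'n='n] by (simp add: G_def Q)
      then show "\<bar>A - ?I * u z\<bar> \<le> M / \<alpha> * h powr \<alpha> + \<epsilon>"
        using Gt[OF t(1,2)] unfolding GA by linarith
    qed
  qed
  have "?I * \<bar>u x - u y\<bar> = \<bar>?I * (u x - u y)\<bar>"
    using mollifier_mass_pos[where 'n='n] by (simp add: abs_mult)
  also have "?I * (u x - u y) = (A - ?I * u y) - (A - ?I * u x)"
    by (simp add: algebra_simps)
  also have "\<bar>(A - ?I * u y) - (A - ?I * u x)\<bar> \<le> 2 * (M / \<alpha> * h powr \<alpha>)" using main[OF xy(1)] main[OF xy(2)] by linarith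
  finally have "?I * \<bar>u x - u y\<bar> \<le> 2 * (M / \<alpha> * h powr \<alpha>)" .
  then have "\<bar>u x - u y\<bar> \<le> 2 * (M / \<alpha> * h powr \<alpha>) / ?I"
    by (subst pos_le_divide_eq[OF mollifier_mass_pos]) (subst mult.commute)
  also have "\<dots> = morrey_const TYPE('n) p * h powr \<alpha> * J powr (1 / p)"
    by (simp add: morrey_const_def M_def \<alpha>_def)
  finally show ?thesis by (simp add: \<alpha>_def)
qed

section \<open>Change of variables\<close>

text \<open>The library's change of variables formula is stated for index types in class \<open>wellorder\<close>.\<close>

typedef 'a ordered_copy = "UNIV :: 'a set" by simp

instance ordered_copy :: (finite) finite
proof
  have "(UNIV :: 'a ordered_copy set) = range Abs_ordered_copy"
    by (metis Rep_ordered_copy_inverse surjI surj_def)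
  then show "finite (UNIV :: 'a ordered_copy set)" by (metis finite finite_imageI)
qed

definition finite_code :: "'a::finite \<Rightarrow> nat" where
  "finite_code = (SOME f. inj f)"

lemma inj_finite_code: "inj (finite_code :: 'a::finite \<Rightarrow> nat)"
proof -
  obtain f :: "'a \<Rightarrow> nat" where "inj f" using finite_imp_inj_to_nat_seg[OF finite[of "UNIV :: 'a set"]] by blast
  then show ?thesis unfolding finite_code_def by (rule someI[of inj])
qed

instantiation ordered_copy :: (finite) wellorder
begin

definition less_eq_ordered_copy :: "'a ordered_copy \<Rightarrow> 'a ordered_copy \<Rightarrow> bool" where
  "x \<le> y \<longleftrightarrow> finite_code (Rep_ordered_copy x) \<le> finite_code (Rep_ordered_copy y)"

definition less_ordered_copy :: "'a ordered_copy \<Rightarrow> 'a ordered_copy \<Rightarrow> bool" where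
  "x < y \<longleftrightarrow> finite_code (Rep_ordered_copy x) < finite_code (Rep_ordered_copy y)"

instance
proof
  fix x y :: "'a ordered_copy"
  assume "x \<le> y" "y \<le> x"
  then show "x = y"
    using injD[OF inj_finite_code] Rep_ordered_copy_inject by (metis antisym less_eq_ordered_copy_def)
next
  fix P :: "'a ordered_copy \<Rightarrow> bool" and a
  assume P: "\<And>x. (\<And>y. y < x \<Longrightarrow> P y) \<Longrightarrow> P x"
  show "P a"
    by (induction a rule: measure_induct_rule[of "\<lambda>x. finite_code (Rep_ordered_copy x)"])
       (use P in \<open>auto simp: less_ordered_copy_def\<close>)
qed (auto simp: less_eq_ordered_copy_def less_ordered_copy_def)

end

section \<open>Integrals, measures and determinants under relabelling of coordinates\<close>

definition reindex :: "('b \<Rightarrow> 'a) \<Rightarrow> 'c^'a \<Rightarrow> 'c^'b" where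
  "reindex r x = (\<chi> j. x $ r j)"

lemma reindex_nth [simp]: "reindex r x $ j = x $ r j"
  by (simp add: reindex_def)

lemma reindex_inverse: "(\<And>i. r (s i) = i) \<Longrightarrow> reindex s (reindex r x) = x"
  by (simp add: vec_eq_iff)

lemma linear_reindex: "linear (reindex r :: real^'a \<Rightarrow> real^'b)"
  by (rule linearI) (simp_all add: vec_eq_iff)

lemma bij_of_inverse: "(\<And>i. r (s i) = i) \<Longrightarrow> (\<And>j. s (r j) = j) \<Longrightarrow> bij r"
  by (metis bijI')

lemma norm_reindex:
  fixes x :: "real^'a"
  assumes "bij (r :: 'b::finite \<Rightarrow> 'a::finite)"
  shows "norm (reindex r x) = norm x"
  unfolding norm_vec_def L2_set_def using sum.reindex_bij_betw[OF assms] by simp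

lemma reindex_cbox:
  fixes r :: "'b::finite \<Rightarrow> 'a::finite" and a b :: "real^'a"
  assumes r: "\<And>i. r (s i) = i" and s: "\<And>j. s (r j) = j"
  shows "reindex r ` cbox a b = cbox (reindex r a) (reindex r b)"
proof (intro set_eqI iffI)
  fix y :: "real^'b" assume y: "y \<in> cbox (reindex r a) (reindex r b)"
  have "y = reindex r (reindex s y)" by (simp add: vec_eq_iff s)
  moreover have "reindex s y \<in> cbox a b" using y by (auto simp: mem_box_cart) (metis r)+
  ultimately show "y \<in> reindex r ` cbox a b" by (rule image_eqI)
qed (auto simp: mem_box_cart)

lemma content_reindex_cbox:
  fixes r :: "'b::finite \<Rightarrow> 'a::finite" and a b :: "real^'a"
  assumes r: "\<And>i. r (s i) = i" and s: "\<And>j. s (r j) = j"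
  shows "measure lborel (reindex r ` cbox a b) = measure lborel (cbox a b)"
proof (cases "cbox a b = {}")
  case False
  then have "cbox (reindex r a) (reindex r b) \<noteq> {}" using reindex_cbox[of r s a b] r s by auto
  moreover have "(\<Prod>j\<in>UNIV. b $ r j - a $ r j) = (\<Prod>i\<in>UNIV. b $ i - a $ i)"
    by (rule prod.reindex_bij_betw[OF bij_of_inverse[of r s]]) (rule r s)+
  ultimately show ?thesis using False reindex_cbox[of r s a b] r s by (simp add: content_cbox_cart)
qed simp

text \<open>Relabelling maps boxes to boxes of equal content, so \<open>has_integral_twiddle\<close>
  handles boxes. It is also an isometry, hence the boxes containing a given ball correspond, and
  this settles general sets.\<close>

lemma has_integral_reindex:
  fixes f :: "real^'a \<Rightarrow> real" and r :: "'b::finite \<Rightarrow> 'a::finite"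
  assumes r: "\<And>i. r (s i) = i" and s: "\<And>j. s (r j) = j" and f: "(f has_integral I) S"
  shows "((\<lambda>y. f (reindex s y)) has_integral I) (reindex r ` S)"
proof -
  let ?T = "reindex r :: real^'a \<Rightarrow> real^'b" and ?T' = "reindex s :: real^'b \<Rightarrow> real^'a"
  let ?F = "\<lambda>x. if x \<in> S then f x else 0"
  have F: "(\<lambda>y. if y \<in> ?T ` S then f (?T' y) else 0) = (\<lambda>y. ?F (?T' y))"
    using r s by (force simp: fun_eq_iff reindex_inverse image_iff)
  have tw: "((\<lambda>y. ?F (?T' y)) has_integral i) (cbox a b)" if "(?F has_integral i) (cbox (?T' a) (?T' b))" for i a b
  proof -
    have "((\<lambda>y. ?F (?T' y)) has_integral (1 / 1) *\<^sub>R i) (?T ` cbox (?T' a) (?T' b))"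
    proof (rule has_integral_twiddle)
      show "continuous (at x) ?T'" for x
        by (simp add: linear_continuous_at linear_linear linear_reindex)
      show "\<exists>w z. ?T' ` cbox u v = cbox w z" for u v using reindex_cbox[of s r u v] r s by blast
      show "\<exists>w z. ?T ` cbox u v = cbox w z" for u v using reindex_cbox[of r s u v] r s by blast
      show "measure lborel (?T' ` cbox u v) = 1 * measure lborel (cbox u v)" for u v
        using content_reindex_cbox[of s r u v] r s by simp
    qed (use that r s in \<open>auto simp: reindex_inverse\<close>)
    then show ?thesis using reindex_cbox[of r s "?T' a" "?T' b"] r s by (simp add: reindex_inverse)
  qed
  have cb: "ball 0 B \<subseteq> cbox (?T' a) (?T' b)" if "ball 0 B \<subseteq> cbox a b" for a b B
  proof
    fix x :: "real^'a" assume "x \<in> ball 0 B"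
    then have "?T x \<in> cbox a b" using that norm_reindex[OF bij_of_inverse[of r s], of x] r s by auto
    then have "?T' (?T x) \<in> ?T' ` cbox a b" by blast
    then show "x \<in> cbox (?T' a) (?T' b)" using reindex_cbox[of s r a b] r s by (simp add: reindex_inverse)
  qed
  have int: "?F integrable_on cbox u v" for u v using f by (simp add: has_integral_alt')
  have eq: "integral (cbox a b) (\<lambda>y. ?F (?T' y)) = integral (cbox (?T' a) (?T' b)) ?F" for a b
    using tw[OF integrable_integral[OF int]] by (rule integral_unique)
  show ?thesis
    unfolding has_integral_alt' F eq
  proof (intro conjI allI impI)
    show "(\<lambda>y. ?F (?T' y)) integrable_on cbox a b" for a b
      using tw[OF integrable_integral[OF int]] by blast
    fix e :: real assume "0 < e"
    then obtain B where "0 < B" "\<And>a b. ball 0 B \<subseteq> cbox a b \<Longrightarrow> norm (integral (cbox a b) ?F - I) < e"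
      using f unfolding has_integral_alt' by meson
    then show "\<exists>B>0. \<forall>a b. ball 0 B \<subseteq> cbox a b \<longrightarrow> norm (integral (cbox (?T' a) (?T' b)) ?F - I) < e"
      using cb by blast
  qed
qed

lemma measure_reindex:
  fixes r :: "'b::finite \<Rightarrow> 'a::finite" and S :: "(real^'a) set"
  assumes r: "\<And>i. r (s i) = i" and s: "\<And>j. s (r j) = j"
  shows "reindex r ` S \<in> lmeasurable \<and> measure lebesgue (reindex r ` S) = m \<longleftrightarrow>
     S \<in> lmeasurable \<and> measure lebesgue S = m"
proof -
  have iff: "A \<in> lmeasurable \<and> measure lebesgue A = m \<longleftrightarrow> ((\<lambda>x. 1) has_integral m) A" for A :: "(real^'c::finite) set"
    by (metis has_integral_iff lmeasurable_iff_integrable_on lmeasure_integral)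
  have "reindex s ` reindex r ` S = S" using r by (simp add: image_image reindex_inverse)
  then show ?thesis
    unfolding iff using has_integral_reindex[of r s "\<lambda>x. 1" m S] has_integral_reindex[of s r "\<lambda>x. 1" m "reindex r ` S"] r s
    by auto
qed

definition reindex_matrix :: "('b \<Rightarrow> 'a) \<Rightarrow> 'c^'a^'a \<Rightarrow> 'c^'b^'b" where
  "reindex_matrix r A = (\<chi> i j. A $ r i $ r j)"

text \<open>Induction over elementary matrices avoids transporting permutations and their signs
  between the two index types: relabelling commutes with products and maps each kind of generator to
  a generator of the same kind.\<close>

lemma det_reindex_matrix:
  fixes A :: "real^'a^'a" and r :: "'b::finite \<Rightarrow> 'a::finite"
  assumes r: "\<And>i. r (s i) = i" and s: "\<And>j. s (r j) = j"
  shows "det (reindex_matrix r A) = det A"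
proof (rule induct_matrix_elementary[where P = "\<lambda>A. det (reindex_matrix r A) = det A"])
  fix A B :: "real^'a^'a"
  assume mult: "det (reindex_matrix r A) = det A" "det (reindex_matrix r B) = det B"
  have "reindex_matrix r (A ** B) = reindex_matrix r A ** reindex_matrix r B"
  proof -
    have "(\<Sum>k\<in>UNIV. A $ r i $ r k * B $ r k $ r j) = (\<Sum>k\<in>UNIV. A $ r i $ k * B $ k $ r j)" for i j
      using sum.reindex_bij_betw[OF bij_of_inverse[of r s], of "\<lambda>k. A $ r i $ k * B $ k $ r j"] r s by simp
    then show ?thesis by (simp add: vec_eq_iff reindex_matrix_def matrix_matrix_mult_def)
  qed
  then show "det (reindex_matrix r (A ** B)) = det (A ** B)" using mult by (simp add: det_mul)
next
  fix A :: "real^'a^'a" and i assume zero_row: "row i A = 0"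
  then have "row (s i) (reindex_matrix r A) = 0" by (simp add: row_def vec_eq_iff reindex_matrix_def r)
  then show "det (reindex_matrix r A) = det A" using zero_row by (simp add: det_zero_row)
next
  fix A :: "real^'a^'a" assume diagonal: "\<And>i j. i \<noteq> j \<Longrightarrow> A $ i $ j = 0"
  have "r i \<noteq> r j" if "i \<noteq> j" for i j using that s by metis
  then have "det (reindex_matrix r A) = (\<Prod>j\<in>UNIV. A $ r j $ r j)"
    using diagonal by (subst det_diagonal) (auto simp: reindex_matrix_def)
  also have "\<dots> = (\<Prod>i\<in>UNIV. A $ i $ i)"
    by (rule prod.reindex_bij_betw[OF bij_of_inverse[of r s]]) (rule r s)+
  also have "\<dots> = det A" using diagonal by (subst det_diagonal) auto
  finally show "det (reindex_matrix r A) = det A" .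
next
  fix m n :: 'a assume swap1: "m \<noteq> n"
  have "reindex_matrix r (swap_matrix m n) = swap_matrix (s m) (s n)"
  proof -
    have rs: "r i = k \<longleftrightarrow> i = s k" "r i = r j \<longleftrightarrow> i = j" for i j k by (metis r s)+
    then have "Transposition.transpose m n (r j) = r (Transposition.transpose (s m) (s n) j)" for j
      by (simp add: Transposition.transpose_def r)
    then show ?thesis by (simp add: reindex_matrix_def swap_matrix_def mat_def vec_eq_iff rs s)
  qed
  moreover have "s m \<noteq> s n" using swap1 r by metis
  ultimately show "det (reindex_matrix r (\<chi> i j. mat 1 $ i $ Transposition.transpose m n j)) =
      det ((\<chi> i j. mat 1 $ i $ Transposition.transpose m n j) :: real^'a^'a)"
    unfolding swap_matrix_def[symmetric] using swap1 by (simp add: det_swap_matrix)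
next
  fix m n :: 'a and c :: real assume idplus: "m \<noteq> n"
  have "reindex_matrix r (transvection m n c) = transvection (s m) (s n) c"
  proof -
    have "r i = k \<longleftrightarrow> i = s k" "r i = r j \<longleftrightarrow> i = j" for i j k by (metis r s)+
    then show ?thesis by (simp add: reindex_matrix_def transvection_def vec_eq_iff)
  qed
  moreover have "s m \<noteq> s n" using idplus r by metis
  ultimately show "det (reindex_matrix r (\<chi> i j. if i = m \<and> j = n then c else of_bool (i = j))) =
      det ((\<chi> i j. if i = m \<and> j = n then c else of_bool (i = j)) :: real^'a^'a)"
    unfolding transvection_def[symmetric] using idplus by (simp add: det_transvection)
qed

text \<open>The map is conjugated by the relabelling, which preserves measure; its derivative matrix
  becomes \<open>reindex_matrix\<close> of the original one, with the same determinant.\<close>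

theorem has_measure_differentiable_image_matrix:
  fixes f :: "real^'n \<Rightarrow> real^'n" and A :: "real^'n \<Rightarrow> real^'n^'n"
  assumes S: "S \<in> sets lebesgue"
    and der: "\<And>x. x \<in> S \<Longrightarrow> (f has_derivative (*v) (A x)) (at x within S)"
    and inj: "inj_on f S"
  shows "f ` S \<in> lmeasurable \<and> measure lebesgue (f ` S) = m \<longleftrightarrow> ((\<lambda>x. \<bar>det (A x)\<bar>) has_integral m) S"
proof -
  let ?r = "Rep_ordered_copy :: 'n ordered_copy \<Rightarrow> 'n" and ?s = "Abs_ordered_copy :: 'n \<Rightarrow> 'n ordered_copy"
  have r: "?r (?s i) = i" for i by (simp add: Abs_ordered_copy_inverse)
  have s: "?s (?r j) = j" for j by (rule Rep_ordered_copy_inverse)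
  let ?T = "reindex ?r :: real^'n \<Rightarrow> real^'n ordered_copy" and ?T' = "reindex ?s :: real^'n ordered_copy \<Rightarrow> real^'n"
  define g where "g = ?T \<circ> f \<circ> ?T'"
  let ?g' = "\<lambda>y. (*v) (reindex_matrix ?r (A (?T' y)))"
  have TT: "?T' (?T x) = x" for x using r by (rule reindex_inverse)
  have TT2: "?T (?T' y) = y" for y using s by (rule reindex_inverse)
  have dimeq: "CARD('n ordered_copy) = CARD('n)"
    using bij_betw_same_card[OF bij_of_inverse[of ?r ?s]] r s by simp
  have TS: "?T ` S \<in> sets lebesgue"
    by (rule differentiable_image_in_sets_lebesgue[OF S])
       (auto simp: dimeq linear_imp_differentiable_on linear_reindex)
  have der_g: "(g has_derivative ?g' y) (at y within ?T ` S)" if yS: "y \<in> ?T ` S" for y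
  proof -
    obtain x where x: "x \<in> S" "y = ?T x" using yS by blast
    have "(?T' has_derivative ?T') (at y within ?T ` S)"
      by (simp add: linear_imp_has_derivative linear_reindex)
    moreover have "?T' ` ?T ` S = S" by (simp add: image_image TT)
    then have "(f has_derivative (*v) (A x)) (at (?T' y) within ?T' ` ?T ` S)" using der[OF x(1)] x(2) TT by simp
    ultimately have "((\<lambda>y. f (?T' y)) has_derivative (\<lambda>v. A x *v ?T' v)) (at y within ?T ` S)"
      by (rule has_derivative_in_compose)
    moreover have "(?T has_derivative ?T) (at w within W)" for w W
      by (simp add: linear_imp_has_derivative linear_reindex)
    ultimately have "((\<lambda>y. ?T (f (?T' y))) has_derivative (\<lambda>v. ?T (A x *v ?T' v))) (at y within ?T ` S)"
      by (rule has_derivative_in_compose)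
    moreover have "?T (A x *v ?T' v) = reindex_matrix ?r (A x) *v v" for v
    proof -
      have "(\<Sum>k\<in>UNIV. A x $ i $ k * v $ ?s k) = (\<Sum>j\<in>UNIV. A x $ i $ ?r j * v $ j)" for i
        using sum.reindex_bij_betw[OF bij_of_inverse[of ?r ?s], of "\<lambda>k. A x $ i $ k * v $ ?s k"] r s by simp
      then show ?thesis by (simp add: vec_eq_iff matrix_vector_mult_def reindex_matrix_def)
    qed
    ultimately show ?thesis using x by (simp add: g_def o_def TT)
  qed
  have inj_g: "inj_on g (?T ` S)"
  proof (rule inj_onI)
    fix y z assume y: "y \<in> ?T ` S" "z \<in> ?T ` S" and "g y = g z"
    then have "f (?T' y) = f (?T' z)" by (metis TT comp_apply g_def)
    then have "?T' y = ?T' z" using y inj TT by (auto dest: inj_onD)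
    then show "y = z" by (metis TT2)
  qed
  have "g ` ?T ` S = ?T ` f ` S" by (simp add: g_def image_image TT)
  then have "f ` S \<in> lmeasurable \<and> measure lebesgue (f ` S) = m \<longleftrightarrow>
      g ` ?T ` S \<in> lmeasurable \<and> measure lebesgue (g ` ?T ` S) = m"
    using measure_reindex[of ?r ?s "f ` S" m] r s by simp
  also have "\<dots> \<longleftrightarrow> ((\<lambda>y. \<bar>det (matrix (?g' y))\<bar>) has_integral m) (?T ` S)"
    by (rule has_measure_differentiable_image[OF TS der_g inj_g])
  also have "\<dots> \<longleftrightarrow> ((\<lambda>y. \<bar>det (A (?T' y))\<bar>) has_integral m) (?T ` S)"
    using det_reindex_matrix[of ?r ?s] r s by simp
  also have "\<dots> \<longleftrightarrow> ((\<lambda>x. \<bar>det (A x)\<bar>) has_integral m) S"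
  proof
    assume "((\<lambda>y. \<bar>det (A (?T' y))\<bar>) has_integral m) (?T ` S)"
    from has_integral_reindex[of ?s ?r, OF s r this]
    show "((\<lambda>x. \<bar>det (A x)\<bar>) has_integral m) S" by (simp add: TT image_image)
  next
    assume "((\<lambda>x. \<bar>det (A x)\<bar>) has_integral m) S"
    from has_integral_reindex[of ?r ?s, OF r s this]
    show "((\<lambda>y. \<bar>det (A (?T' y))\<bar>) has_integral m) (?T ` S)" .
  qed
  finally show ?thesis .
qed

section \<open>Differentiability almost everywhere\<close>

lemma integrable_lebesgue_on_iff:
  fixes f :: "'a::euclidean_space \<Rightarrow> 'b::euclidean_space"
  assumes "S \<in> sets lebesgue"
  shows "integrable (lebesgue_on S) f \<longleftrightarrow> f absolutely_integrable_on S"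
  using assms by (simp add: set_integrable_def integrable_restrict_space)

lemma powr_add_le:
  fixes a b p :: real
  assumes "0 \<le> a" "0 \<le> b" "0 \<le> p"
  shows "(a + b) powr p \<le> 2 powr p * (a powr p + b powr p)"
proof -
  have "(a + b) powr p \<le> (2 * max a b) powr p" using assms by (intro powr_mono2) auto
  also have "\<dots> = 2 powr p * max a b powr p" using assms by (simp add: powr_mult)
  also have "max a b powr p \<le> a powr p + b powr p" by (simp add: max_def)
  finally show ?thesis by simp
qed

lemma norm_diff_powr_le:
  fixes a b c :: "'a::real_normed_vector"
  assumes "0 \<le> p"
  shows "norm (a - c) powr p \<le> 2 powr p * (norm (a - b) powr p + norm (b - c) powr p)"
proof -
  have "norm (a - c) powr p \<le> (norm (a - b) + norm (b - c)) powr p"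
    using assms norm_triangle_ineq[of "a - b" "b - c"] by (intro powr_mono2) auto
  also have "\<dots> \<le> 2 powr p * (norm (a - b) powr p + norm (b - c) powr p)"
    using assms by (intro powr_add_le) auto
  finally show ?thesis .
qed

text \<open>On a set of finite measure constants are integrable, so subtracting a fixed matrix is
  harmless. The second claim concerns the \<open>i\<close>-th row, the gradient of the
  \<open>i\<close>-th component.\<close>

lemma in_Lp_shift_integrable:
  fixes F :: "real^'n \<Rightarrow> real^'n^'n"
  assumes F: "in_Lp p \<Omega> F" and p: "0 \<le> p" and \<Omega>: "\<Omega> \<in> sets lebesgue" and S: "S \<subseteq> \<Omega>" "S \<in> lmeasurable"
  shows "(\<lambda>x. norm (F x - B) powr p) absolutely_integrable_on S"
    "(\<lambda>x. norm ((F x - B) $ i) powr p) absolutely_integrable_on S"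
proof -
  have Ss: "S \<in> sets lebesgue" using S by (simp add: fmeasurableD)
  have "F \<in> borel_measurable (lebesgue_on \<Omega>)" using F by (simp add: in_Lp_def)
  then have Fm [measurable]: "F \<in> borel_measurable (lebesgue_on S)" using S(1) by (rule measurable_restrict_mono)
  have "(\<lambda>x. norm (F x) powr p) absolutely_integrable_on \<Omega>"
    using F \<Omega> by (simp add: in_Lp_def integrable_lebesgue_on_iff)
  then have "(\<lambda>x. norm (F x) powr p) absolutely_integrable_on S"
    using Ss S(1) by (rule set_integrable_subset)
  then have "(\<lambda>x. norm (F x) powr p) integrable_on S" by (rule set_lebesgue_integral_eq_integral(1))
  then have g: "(\<lambda>x. 2 powr p * (norm (F x - 0) powr p + norm (0 - B) powr p)) integrable_on S"
    using integrable_on_const[OF S(2)] by (intro integrable_on_mult_right integrable_add) auto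
  show "(\<lambda>x. norm (F x - B) powr p) absolutely_integrable_on S"
    by (rule measurable_bounded_by_integrable_imp_absolutely_integrable[OF _ Ss g])
       (use p norm_diff_powr_le[of p _ B 0] in \<open>auto\<close>)
  have "(\<lambda>x. (F x - B) $ i) \<in> borel_measurable (lebesgue_on S)"
    by (rule measurable_compose[of "\<lambda>x. F x - B" _ borel "\<lambda>A. A $ i"])
       (auto intro!: borel_measurable_continuous_onI continuous_intros)
  then have "(\<lambda>x. norm ((F x - B) $ i) powr p) \<in> borel_measurable (lebesgue_on S)" by measurable
  then show "(\<lambda>x. norm ((F x - B) $ i) powr p) absolutely_integrable_on S"
  proof (rule measurable_bounded_by_integrable_imp_absolutely_integrable[OF _ Ss g])
    fix x
    have "norm ((F x - B) $ i) powr p \<le> norm (F x - B) powr p"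
      using p by (intro powr_mono2 Finite_Cartesian_Product.norm_nth_le) auto
    then show "norm (norm ((F x - B) $ i) powr p) \<le> 2 powr p * (norm (F x - 0) powr p + norm (0 - B) powr p)"
      using norm_diff_powr_le[OF p, of "F x" B 0] by simp
  qed
qed

lemma in_Lp_entry_integrable:
  fixes F :: "real^'n \<Rightarrow> real^'n^'n"
  assumes F: "in_Lp p \<Omega> F" and p: "1 < p" and \<Omega>: "\<Omega> \<in> sets lebesgue" and S: "S \<subseteq> \<Omega>" "S \<in> lmeasurable"
  shows "(\<lambda>x. F x $ i $ j) absolutely_integrable_on S"
proof -
  have Ss: "S \<in> sets lebesgue" using S by (simp add: fmeasurableD)
  have "F \<in> borel_measurable (lebesgue_on \<Omega>)" using F by (simp add: in_Lp_def)
  then have "F \<in> borel_measurable (lebesgue_on S)" using S(1) by (rule measurable_restrict_mono)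
  then have m: "(\<lambda>x. F x $ i $ j) \<in> borel_measurable (lebesgue_on S)"
    by (rule measurable_compose) (intro borel_measurable_continuous_onI continuous_intros)
  have "(\<lambda>x. norm (F x - 0) powr p) absolutely_integrable_on S"
    by (rule in_Lp_shift_integrable(1)[OF F _ \<Omega> S]) (use p in simp)
  then have "(\<lambda>x. norm (F x) powr p) integrable_on S" by (simp add: set_lebesgue_integral_eq_integral(1))
  \<comment> \<open>The bound of \<open>le_powr_add\<close> with threshold 1: an entry is dominated
    by the \<open>p\<close>-th power of the norm plus 1.\<close>
  then have g: "(\<lambda>x. 1 powr (1 - p) * norm (F x) powr p + 1) integrable_on S"
    using integrable_on_const[OF S(2)] by (intro integrable_on_mult_right integrable_add) auto
  show ?thesis
  proof (rule measurable_bounded_by_integrable_imp_absolutely_integrable[OF m Ss g])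
    fix x
    have "\<bar>F x $ i $ j\<bar> \<le> norm (F x $ i)" by (rule component_le_norm_cart)
    also have "\<dots> \<le> norm (F x)" by (rule Finite_Cartesian_Product.norm_nth_le)
    also have "\<dots> \<le> 1 powr (1 - p) * norm (F x) powr p + 1" using p by (intro le_powr_add) auto
    finally show "norm (F x $ i $ j) \<le> 1 powr (1 - p) * norm (F x) powr p + 1" by simp
  qed
qed

lemma lebesgue_on_integral_eq_integral_cbox:
  fixes g :: "real^'n \<Rightarrow> real"
  assumes "\<Omega> \<in> sets lebesgue" "cbox a b \<subseteq> \<Omega>" "\<And>x. x \<notin> cbox a b \<Longrightarrow> g x = 0"
    and "g absolutely_integrable_on cbox a b"
  shows "integral\<^sup>L (lebesgue_on \<Omega>) g = integral (cbox a b) g"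
proof -
  have "integral\<^sup>L (lebesgue_on \<Omega>) g = integral\<^sup>L lebesgue g"
    using assms by (intro integral_lebesgue_on_eq_of_vanish) auto
  also have "\<dots> = integral\<^sup>L (lebesgue_on (cbox a b)) g"
    using assms by (intro integral_lebesgue_on_eq_of_vanish[symmetric]) auto
  also have "\<dots> = integral (cbox a b) g"
    using assms by (intro lebesgue_integral_eq_integral) (auto simp: integrable_lebesgue_on_iff)
  finally show ?thesis .
qed

lemma absolutely_integrable_mult_bump_prod:
  fixes f :: "real^'n \<Rightarrow> real"
  assumes "f absolutely_integrable_on cbox a b"
  shows "(\<lambda>x. f x * bump_prod c P k q t x) absolutely_integrable_on cbox a b"
proof -
  have "(\<lambda>x. bump_prod c P k q t x * f x) absolutely_integrable_on cbox a b"
    by (rule absolutely_integrable_bounded_measurable_product[OF bilinear_times _ _ _ assms])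
       (auto intro!: continuous_imp_measurable_on_sets_lebesgue continuous_on_bump_prod
          compact_imp_bounded compact_continuous_image)
  then show ?thesis by (simp add: mult.commute)
qed

text \<open>Passes from the Lebesgue integrals over the domain in the definition of weak gradients
  to integrals over a cube, as \<open>morrey_cube\<close> expects; bumps supported in the cube do
  not see the rest of the domain.\<close>

lemma weak_gradient_cube:
  fixes y :: "real^'n \<Rightarrow> real^'n"
  assumes \<Omega>: "\<Omega> \<in> sets lebesgue" "cbox a b \<subseteq> \<Omega>" and w: "has_weak_gradient \<Omega> y Dy"
    and y: "continuous_on (cbox a b) y" and Dy: "(\<lambda>x. Dy x $ i $ j) absolutely_integrable_on cbox a b"
    and t: "0 < t" "cbox q (q + t *\<^sub>R One) \<subseteq> cbox a b"
  shows "((\<lambda>x. y x $ i * partial_deriv j (bump_prod c P k q t) x) has_integral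
     - integral (cbox a b) (\<lambda>x. Dy x $ i $ j * bump_prod c P k q t x)) (cbox a b)"
proof -
  let ?\<phi> = "bump_prod c P k q t"
  have vanish: "bump_prod c' P' k' q t x = 0" if "x \<notin> cbox a b" for c' P' k' x
  proof (rule ccontr)
    assume "bump_prod c' P' k' q t x \<noteq> 0"
    from bump_prod_nonzeroD[OF this t(1)] have "x \<in> cbox q (q + t *\<^sub>R One)"
      by (auto simp: mem_box_cart less_imp_le)
    then show False using t(2) that by blast
  qed
  have c: "continuous_on (cbox a b) (\<lambda>x. y x $ i * partial_deriv j ?\<phi> x)"
    unfolding partial_deriv_bump_prod[OF t(1)]
    by (intro continuous_intros y continuous_on_bump_prod)
  have "integral (cbox a b) (\<lambda>x. y x $ i * partial_deriv j ?\<phi> x) = (LINT x|lebesgue_on \<Omega>. y x $ i * partial_deriv j ?\<phi> x)"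
    using \<Omega> by (intro lebesgue_on_integral_eq_integral_cbox[symmetric] absolutely_integrable_continuous c)
       (auto simp: partial_deriv_bump_prod[OF t(1)] vanish)
  also have "\<dots> = - (LINT x|lebesgue_on \<Omega>. Dy x $ i $ j * ?\<phi> x)"
    using w test_function_bump_prod[OF t(1), of q \<Omega>] t(2) \<Omega>(2) unfolding has_weak_gradient_def by blast
  also have "(LINT x|lebesgue_on \<Omega>. Dy x $ i $ j * ?\<phi> x) = integral (cbox a b) (\<lambda>x. Dy x $ i $ j * ?\<phi> x)"
    using \<Omega> by (intro lebesgue_on_integral_eq_integral_cbox absolutely_integrable_mult_bump_prod Dy) (auto simp: vanish)
  finally show ?thesis using integrable_integral[OF integrable_continuous[OF c]] by simp
qed

text \<open>\<open>morrey_cube\<close> applied to each component of \<open>y - B\<close>; summing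
  the components gives the factor \<open>CARD('n)\<close>. Differentiability at \<open>x\<close>
  uses it with \<open>B = Dy x\<close>, the control of images of null sets with
  \<open>B = 0\<close>.\<close>

proposition morrey_sobolev:
  fixes y :: "real^'n \<Rightarrow> real^'n" and B :: "real^'n^'n"
  assumes p: "real CARD('n) < p" and h: "0 < h" and Q: "Q = cbox a (a + h *\<^sub>R One)"
    and \<Omega>: "\<Omega> \<in> sets lebesgue" "Q \<subseteq> \<Omega>" and y: "continuous_on \<Omega> y" and W: "sobolev_W1 p \<Omega> y Dy"
    and J: "0 < J" "integral Q (\<lambda>x. norm (Dy x - B) powr p) \<le> J"
    and x: "x \<in> Q" "x' \<in> Q"
  shows "norm (y x - y x' - B *v (x - x')) \<le>
    real CARD('n) * (morrey_const TYPE('n) p * h powr (1 - real CARD('n) / p) * J powr (1 / p))"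
proof -
  have "1 \<le> real CARD('n)" by (simp add: Suc_leI)
  then have p1: "1 < p" using p by linarith
  have Ql: "Q \<in> lmeasurable" unfolding Q by simp
  have Lp: "in_Lp p \<Omega> Dy" and w: "has_weak_gradient \<Omega> y Dy" using W by (auto simp: sobolev_W1_def)
  have yQ: "continuous_on Q y" using y \<Omega>(2) by (rule continuous_on_subset)
  have BL: "sobolev_W1 p Q ((*v) B) (\<lambda>x. B)"
    using Ql p1 by (intro sobolev_W1_matrix) (auto simp: Q)
  have int: "(\<lambda>x. norm (Dy x - B) powr p) integrable_on Q" "(\<lambda>x. norm ((Dy x - B) $ i) powr p) integrable_on Q" for i
    using in_Lp_shift_integrable[OF Lp _ \<Omega> Ql, of B] p1 by (auto intro: set_lebesgue_integral_eq_integral(1))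
  have D: "(\<lambda>x. Dy x $ i $ j) absolutely_integrable_on Q" for i j
    by (rule in_Lp_entry_integrable[OF Lp p1 \<Omega> Ql])
  have Bc: "(\<lambda>x. B $ i $ j) absolutely_integrable_on Q" for i j
    using Ql by (rule absolutely_integrable_on_const)
  have comp: "\<bar>(y x - y x' - B *v (x - x')) $ i\<bar> \<le>
      morrey_const TYPE('n) p * h powr (1 - real CARD('n) / p) * J powr (1 / p)" for i
  proof -
    have "\<bar>(y x $ i - (B *v x) $ i) - (y x' $ i - (B *v x') $ i)\<bar> \<le>
      morrey_const TYPE('n) p * h powr (1 - real CARD('n) / p) * J powr (1 / p)"
    proof (rule morrey_cube[OF p h Q _ _ int(2)[of i] J(1) _ _ x])
      show "continuous_on Q (\<lambda>x. y x $ i - (B *v x) $ i)"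
        by (intro continuous_intros yQ linear_continuous_on matrix_vector_mul_bounded_linear)
      show "(\<lambda>x. (Dy x - B) $ i $ j) absolutely_integrable_on Q" for j
        using D[of i j] Bc[of i j] by (simp add: set_integral_diff(1))
      have "integral Q (\<lambda>x. norm ((Dy x - B) $ i) powr p) \<le> integral Q (\<lambda>x. norm (Dy x - B) powr p)"
        using p1 by (intro integral_le int powr_mono2 Finite_Cartesian_Product.norm_nth_le) auto
      then show "integral Q (\<lambda>x. norm ((Dy x - B) $ i) powr p) \<le> J" using J by linarith
      fix c P k q t j
      assume t: "0 < (t::real)" "cbox q (q + t *\<^sub>R One) \<subseteq> Q"
      let ?\<phi> = "bump_prod c P k q t"
      have 1: "((\<lambda>x. y x $ i * partial_deriv j ?\<phi> x) has_integral - integral Q (\<lambda>x. Dy x $ i $ j * ?\<phi> x)) Q"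
        using weak_gradient_cube[OF \<Omega>(1) _ w _ _ t(1)] \<Omega>(2) yQ D t(2) unfolding Q by blast
      have 2: "((\<lambda>x. (B *v x) $ i * partial_deriv j ?\<phi> x) has_integral - integral Q (\<lambda>x. B $ i $ j * ?\<phi> x)) Q"
        using weak_gradient_cube[of Q a "a + h *\<^sub>R One" "(*v) B" "\<lambda>x. B" i j t q c P k] BL t Bc[of i j] Ql
        unfolding Q sobolev_W1_def
        by (auto simp: fmeasurableD intro!: linear_continuous_on)
      have "integral Q (\<lambda>x. (y x $ i - (B *v x) $ i) * partial_deriv j ?\<phi> x) =
          - integral Q (\<lambda>x. Dy x $ i $ j * ?\<phi> x) - - integral Q (\<lambda>x. B $ i $ j * ?\<phi> x)"
        using integral_unique[OF has_integral_diff[OF 1 2]] by (simp add: algebra_simps)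
      also have "\<dots> = - (integral Q (\<lambda>x. Dy x $ i $ j * ?\<phi> x) - integral Q (\<lambda>x. B $ i $ j * ?\<phi> x))"
        by simp
      also have "integral Q (\<lambda>x. Dy x $ i $ j * ?\<phi> x) - integral Q (\<lambda>x. B $ i $ j * ?\<phi> x) =
          integral Q (\<lambda>x. Dy x $ i $ j * ?\<phi> x - B $ i $ j * ?\<phi> x)"
        unfolding Q
        by (intro integral_diff[symmetric] set_lebesgue_integral_eq_integral(1)
            absolutely_integrable_mult_bump_prod D[unfolded Q] Bc[unfolded Q])
      finally show "integral Q (\<lambda>x. (y x $ i - (B *v x) $ i) * partial_deriv j ?\<phi> x) =
          - integral Q (\<lambda>x. (Dy x - B) $ i $ j * ?\<phi> x)" by (simp add: algebra_simps)
    qed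
    then show ?thesis by (simp add: matrix_vector_mult_diff_distrib algebra_simps)
  qed
  have "norm (y x - y x' - B *v (x - x')) \<le> (\<Sum>i\<in>UNIV. \<bar>(y x - y x' - B *v (x - x')) $ i\<bar>)"
    by (rule norm_le_l1_cart)
  also have "\<dots> \<le> (\<Sum>i\<in>(UNIV :: 'n set). morrey_const TYPE('n) p * h powr (1 - real CARD('n) / p) * J powr (1 / p))"
    by (intro sum_mono comp)
  finally show ?thesis by simp
qed

section \<open>Lebesgue differentiation along centred cubes\<close>

definition reflect :: "'n set \<Rightarrow> real^'n \<Rightarrow> real^'n" where
  "reflect s x = (\<chi> i. (if i \<in> s then - 1 else 1) * x $ i)"

lemma reflect_reflect [simp]: "reflect s (reflect s x) = x"
  by (simp add: reflect_def vec_eq_iff)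

lemma reflect_nth: "reflect s x $ i = (if i \<in> s then - x $ i else x $ i)"
  by (simp add: reflect_def)

lemma reflect_cbox:
  fixes x :: "real^'n"
  shows "reflect s ` cbox a b = cbox (\<chi> i. if i \<in> s then - b $ i else a $ i) (\<chi> i. if i \<in> s then - a $ i else b $ i)"
proof (intro set_eqI iffI)
  fix z assume z: "z \<in> cbox (\<chi> i. if i \<in> s then - b $ i else a $ i) (\<chi> i. if i \<in> s then - a $ i else b $ i)"
  have "a $ i \<le> reflect s z $ i \<and> reflect s z $ i \<le> b $ i" for i
    using z[unfolded mem_box_cart, rule_format, of i] by (auto simp: reflect_nth)
  then have "reflect s z \<in> cbox a b" by (simp add: mem_box_cart)
  then show "z \<in> reflect s ` cbox a b" by (intro image_eqI[of _ _ "reflect s z"]) auto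
qed (auto simp: mem_box_cart reflect_nth)

lemma has_integral_reflect_cbox:
  fixes f :: "real^'n \<Rightarrow> real"
  assumes "(f has_integral i) (cbox a b)"
  shows "((\<lambda>x. f (reflect s x)) has_integral i) (reflect s ` cbox a b)"
proof -
  let ?m = "\<lambda>i. if i \<in> s then - 1 else 1 :: real"
  have 1: "((\<lambda>x. f (\<chi> k. ?m k * x $ k)) has_integral i /\<^sub>R \<bar>prod ?m UNIV\<bar>) ((\<lambda>x. \<chi> k. x $ k / ?m k) ` cbox a b)"
    by (rule has_integral_stretch_cart[OF assms]) simp
  have 2: "\<bar>prod ?m UNIV\<bar> = 1" by (auto simp: abs_prod intro!: prod.neutral)
  have 3: "(\<lambda>x. \<chi> k. x $ k / ?m k) = (reflect s :: real^'n \<Rightarrow> real^'n)"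
    by (auto simp: reflect_def fun_eq_iff vec_eq_iff)
  show ?thesis using 1 unfolding 2 3 by (simp flip: reflect_def)
qed

text \<open>The library's differentiation theorem uses cubes with a corner at \<open>x\<close>; reflecting it in all
  coordinate hyperplanes covers the cubes centred at \<open>x\<close>.\<close>
lemma lebesgue_differentiation_centred:
  fixes g :: "real^'n \<Rightarrow> real"
  assumes g: "\<And>a b. g integrable_on cbox a b" and nn: "\<And>x. 0 \<le> g x"
  obtains N where "negligible N" "\<And>x e. x \<notin> N \<Longrightarrow> 0 < e \<Longrightarrow>
     \<exists>d>0. \<forall>h. 0 < h \<and> h < d \<longrightarrow>
       integral (cbox (x - h *\<^sub>R One) (x + h *\<^sub>R One)) g \<le> 2 ^ CARD('n) * (h ^ CARD('n) * (g x + e))"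
proof -
  have "\<exists>N. negligible N \<and> (\<forall>x e. x \<notin> N \<longrightarrow> 0 < e \<longrightarrow> (\<exists>d>0. \<forall>h. 0 < h \<and> h < d \<longrightarrow>
      integral (cbox x (x + h *\<^sub>R One)) (\<lambda>z. g (reflect s z)) \<le> h ^ CARD('n) * (g (reflect s x) + e)))" for s :: "'n set"
  proof -
    have i: "(\<lambda>z. g (reflect s z)) integrable_on cbox a b" for a b
    proof -
      obtain u v where uv: "reflect s ` cbox a b = cbox u v" using reflect_cbox by blast
      have "((\<lambda>z. g (reflect s z)) has_integral integral (cbox u v) g) (reflect s ` cbox u v)"
        by (intro has_integral_reflect_cbox integrable_integral g)
      then show ?thesis unfolding uv[symmetric] image_image by auto
    qed
    obtain N where N: "negligible N" "\<And>x e. x \<notin> N \<Longrightarrow> 0 < e \<Longrightarrow> \<exists>d>0. \<forall>h. 0 < h \<and> h < d \<longrightarrow>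
        norm (integral (cbox x (x + h *\<^sub>R One)) (\<lambda>z. g (reflect s z)) /\<^sub>R h ^ DIM(real^'n) - g (reflect s x)) < e"
      using integrable_ccontinuous_explicit[OF i] by blast
    show ?thesis
    proof (intro exI[of _ N] conjI N(1) allI impI)
      fix x and e :: real assume "x \<notin> N" "0 < e"
      then obtain d where d: "d > 0" "\<And>h. 0 < h \<Longrightarrow> h < d \<Longrightarrow>
        norm (integral (cbox x (x + h *\<^sub>R One)) (\<lambda>z. g (reflect s z)) /\<^sub>R h ^ DIM(real^'n) - g (reflect s x)) < e"
        using N(2) by metis
      have "integral (cbox x (x + h *\<^sub>R One)) (\<lambda>z. g (reflect s z)) \<le> h ^ CARD('n) * (g (reflect s x) + e)"
        if h: "0 < h" "h < d" for h
      proof -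
        have "integral (cbox x (x + h *\<^sub>R One)) (\<lambda>z. g (reflect s z)) / h ^ CARD('n) \<le> g (reflect s x) + e"
          using d(2)[OF h] by (simp add: divide_inverse mult.commute abs_less_iff)
        then show ?thesis using h by (simp add: pos_divide_le_eq mult.commute)
      qed
      then show "\<exists>d>0. \<forall>h. 0 < h \<and> h < d \<longrightarrow>
        integral (cbox x (x + h *\<^sub>R One)) (\<lambda>z. g (reflect s z)) \<le> h ^ CARD('n) * (g (reflect s x) + e)"
        using d(1) by blast
    qed
  qed
  then obtain N where N: "\<And>s. negligible (N s)"
    "\<And>s x e. x \<notin> N s \<Longrightarrow> 0 < e \<Longrightarrow> (\<exists>d>0. \<forall>h. 0 < h \<and> h < d \<longrightarrow>
      integral (cbox x (x + h *\<^sub>R One)) (\<lambda>z. g (reflect s z)) \<le> h ^ CARD('n) * (g (reflect s x) + e))"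
    by metis
  show thesis
  proof
    have lin: "linear (reflect s)" for s by (rule linearI) (auto simp: vec_eq_iff reflect_nth)
    have "negligible (reflect s ` N s)" for s
      using lin N(1) by (intro negligible_differentiable_image_negligible linear_imp_differentiable_on) auto
    then show "negligible (\<Union>s\<in>UNIV. reflect s ` N s)" by (intro negligible_Union) auto
    fix x and e :: real
    assume x: "x \<notin> (\<Union>s\<in>UNIV. reflect s ` N s)" and e: "0 < e"
    have "reflect s x \<notin> N s" for s
    proof
      assume "reflect s x \<in> N s"
      then have "reflect s (reflect s x) \<in> reflect s ` N s" by (rule imageI)
      then show False using x by auto
    qed
    then have "\<exists>d>0. \<forall>h. 0 < h \<and> h < d \<longrightarrow>
      integral (cbox (reflect s x) (reflect s x + h *\<^sub>R One)) (\<lambda>z. g (reflect s z)) \<le> h ^ CARD('n) * (g x + e)" for s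
      using N(2)[of "reflect s x" s e] e by simp
    then obtain d where d: "\<And>s. d s > 0" "\<And>s h. 0 < h \<Longrightarrow> h < d s \<Longrightarrow>
      integral (cbox (reflect s x) (reflect s x + h *\<^sub>R One)) (\<lambda>z. g (reflect s z)) \<le> h ^ CARD('n) * (g x + e)"
      by metis
    \<comment> \<open>There are finitely many sign patterns \<open>s\<close>, so one radius serves
      all of them.\<close>
    define D where "D = Min (range d)"
    have D: "D > 0" "\<And>s. D \<le> d s" using d(1) by (auto simp: D_def)
    have "integral (cbox (x - h *\<^sub>R One) (x + h *\<^sub>R One)) g \<le> 2 ^ CARD('n) * (h ^ CARD('n) * (g x + e))"
      if h: "0 < h" "h < D" for h
    proof -
      let ?Q = "cbox (x - h *\<^sub>R One) (x + h *\<^sub>R One)"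
      let ?B = "\<lambda>s. reflect s ` cbox (reflect s x) (reflect s x + h *\<^sub>R One)"
      have B: "\<exists>a b. ?B s = cbox a b" "?B s \<subseteq> ?Q" for s
      proof -
        show "\<exists>a b. ?B s = cbox a b" using reflect_cbox by blast
        show "?B s \<subseteq> ?Q"
        proof
          fix z assume "z \<in> ?B s"
          then obtain w where w: "z = reflect s w" "w \<in> cbox (reflect s x) (reflect s x + h *\<^sub>R One)" by blast
          have "x $ i - h \<le> z $ i \<and> z $ i \<le> x $ i + h" for i
            using w(2)[unfolded mem_box_cart, rule_format, of i] h unfolding w(1)
            by (auto simp: reflect_nth split: if_splits)
          then show "z \<in> ?Q" by (simp add: mem_box_cart)
        qed
      qed
      have gB: "g integrable_on ?B s" for s using B(1)[of s] g by auto
      have Bint: "integral (?B s) g \<le> h ^ CARD('n) * (g x + e)" for s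
      proof -
        let ?C = "cbox (reflect s x) (reflect s x + h *\<^sub>R One)"
        obtain a b where ab: "?B s = cbox a b" using B by blast
        have "((\<lambda>z. g (reflect s z)) has_integral integral (cbox a b) g) (reflect s ` cbox a b)"
          by (intro has_integral_reflect_cbox integrable_integral g)
        then have "((\<lambda>z. g (reflect s z)) has_integral integral (?B s) g) ?C"
          unfolding ab[symmetric] by (simp add: image_image)
        then have "integral ?C (\<lambda>z. g (reflect s z)) = integral (?B s) g" by (rule integral_unique)
        then show ?thesis using d(2)[of h s] h D(2)[of s] by simp
      qed
      have r: "((\<lambda>z. if z \<in> ?B s then g z else 0) has_integral integral (?B s) g) ?Q" for s
        using has_integral_restrict[OF B(2)] integrable_integral[OF gB] by blast
      have "integral ?Q g \<le> (\<Sum>s\<in>UNIV. integral (?B s) g)"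
      proof (rule has_integral_le[OF integrable_integral[OF g]])
        show "((\<lambda>z. \<Sum>s\<in>UNIV. if z \<in> ?B s then g z else 0) has_integral (\<Sum>s\<in>UNIV. integral (?B s) g)) ?Q"
          by (intro has_integral_sum r) auto
        fix z assume z: "z \<in> ?Q"
        \<comment> \<open>The coordinates in which \<open>z\<close> lies below \<open>x\<close>
          select an orthant box containing \<open>z\<close>. Boxes may share faces, but
          \<open>g\<close> is nonnegative and only an upper bound is claimed; the number of sign
          patterns is \<open>2 ^ CARD('n)\<close>.\<close>
        define s where "s = {i. z $ i < x $ i}"
        have "reflect s z \<in> cbox (reflect s x) (reflect s x + h *\<^sub>R One)"
          using z by (auto simp: mem_box_cart reflect_nth s_def) (smt (verit))+
        then have "z \<in> ?B s" by (intro image_eqI[of _ _ "reflect s z"]) auto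
        then have "g z = (if z \<in> ?B s then g z else 0)" by simp
        also have "\<dots> \<le> (\<Sum>s\<in>UNIV. if z \<in> ?B s then g z else 0)"
          by (rule member_le_sum) (auto simp: nn)
        finally show "g z \<le> (\<Sum>s\<in>UNIV. if z \<in> ?B s then g z else 0)" .
      qed
      also have "\<dots> \<le> (\<Sum>s\<in>(UNIV :: 'n set set). h ^ CARD('n) * (g x + e))" by (intro sum_mono Bint)
      also have "\<dots> = 2 ^ CARD('n) * (h ^ CARD('n) * (g x + e))"
        by (simp add: card_UNIV_set)
      finally show ?thesis .
    qed
    then show "\<exists>d>0. \<forall>h. 0 < h \<and> h < d \<longrightarrow>
       integral (cbox (x - h *\<^sub>R One) (x + h *\<^sub>R One)) g \<le> 2 ^ CARD('n) * (h ^ CARD('n) * (g x + e))"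
      using D(1) by blast
  qed
qed

text \<open>Lebesgue points are available for \<open>norm (Dy x - q) powr p\<close> with
  \<open>q\<close> fixed, whereas the argument at \<open>x\<close> needs \<open>q = Dy x\<close>; a
  countable dense set of \<open>q\<close> keeps the exceptional set null, and approximation bridges
  the difference. At a good point the integral over a small cube of half side \<open>h\<close> is at
  most \<open>\<eta> * h ^ n\<close>, and Morrey's bound becomes a constant times
  \<open>\<eta> powr (1 / p) * h\<close>, which is small relative to \<open>h\<close>.\<close>

theorem sobolev_differentiable_ae:
  fixes y :: "real^'n \<Rightarrow> real^'n"
  assumes p: "real CARD('n) < p" and \<Omega>: "open \<Omega>" and y: "continuous_on \<Omega> y" and W: "sobolev_W1 p \<Omega> y Dy"
  obtains N where "negligible N" "\<And>x. x \<in> \<Omega> - N \<Longrightarrow> (y has_derivative (*v) (Dy x)) (at x)"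
proof -
  let ?n = "CARD('n)"
  have n1: "1 \<le> real ?n" by (simp add: Suc_leI)
  then have p1: "1 < p" "0 < p" "0 \<le> p" using p by linarith+
  have \<Omega>s: "\<Omega> \<in> sets lebesgue" using \<Omega> by (simp add: borel_open)
  have Lp: "in_Lp p \<Omega> Dy" using W by (simp add: sobolev_W1_def)
  obtain D :: "(real^'n^'n) set" where D: "countable D" "\<And>X. open X \<Longrightarrow> X \<noteq> {} \<Longrightarrow> \<exists>d\<in>D. d \<in> X"
    using countable_dense_setE by blast
  \<comment> \<open>Extension by zero makes the function integrable on every box, as the
    differentiation lemma requires.\<close>
  define g where "g = (\<lambda>q x. if x \<in> \<Omega> then norm (Dy x - q) powr p else 0)"
  have gi: "g q integrable_on cbox a b" for q a b
  proof -
    have "(\<lambda>x. norm (Dy x - q) powr p) absolutely_integrable_on (\<Omega> \<inter> cbox a b)"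
      using fmeasurable_Int_fmeasurable[OF lmeasurable_cbox \<Omega>s, of a b]
      by (intro in_Lp_shift_integrable(1)[OF Lp p1(3) \<Omega>s]) (auto simp: Int_commute)
    then have "(\<lambda>x. norm (Dy x - q) powr p) integrable_on (\<Omega> \<inter> cbox a b)"
      by (rule set_lebesgue_integral_eq_integral(1))
    then show ?thesis unfolding g_def by (simp add: integrable_restrict_Int)
  qed
  have "\<exists>N. negligible N \<and> (\<forall>x e. x \<notin> N \<longrightarrow> 0 < e \<longrightarrow> (\<exists>d>0. \<forall>h. 0 < h \<and> h < d \<longrightarrow>
      integral (cbox (x - h *\<^sub>R One) (x + h *\<^sub>R One)) (g q) \<le> 2 ^ ?n * (h ^ ?n * (g q x + e))))" for q
    by (rule lebesgue_differentiation_centred[of "g q"]) (auto simp: gi, auto simp: g_def)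
  then obtain N where N: "\<And>q. negligible (N q)" "\<And>q x e. x \<notin> N q \<Longrightarrow> 0 < e \<Longrightarrow> \<exists>d>0. \<forall>h. 0 < h \<and> h < d \<longrightarrow>
      integral (cbox (x - h *\<^sub>R One) (x + h *\<^sub>R One)) (g q) \<le> 2 ^ ?n * (h ^ ?n * (g q x + e))"
    by metis
  show thesis
  proof
    show "negligible (\<Union>q\<in>D. N q)" using D(1) N(1) by (intro negligible_countable_Union) auto
    fix x assume x: "x \<in> \<Omega> - (\<Union>q\<in>D. N q)"
    define A where "A = Dy x"
    define K where "K = real ?n * (morrey_const TYPE('n) p * 2 powr (1 - real ?n / p))"
    have K: "0 < K" using n1 morrey_const_pos[OF p] by (simp add: K_def)
    obtain r where r: "0 < r" "cball x r \<subseteq> \<Omega>" using \<Omega> x open_contains_cball by blast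
    show "(y has_derivative (*v) (Dy x)) (at x)"
      unfolding has_derivative_at_alt
    proof (intro conjI allI impI matrix_vector_mul_bounded_linear)
      fix e :: real assume e: "0 < e"
      \<comment> \<open>Solves \<open>K * \<eta> powr (1 / p) = e\<close>, where \<open>K\<close> is
        Morrey's constant for a cube of side \<open>2 * h\<close> with the power of \<open>h\<close>
        split off.\<close>
      define \<eta> where "\<eta> = (e / K) powr p"
      have \<eta>: "0 < \<eta>" "\<eta> powr (1 / p) = e / K" using e K p1 by (auto simp: \<eta>_def powr_powr)
      \<comment> \<open>The factor \<open>2 powr p\<close> comes from the triangle inequality for
        \<open>p\<close>-th powers and \<open>2 ^ n\<close> from the side \<open>2 * h\<close>. The
        3 counts the value of \<open>g q\<close> at \<open>x\<close>, the differentiation error, and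
        the distance from \<open>q\<close> to \<open>A\<close>.\<close>
      define \<theta> where "\<theta> = \<eta> / (2 powr p * 2 ^ ?n * 3)"
      have \<theta>: "0 < \<theta>" using \<eta> by (simp add: \<theta>_def)
      obtain q where q: "q \<in> D" "q \<in> ball A (\<theta> powr (1 / p))"
        using D(2)[of "ball A (\<theta> powr (1 / p))"] \<theta> by auto
      have "norm (A - q) powr p \<le> (\<theta> powr (1 / p)) powr p"
        using q p1 by (intro powr_mono2) (auto simp: dist_norm)
      then have qA: "norm (A - q) powr p \<le> \<theta>" using \<theta> p1 by (simp add: powr_powr)
      obtain d where d: "0 < d" "\<And>h. 0 < h \<Longrightarrow> h < d \<Longrightarrow>
          integral (cbox (x - h *\<^sub>R One) (x + h *\<^sub>R One)) (g q) \<le> 2 ^ ?n * (h ^ ?n * (g q x + \<theta>))"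
        using N(2)[of x q \<theta>] x q(1) \<theta> by auto
      show "\<exists>d>0. \<forall>z. norm (z - x) < d \<longrightarrow> norm (y z - y x - Dy x *v (z - x)) \<le> e * norm (z - x)"
      \<comment> \<open>The cube of half side \<open>h\<close> about \<open>x\<close> lies within
        distance \<open>n * h\<close> of \<open>x\<close>, so \<open>h < r / n\<close> keeps it
        inside the domain.\<close>
      proof (intro exI[of _ "min d (r / ?n)"] conjI allI impI)
        show "0 < min d (r / ?n)" using d r by simp
        fix z assume z: "norm (z - x) < min d (r / ?n)"
        show "norm (y z - y x - Dy x *v (z - x)) \<le> e * norm (z - x)"
        proof (cases "z = x")
          case False
          define h where "h = norm (z - x)"
          have h: "0 < h" "h < d" "h * ?n \<le> r" using False z by (auto simp: h_def field_simps)
          define a where "a = x - h *\<^sub>R One"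
          define Q where "Q = cbox a (a + (2 * h) *\<^sub>R One)"
          have b: "a + (2 * h) *\<^sub>R One = x + h *\<^sub>R One" by (simp add: a_def algebra_simps flip: scaleR_add_left)
          have inQ: "w \<in> Q \<longleftrightarrow> (\<forall>i. \<bar>w $ i - x $ i\<bar> \<le> h)" for w
            unfolding Q_def b unfolding a_def by (auto simp: mem_box_cart abs_le_iff algebra_simps)
          have Qsub: "Q \<subseteq> \<Omega>"
          proof
            fix w assume "w \<in> Q"
            then have "(\<Sum>i\<in>UNIV. \<bar>(w - x) $ i\<bar>) \<le> (\<Sum>i\<in>(UNIV :: 'n set). h)"
              unfolding inQ by (intro sum_mono) simp
            then have "norm (w - x) \<le> r"
              using norm_le_l1_cart[of "w - x"] h(3) by (simp add: mult.commute)
            then show "w \<in> \<Omega>" using r(2) by (auto simp: dist_norm norm_minus_commute)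
          qed
          have "\<bar>(z - x) $ i\<bar> \<le> h" for i unfolding h_def by (rule component_le_norm_cart)
          then have zQ: "z \<in> Q" "x \<in> Q" using h by (auto simp: inQ)
          have Ql: "Q \<in> lmeasurable" by (simp add: Q_def)
          have int: "(\<lambda>w. norm (Dy w - B) powr p) integrable_on Q" for B
            using in_Lp_shift_integrable(1)[OF Lp p1(3) \<Omega>s Qsub Ql] by (rule set_lebesgue_integral_eq_integral(1))
          have cQ: "((\<lambda>w. c) has_integral (2 * h) ^ ?n * c) Q" for c :: real
            using has_integral_const[of c a "a + (2 * h) *\<^sub>R One"] content_cube[of "2 * h" a] h by (simp add: Q_def)
          have "integral Q (\<lambda>w. norm (Dy w - A) powr p) \<le> integral Q (\<lambda>w. 2 powr p * (norm (Dy w - q) powr p + norm (q - A) powr p))"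
            using cQ by (intro integral_le int integrable_on_mult_right integrable_add norm_diff_powr_le p1) auto
          also have "\<dots> = 2 powr p * (integral Q (\<lambda>w. norm (Dy w - q) powr p) + (2 * h) ^ ?n * norm (q - A) powr p)"
            by (intro integral_unique has_integral_mult_right has_integral_add integrable_integral int cQ)
          also have "integral Q (\<lambda>w. norm (Dy w - q) powr p) = integral Q (g q)"
            using Qsub by (intro integral_cong) (auto simp: g_def)
          also have "2 powr p * (integral Q (g q) + (2 * h) ^ ?n * norm (q - A) powr p) \<le>
             2 powr p * (2 ^ ?n * (h ^ ?n * (\<theta> + \<theta>)) + (2 * h) ^ ?n * \<theta>)"
          proof (intro mult_left_mono add_mono)
            have "integral Q (g q) \<le> 2 ^ ?n * (h ^ ?n * (g q x + \<theta>))"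
              using d(2)[OF h(1,2)] unfolding Q_def b unfolding a_def .
            also have "\<dots> \<le> 2 ^ ?n * (h ^ ?n * (\<theta> + \<theta>))"
              using x qA h by (intro mult_left_mono) (auto simp: g_def A_def)
            finally show "integral Q (g q) \<le> 2 ^ ?n * (h ^ ?n * (\<theta> + \<theta>))" .
            show "norm (q - A) powr p \<le> \<theta>" using qA by (simp add: norm_minus_commute)
          qed (use h in auto)
          also have "\<dots> = \<eta> * h ^ ?n" by (simp add: \<theta>_def power_mult_distrib)
          finally have J: "integral Q (\<lambda>w. norm (Dy w - A) powr p) \<le> \<eta> * h ^ ?n" .
          have "norm (y z - y x - A *v (z - x)) \<le>
            real ?n * (morrey_const TYPE('n) p * (2 * h) powr (1 - real ?n / p) * (\<eta> * h ^ ?n) powr (1 / p))"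
            using h \<eta> by (intro morrey_sobolev[OF p _ Q_def \<Omega>s Qsub y W _ J zQ]) auto
          also have "\<dots> = K * \<eta> powr (1 / p) * (h powr (1 - real ?n / p) * h powr (real ?n / p))"
            using h \<eta> by (simp add: K_def powr_mult powr_powr flip: powr_realpow)
          also have "h powr (1 - real ?n / p) * h powr (real ?n / p) = h"
            using h by (simp flip: powr_add)
          also have "K * \<eta> powr (1 / p) * h = e * h" using K by (simp add: \<eta>)
          finally show ?thesis by (simp add: A_def h_def)
        qed simp
      qed
    qed
  qed
qed

section \<open>Lusin's condition and the area formula\<close>

text \<open>Absolute continuity of the integral: open neighbourhoods of \<open>N\<close> shrink to a
  null set, and dominated convergence with \<open>G\<close> as majorant does the rest.\<close>

lemma open_superset_small_integral:
  fixes G :: "real^'n \<Rightarrow> real"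
  assumes \<Omega>: "open \<Omega>" and G: "G absolutely_integrable_on \<Omega>" and nn: "\<And>x. 0 \<le> G x"
    and N: "negligible N" "N \<subseteq> \<Omega>" and e: "0 < e"
  obtains U where "open U" "N \<subseteq> U" "U \<subseteq> \<Omega>" "integral U G < e"
proof -
  have Nm: "N \<in> lmeasurable" "measure lebesgue N = 0" using N(1) by (auto simp: negligible_iff_measure)
  have "\<exists>U. open U \<and> N \<subseteq> U \<and> U \<in> lmeasurable \<and> measure lebesgue U < 1 / real (Suc k)" for k
  proof -
    have "N \<in> sets lebesgue" "0 < 1 / real (Suc k)" using Nm(1) by (simp_all add: fmeasurableD)
    then obtain T where T: "open T" "N \<subseteq> T" "T - N \<in> lmeasurable" "emeasure lebesgue (T - N) < ennreal (1 / real (Suc k))"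
      by (rule sets_lebesgue_outer_open)
    have neg: "negligible ((T - N - T) \<union> (T - (T - N)))" using N(1) by (rule negligible_subset) auto
    have "T \<in> lmeasurable" "measure lebesgue T = measure lebesgue (T - N)"
      by (rule lmeasurable_negligible_symdiff[OF T(3) neg], rule measure_negligible_symdiff[OF T(3) neg])
    moreover have "measure lebesgue (T - N) < 1 / real (Suc k)"
      using T(4) unfolding emeasure_eq_measure2[OF T(3)] by (simp add: ennreal_less_iff)
    ultimately show ?thesis using T by auto
  qed
  then obtain U where U: "\<And>k. open (U k)" "\<And>k. N \<subseteq> U k" "\<And>k. U k \<in> lmeasurable"
      "\<And>k. measure lebesgue (U k) < 1 / real (Suc k)" by metis
  \<comment> \<open>Finite intersections stay open and decrease with \<open>k\<close>, so a point
    that has left one \<open>V k\<close> remains outside.\<close>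
  define V where "V = (\<lambda>k. \<Omega> \<inter> (\<Inter>i\<in>{..k}. U i))"
  have V: "open (V k)" "N \<subseteq> V k" "V k \<subseteq> \<Omega>" for k
    using U N \<Omega> by (auto simp: V_def)
  have Vm: "V l \<subseteq> V k" if "k \<le> l" for k l using that by (force simp: V_def)
  define Z where "Z = (\<Inter>k. V k)"
  have Z: "negligible Z"
    unfolding negligible_outer
  proof (intro allI impI)
    fix r :: real assume "0 < r"
    then obtain k where "1 / real (Suc k) < r" using nat_approx_posE by blast
    then show "\<exists>T. Z \<subseteq> T \<and> T \<in> lmeasurable \<and> measure lebesgue T < r"
      using U(3,4)[of k] by (intro exI[of _ "U k"]) (force simp: Z_def V_def)
  qed
  let ?f = "\<lambda>k x. if x \<in> V k then G x else 0" and ?g = "\<lambda>x. if x \<in> Z then G x else 0"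
  have GV: "G integrable_on V k" for k
    using set_integrable_subset[OF G, of "V k"] V set_lebesgue_integral_eq_integral(1) by (metis borel_open sets_completionI_sets sets_lborel)
  have "?f k integrable_on \<Omega>" for k
    using GV[of k] V(3)[of k] by (simp add: integrable_restrict_Int inf.absorb1)
  moreover have "G integrable_on \<Omega>" using G by (rule set_lebesgue_integral_eq_integral(1))
  moreover have "(\<lambda>k. ?f k x) \<longlonglongrightarrow> ?g x" for x
  proof (cases "x \<in> Z")
    case False
    then obtain k where k: "x \<notin> V k" by (auto simp: Z_def)
    have "\<forall>\<^sub>F l in sequentially. ?f l x = ?g x"
      using eventually_ge_at_top[of k] by eventually_elim (use Vm k False in auto)
    then show ?thesis by (rule tendsto_eventually)
  qed (simp add: Z_def)
  ultimately have "(\<lambda>k. integral \<Omega> (?f k)) \<longlonglongrightarrow> integral \<Omega> ?g"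
    using nn by (intro dominated_convergence(2)[where h = G]) auto
  moreover have "integral \<Omega> ?g = integral \<Omega> (\<lambda>x. 0)" by (rule integral_spike[OF Z]) auto
  ultimately have "\<forall>\<^sub>F k in sequentially. integral \<Omega> (?f k) < e"
    using e by (intro order_tendstoD(2)) auto
  then obtain k where "integral \<Omega> (?f k) < e" by (auto simp: eventually_sequentially)
  then have "integral (V k) G < e"
    using V(3)[of k] by (simp add: integral_restrict_Int inf.absorb1)
  then show thesis using V that by blast
qed

lemma bounded_subset_cube:
  fixes S :: "(real^'n) set"
  assumes "bounded S"
  obtains R where "0 < R" "S \<subseteq> cbox (- R *\<^sub>R One) (R *\<^sub>R One)"
proof -
  obtain B where B: "\<And>x. x \<in> S \<Longrightarrow> norm x \<le> B" using assms by (auto simp: bounded_iff)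
  have "S \<subseteq> cbox (- (\<bar>B\<bar> + 1) *\<^sub>R One) ((\<bar>B\<bar> + 1) *\<^sub>R One)"
  proof
    fix x assume "x \<in> S"
    have "\<bar>x $ i\<bar> \<le> \<bar>B\<bar> + 1" for i
      using component_le_norm_cart[of x i] B[OF \<open>x \<in> S\<close>] by linarith
    then show "x \<in> cbox (- (\<bar>B\<bar> + 1) *\<^sub>R One) ((\<bar>B\<bar> + 1) *\<^sub>R One)"
      by (auto simp: mem_box_cart abs_le_iff) (smt (verit))+
  qed
  then show thesis by (intro that[of "\<bar>B\<bar> + 1"]) auto
qed

text \<open>By Morrey's inequality, a cube \<open>K\<close> has an image of diameter at most a
  constant times \<open>J K powr (1 / n)\<close>, with \<open>J K\<close> the integral of
  \<open>G\<close> over \<open>K\<close>. The image thus fits into a ball of volume proportional to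
  \<open>J K\<close>, and over cubes with disjoint interiors in a small neighbourhood of
  \<open>N\<close> these volumes have a small sum.\<close>

theorem sobolev_lusin_N:
  fixes y :: "real^'n \<Rightarrow> real^'n"
  assumes p: "real CARD('n) < p" and \<Omega>: "open \<Omega>" "bounded \<Omega>" and y: "continuous_on \<Omega> y"
    and W: "sobolev_W1 p \<Omega> y Dy" and N: "negligible N" "N \<subseteq> \<Omega>"
  shows "negligible (y ` N)"
  unfolding negligible_outer
proof (intro allI impI)
  fix e :: real assume e: "0 < e"
  let ?n = "CARD('n)"
  have n1: "1 \<le> real ?n" by (simp add: Suc_leI)
  then have p1: "1 < p" "0 < p" "0 \<le> p" using p by linarith+
  have \<Omega>l: "\<Omega> \<in> lmeasurable" using \<Omega> by (simp add: lmeasurable_open)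
  then have \<Omega>s: "\<Omega> \<in> sets lebesgue" by (simp add: fmeasurableD)
  have Lp: "in_Lp p \<Omega> Dy" using W by (simp add: sobolev_W1_def)
  \<comment> \<open>The summand 1 makes the integral of \<open>G\<close> over a cube positive and at
    least the volume of the cube, which allows powers of the side to be replaced by powers of the
    integral.\<close>
  define G where "G = (\<lambda>x. norm (Dy x - 0) powr p + 1)"
  have G: "G absolutely_integrable_on \<Omega>"
    unfolding G_def using in_Lp_shift_integrable(1)[OF Lp p1(3) \<Omega>s order_refl \<Omega>l] absolutely_integrable_on_const[OF \<Omega>l]
    by (rule set_integral_add(1))
  have G1: "1 \<le> G x" for x by (simp add: G_def)
  then have G0: "0 \<le> G x" for x by (meson order_trans zero_le_one)
  define C where "C = real ?n * morrey_const TYPE('n) p"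
  have C: "0 < C" using n1 morrey_const_pos[OF p] by (simp add: C_def)
  \<comment> \<open>A ball of radius \<open>2 * C * J powr (1 / n)\<close> has volume
    \<open>\<beta> * J\<close>. The 2 turns Morrey's bound into a strict inequality, so that open
    balls can be used.\<close>
  define \<beta> where "\<beta> = (2 * C) ^ ?n * measure lborel (ball (0 :: real^'n) 1)"
  have \<beta>: "0 < \<beta>" using C content_ball_pos[of 1 "0 :: real^'n"] by (simp add: \<beta>_def)
  obtain U where U: "open U" "N \<subseteq> U" "U \<subseteq> \<Omega>" "integral U G < e / \<beta>"
    using open_superset_small_integral[OF \<Omega>(1) G G0 N, of "e / \<beta>"] e \<beta> by auto
  have GU: "G integrable_on U"
    using set_integrable_subset[OF G, of U] U by (auto intro: set_lebesgue_integral_eq_integral(1))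
  obtain R where R: "0 < R" "\<Omega> \<subseteq> cbox (- R *\<^sub>R One) (R *\<^sub>R One)"
    using bounded_subset_cube[OF \<Omega>(2)] .
  \<comment> \<open>The tags produced by the covering lemma lie in \<open>N\<close> and hence in
    \<open>U\<close>, so this gauge confines all cubes to \<open>U\<close>.\<close>
  have "gauge (\<lambda>x. if x \<in> U then U else UNIV)" using U(1) by (auto simp: gauge_def)
  moreover have "N \<subseteq> cbox (- R *\<^sub>R One) (R *\<^sub>R One)" using N(2) R(2) by blast
  moreover have "box (- R *\<^sub>R One) (R *\<^sub>R One :: real^'n) \<noteq> {}" using R(1) by (simp add: box_ne_empty)
  ultimately obtain \<D> where D: "countable \<D>"
    "\<And>K. K \<in> \<D> \<Longrightarrow> interior K \<noteq> {} \<and> (\<exists>c d. K = cbox c d)"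
    "pairwise (\<lambda>A B. interior A \<inter> interior B = {}) \<D>"
    "\<And>K. K \<in> \<D> \<Longrightarrow> \<exists>x \<in> N \<inter> K. K \<subseteq> (if x \<in> U then U else UNIV)"
    "\<And>u v. cbox u v \<in> \<D> \<Longrightarrow> \<exists>n. \<forall>i \<in> Basis. v \<bullet> i - u \<bullet> i = ((R *\<^sub>R One) \<bullet> i - (- R *\<^sub>R One :: real^'n) \<bullet> i) / 2^n"
    "N \<subseteq> \<Union>\<D>"
    using covering_lemma[of N "- R *\<^sub>R One" "R *\<^sub>R One" "\<lambda>x. if x \<in> U then U else UNIV"] by metis
  have DU: "K \<subseteq> U" if K: "K \<in> \<D>" for K
  proof -
    obtain x where "x \<in> N" "K \<subseteq> (if x \<in> U then U else UNIV)" using D(4)[OF K] by blast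
    then show ?thesis using subsetD[OF U(2), of x] by simp
  qed
  have cube: "\<exists>a h. 0 < h \<and> K = cbox a (a + h *\<^sub>R One)" if K: "K \<in> \<D>" for K
  proof -
    obtain u v where uv: "K = cbox u v" using D(2)[OF K] by blast
    from D(5)[OF K[unfolded uv]] obtain m
      where m: "\<forall>i\<in>Basis. v \<bullet> i - u \<bullet> i = (R *\<^sub>R One \<bullet> i - (- R *\<^sub>R One :: real^'n) \<bullet> i) / 2^m" ..
    \<comment> \<open>The covering starts from a cube of side \<open>2 * R\<close>, so its boxes
      have equal sides and Morrey's inequality for cubes applies.\<close>
    have "v $ i = (u + (2 * R / 2 ^ m) *\<^sub>R One) $ i" for i
      using m[rule_format, of "axis i 1"] by (simp add: inner_axis axis_in_Basis_iff)
    then have "v = u + (2 * R / 2 ^ m) *\<^sub>R One" unfolding vec_eq_iff by blast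
    then show ?thesis using uv R(1) by (intro exI[of _ u] exI[of _ "2 * R / 2 ^ m"]) auto
  qed
  have GK: "G integrable_on K" if K: "K \<in> \<D>" for K
  proof -
    obtain u v where "K = cbox u v" using D(2)[OF K] by blast
    then have "K \<in> sets lebesgue" by simp
    then have "G absolutely_integrable_on K"
      using set_integrable_subset[OF G] DU[OF K] U(3) by (meson order_trans)
    then show ?thesis by (rule set_lebesgue_integral_eq_integral(1))
  qed
  define J where "J = (\<lambda>K. integral K G)"
  have "\<exists>c. y ` K \<subseteq> ball c (2 * C * J K powr (1 / real ?n)) \<and> 0 < J K" if K: "K \<in> \<D>" for K
  proof -
    obtain a h where ah: "0 < h" "K = cbox a (a + h *\<^sub>R One)" using cube[OF K] by blast
    have K\<Omega>: "K \<subseteq> \<Omega>" using DU[OF K] U(3) by blast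
    have "K \<in> lmeasurable" using ah by simp
    then have "(\<lambda>x. norm (Dy x - 0) powr p) integrable_on K"
      using in_Lp_shift_integrable(1)[OF Lp p1(3) \<Omega>s K\<Omega>] set_lebesgue_integral_eq_integral(1) by blast
    then have i: "integral K (\<lambda>x. norm (Dy x - 0) powr p) \<le> J K"
      unfolding J_def using GK[OF K] by (intro integral_le) (auto simp: G_def)
    have "((\<lambda>x. 1) has_integral h ^ ?n) K"
      using has_integral_const[of "1 :: real" a "a + h *\<^sub>R One"] content_cube[of h a] ah by simp
    then have hJ: "h ^ ?n \<le> J K"
      unfolding J_def using GK[OF K] G1 by (intro has_integral_le[OF _ integrable_integral]) auto
    have J0: "0 < J K" using hJ ah(1) by (meson less_le_trans zero_less_power)
    have "h = (h ^ ?n) powr (1 / real ?n)" using ah(1) by (simp add: powr_powr flip: powr_realpow)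
    also have "\<dots> \<le> J K powr (1 / real ?n)" using hJ ah(1) by (intro powr_mono2) auto
    finally have h: "h \<le> J K powr (1 / real ?n)" .
    \<comment> \<open>As this exponent is nonnegative, \<open>h\<close> may be replaced by the
      larger \<open>J K powr (1 / n)\<close>; the exponents of \<open>J K\<close> then add up to
      \<open>1 / n\<close>.\<close>
    have pow: "0 \<le> 1 - real ?n / p" using p p1 by simp
    have "h powr (1 - real ?n / p) \<le> (J K powr (1 / real ?n)) powr (1 - real ?n / p)"
      using h ah(1) pow by (intro powr_mono2) auto
    also have "\<dots> = J K powr (1 / real ?n - 1 / p)"
    proof -
      have "1 / real ?n * (1 - real ?n / p) = 1 / real ?n - 1 / p" using n1 p1 by (simp add: field_simps)
      then show ?thesis by (simp add: powr_powr)
    qed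
    finally have "h powr (1 - real ?n / p) * J K powr (1 / p) \<le> J K powr (1 / real ?n - 1 / p) * J K powr (1 / p)"
      by (intro mult_right_mono) auto
    also have "\<dots> = J K powr (1 / real ?n)" by (simp flip: powr_add)
    finally have hp: "h powr (1 - real ?n / p) * J K powr (1 / p) \<le> J K powr (1 / real ?n)" .
    have aK: "a \<in> K" using ah by (auto simp: mem_box_cart)
    have "dist (y a) (y x) < 2 * C * J K powr (1 / real ?n)" if "x \<in> K" for x
    proof -
      have "norm (y a - y x - 0 *v (a - x)) \<le>
          real ?n * (morrey_const TYPE('n) p * h powr (1 - real ?n / p) * J K powr (1 / p))"
        by (rule morrey_sobolev[OF p ah \<Omega>s K\<Omega> y W J0 i aK that])
      also have "\<dots> = C * (h powr (1 - real ?n / p) * J K powr (1 / p))" by (simp add: C_def)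
      also have "\<dots> \<le> C * J K powr (1 / real ?n)" using hp C by (intro mult_left_mono) auto
      also have "\<dots> < 2 * C * J K powr (1 / real ?n)" using C J0 by simp
      finally show ?thesis by (simp add: dist_norm)
    qed
    then show ?thesis using J0 by (intro exI[of _ "y a"]) auto
  qed
  then obtain c where c: "\<And>K. K \<in> \<D> \<Longrightarrow> y ` K \<subseteq> ball (c K) (2 * C * J K powr (1 / real ?n))"
    and J0: "\<And>K. K \<in> \<D> \<Longrightarrow> 0 < J K" by metis
  let ?B = "\<lambda>K. ball (c K) (2 * C * J K powr (1 / real ?n))"
  have mB: "measure lebesgue (?B K) = \<beta> * J K" if "K \<in> \<D>" for K
  proof -
    have "measure lborel (?B K) = (2 * C * J K powr (1 / real ?n)) ^ ?n * measure lborel (ball (0 :: real^'n) 1)"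
      using content_ball_conv_unit_ball[of "2 * C * J K powr (1 / real ?n)" "c K"] C by simp
    also have "(2 * C * J K powr (1 / real ?n)) ^ ?n = (2 * C) ^ ?n * J K"
      using J0[OF that] by (simp add: power_mult_distrib powr_powr flip: powr_realpow)
    finally show ?thesis by (simp add: \<beta>_def)
  qed
  \<comment> \<open>A bound uniform in finite subfamilies passes to the countable union. The cubes
    overlap only in null sets, so the \<open>J K\<close> add up to an integral over a subset of
    \<open>U\<close>.\<close>
  have bound: "measure lebesgue (\<Union>K\<in>\<E>. ?B K) \<le> \<beta> * integral U G" if E: "\<E> \<subseteq> \<D>" "finite \<E>" for \<E>
  proof -
    have "measure lebesgue (\<Union>K\<in>\<E>. ?B K) \<le> (\<Sum>K\<in>\<E>. measure lebesgue (?B K))"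
      using E(2) by (intro measure_UNION_le) auto
    also have "\<dots> = \<beta> * (\<Sum>K\<in>\<E>. J K)"
      using E(1) mB by (simp add: sum_distrib_left subset_iff)
    also have "(\<Sum>K\<in>\<E>. J K) \<le> integral U G"
    proof -
      have "(G has_integral (\<Sum>K\<in>\<E>. J K)) (\<Union>\<E>)"
      proof (rule has_integral_Union[OF E(2)])
        show "(G has_integral J K) K" if "K \<in> \<E>" for K
          unfolding J_def using that E GK by (intro integrable_integral) auto
        show "pairwise (\<lambda>S S'. negligible (S \<inter> S')) \<E>"
        proof (rule pairwiseI)
          fix A B assume AB: "A \<in> \<E>" "B \<in> \<E>" "A \<noteq> B"
          have fr: "negligible (K - interior K)" if K: "K \<in> \<E>" for K
          proof -
            obtain u v where "K = cbox u v" using D(2) E(1) K by blast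
            then show ?thesis using negligible_frontier_interval[of u v] by (simp add: interior_cbox)
          qed
          have "interior A \<inter> interior B = {}" using D(3) E(1) AB by (auto simp: pairwise_def)
          then have "A \<inter> B \<subseteq> (A - interior A) \<union> (B - interior B)" by blast
          then show "negligible (A \<inter> B)"
            using fr AB(1,2) by (meson negligible_Un negligible_subset)
        qed
      qed
      then have "(\<Sum>K\<in>\<E>. J K) = integral (\<Union>\<E>) G" "G integrable_on \<Union>\<E>" by (auto simp: has_integral_iff)
      then show ?thesis using E(1) DU GU G0 by (simp, intro integral_subset_le) auto
    qed
    finally show ?thesis using \<beta> by simp
  qed
  have "(\<Union>K\<in>\<D>. ?B K) \<in> lmeasurable" "measure lebesgue (\<Union>K\<in>\<D>. ?B K) \<le> \<beta> * integral U G"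
    by (rule fmeasurable_UN_bound[OF D(1) _ bound], simp_all, rule measure_UN_bound[OF D(1) _ bound], simp_all)
  moreover have "\<beta> * integral U G < e" using U(4) \<beta> by (simp add: field_simps)
  moreover have "y ` N \<subseteq> (\<Union>K\<in>\<D>. ?B K)" using D(6) c by blast
  ultimately show "\<exists>T. y ` N \<subseteq> T \<and> T \<in> lmeasurable \<and> measure lebesgue T < e"
    by (meson le_less_trans)
qed

text \<open>The points of non-differentiability form a null set with null image; discarding them
  changes neither the integral over the domain nor the measure of the image.\<close>

theorem sobolev_area_formula:
  fixes y :: "real^'n \<Rightarrow> real^'n"
  assumes p: "real CARD('n) < p" and \<Omega>: "open \<Omega>" "bounded \<Omega>" and y: "continuous_on \<Omega> y" "inj_on y \<Omega>"
    and W: "sobolev_W1 p \<Omega> y Dy" and img: "y ` \<Omega> \<in> lmeasurable"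
  shows "((\<lambda>x. \<bar>det (Dy x)\<bar>) has_integral measure lebesgue (y ` \<Omega>)) \<Omega>"
proof -
  obtain N where N: "negligible N" "\<And>x. x \<in> \<Omega> - N \<Longrightarrow> (y has_derivative (*v) (Dy x)) (at x)"
    using sobolev_differentiable_ae[OF p \<Omega>(1) y(1) W] by blast
  have yN: "negligible (y ` (\<Omega> \<inter> N))"
    using N(1) by (intro sobolev_lusin_N[OF p \<Omega> y(1) W]) (auto intro: negligible_subset)
  have "y ` (\<Omega> - N) = y ` \<Omega> - y ` (\<Omega> \<inter> N)" using y(2) by (auto simp: inj_on_def)
  then have sd: "(y ` \<Omega> - y ` (\<Omega> - N)) \<union> (y ` (\<Omega> - N) - y ` \<Omega>) \<subseteq> y ` (\<Omega> \<inter> N)" by blast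
  have neg: "negligible ((y ` \<Omega> - y ` (\<Omega> - N)) \<union> (y ` (\<Omega> - N) - y ` \<Omega>))"
    using yN sd by (rule negligible_subset)
  have S: "\<Omega> - N \<in> sets lebesgue"
    using \<Omega>(1) N(1) by (simp add: negligible_iff_null_sets null_setsD2 sets.Diff)
  have "y ` (\<Omega> - N) \<in> lmeasurable \<and> measure lebesgue (y ` (\<Omega> - N)) = measure lebesgue (y ` \<Omega>)"
    using lmeasurable_negligible_symdiff[OF img neg] measure_negligible_symdiff[of "y ` \<Omega>" "y ` (\<Omega> - N)"] img neg
    by (auto simp: fmeasurableD)
  then have "((\<lambda>x. \<bar>det (Dy x)\<bar>) has_integral measure lebesgue (y ` \<Omega>)) (\<Omega> - N)"
    by (subst (asm) has_measure_differentiable_image_matrix[OF S])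
       (use N(2) y(2) in \<open>auto intro: has_derivative_at_withinI inj_on_subset\<close>)
  then show ?thesis
    by (subst has_integral_spike_set_eq[of _ "\<Omega> - N"]) (auto intro: negligible_subset[OF N(1)])
qed

section \<open>Sufficiency\<close>

lemma measure_matrix_image:
  fixes M :: "real^'n^'n"
  assumes \<Omega>: "open \<Omega>" "bounded \<Omega>" and M: "0 < det M"
  shows "measure lebesgue ((*v) M ` \<Omega>) = det M * measure lebesgue \<Omega>"
proof -
  obtain N where N: "N ** M = mat 1" using det_nonzero_inverse[of M] M by (metis less_irrefl)
  then have inj: "inj_on ((*v) M) \<Omega>"
    by (intro inj_on_inverseI[of _ "(*v) N"]) (simp add: matrix_vector_mul_assoc)
  have l: "\<Omega> \<in> lmeasurable" using \<Omega> by (simp add: lmeasurable_open)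
  then have "((\<lambda>x. 1 :: real) has_integral measure lebesgue \<Omega>) \<Omega>"
    by (metis has_integral_iff lmeasurable_iff_integrable_on lmeasure_integral)
  then have "((\<lambda>x. \<bar>det M\<bar>) has_integral det M * measure lebesgue \<Omega>) \<Omega>"
    using has_integral_mult_right[of "\<lambda>x. 1" "measure lebesgue \<Omega>" \<Omega> "det M"] M by simp
  then show ?thesis
    using has_measure_differentiable_image_matrix[OF fmeasurableD[OF l] _ inj, of "\<lambda>x. M" "det M * measure lebesgue \<Omega>"]
      has_derivative_matrix has_derivative_at_withinI by blast
qed

text \<open>\<open>ennreal\<close> sends negative values to 0, so the right-hand side integrates the
  positive part of \<open>f\<close>.\<close>

lemma ennreal_integral_le_nn_integral:
  fixes f :: "'a \<Rightarrow> real"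
  assumes "integrable M f"
  shows "ennreal (integral\<^sup>L M f) \<le> (\<integral>\<^sup>+ x. ennreal (f x) \<partial>M)"
proof -
  have i: "integrable M (\<lambda>x. max 0 (f x))" using assms by simp
  have "integral\<^sup>L M f \<le> integral\<^sup>L M (\<lambda>x. max 0 (f x))" by (intro integral_mono assms i) auto
  then have "ennreal (integral\<^sup>L M f) \<le> ennreal (integral\<^sup>L M (\<lambda>x. max 0 (f x)))" by (rule ennreal_leI)
  also have "\<dots> = (\<integral>\<^sup>+ x. ennreal (max 0 (f x)) \<partial>M)" by (intro nn_integral_eq_integral[symmetric] i) auto
  also have "(\<lambda>x. ennreal (max 0 (f x))) = (\<lambda>x. ennreal (f x))" by (auto simp: max_def ennreal_neg)
  finally show ?thesis .
qed

lemma mean_inequality_of_convex: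
  fixes \<Psi> :: "real^'n^'n \<Rightarrow> real"
  assumes p: "real CARD('n) < p" and nonneg: "\<And>A. 0 < det A \<Longrightarrow> 0 \<le> \<Psi> A"
    and H: "convex_on {0<..} H" and \<Psi>: "\<And>A. 0 < det A \<Longrightarrow> \<Psi> A = H (det A)"
  shows "mean_inequality p \<Psi>"
  unfolding mean_inequality_def
proof (intro allI impI, elim conjE)
  fix \<Omega> :: "(real^'n) set" and M y Dy
  assume dom: "bounded_lipschitz_domain \<Omega>" and M: "0 < det M"
    and opi: "orientation_preserving_invertible p \<Omega> ((*v) M ` \<Omega>) y Dy"
  have \<Omega>: "open \<Omega>" "bounded \<Omega>" "\<Omega> \<noteq> {}" using dom by (auto simp: bounded_lipschitz_domain_def)
  have \<Omega>s: "\<Omega> \<in> sets lebesgue" using \<Omega>(1) by (simp add: borel_open)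
  let ?m = "measure lebesgue \<Omega>" and ?d = "det M"
  have m: "emeasure lebesgue \<Omega> = ennreal ?m" "0 < ?m" using emeasure_open_bounded[OF \<Omega>] .
  obtain z Dz where hom: "homeomorphism \<Omega> ((*v) M ` \<Omega>) y z" and W: "sobolev_W1 p \<Omega> y Dy"
    and pos: "AE x in lebesgue_on \<Omega>. 0 < det (Dy x)"
    using opi unfolding orientation_preserving_invertible_def by blast
  have yc: "continuous_on \<Omega> y" and yi: "inj_on y \<Omega>" and img: "y ` \<Omega> = (*v) M ` \<Omega>"
    using hom unfolding homeomorphism_def by (auto intro: inj_on_inverseI)
  have "((\<lambda>x. \<bar>det (Dy x)\<bar>) has_integral ?d * ?m) \<Omega>"
    using sobolev_area_formula[OF p \<Omega>(1,2) yc yi W] lmeasurable_matrix_image_open[OF \<Omega>(1,2), of M] M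
      measure_matrix_image[OF \<Omega>(1,2) M] by (simp add: img)
  then have det: "(\<lambda>x. \<bar>det (Dy x)\<bar>) absolutely_integrable_on \<Omega>" "integral \<Omega> (\<lambda>x. \<bar>det (Dy x)\<bar>) = ?d * ?m"
    by (auto simp: has_integral_iff absolutely_integrable_on_iff_nonneg)
  have deti: "integrable (lebesgue_on \<Omega>) (\<lambda>x. \<bar>det (Dy x)\<bar>)"
    using det(1) \<Omega>s by (simp add: integrable_lebesgue_on_iff)
  have detL: "(LINT x|lebesgue_on \<Omega>. \<bar>det (Dy x)\<bar>) = ?d * ?m"
    using lebesgue_integral_eq_integral[OF deti \<Omega>s] det(2) by simp
  have fin: "finite_measure (lebesgue_on \<Omega>)"
    using \<Omega> by (intro finite_measure_lebesgue_on) (simp add: lmeasurable_open)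
  obtain a where a: "\<And>t. 0 < t \<Longrightarrow> H ?d + a * (t - ?d) \<le> H t"
    using convex_le_Inf_differential[OF H, of ?d] M by (auto simp: interior_open)
  \<comment> \<open>The supporting line of \<open>H\<close> at \<open>det M\<close>, evaluated at
    \<open>\<bar>det (Dy x)\<bar>\<close>, which agrees almost everywhere with the determinant and
    is integrable by the area formula. \<open>L\<close> may be negative and
    \<open>\<Psi> (Dy x)\<close> may have infinite integral, so the comparison uses nonnegative
    integrals.\<close>
  define L where "L = (\<lambda>x. H ?d + a * (\<bar>det (Dy x)\<bar> - ?d))"
  have ci: "integrable (lebesgue_on \<Omega>) (\<lambda>x. c)" for c :: real
    using fin by (simp add: finite_measure.integrable_const)
  have Li: "integrable (lebesgue_on \<Omega>) L"
    unfolding L_def using deti ci by (intro Bochner_Integration.integrable_add integrable_mult_right Bochner_Integration.integrable_diff)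
  have msp: "measure (lebesgue_on \<Omega>) (space (lebesgue_on \<Omega>)) = ?m"
    using \<Omega>s by (simp add: measure_restrict_space)
  have "integral\<^sup>L (lebesgue_on \<Omega>) L = H ?d * ?m + a * (?d * ?m - ?d * ?m)"
    unfolding L_def using deti ci detL msp by (simp add: mult.commute)
  then have "ennreal (H ?d * ?m) = ennreal (integral\<^sup>L (lebesgue_on \<Omega>) L)" by simp
  also have "\<dots> \<le> (\<integral>\<^sup>+ x. ennreal (L x) \<partial>lebesgue_on \<Omega>)" by (rule ennreal_integral_le_nn_integral[OF Li])
  also have "\<dots> \<le> (\<integral>\<^sup>+ x. ennreal (\<Psi> (Dy x)) \<partial>lebesgue_on \<Omega>)"
  proof (rule nn_integral_mono_AE)
    show "AE x in lebesgue_on \<Omega>. ennreal (L x) \<le> ennreal (\<Psi> (Dy x))"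
      using pos by eventually_elim (auto simp: L_def \<Psi> intro!: ennreal_leI a)
  qed
  finally have le: "ennreal (H ?d * ?m) \<le> (\<integral>\<^sup>+ x. ennreal (\<Psi> (Dy x)) \<partial>lebesgue_on \<Omega>)" .
  have "ennreal (\<Psi> M) = 1 / emeasure lebesgue \<Omega> * ennreal (H ?d * ?m)"
  proof -
    have "1 / emeasure lebesgue \<Omega> = ennreal (1 / ?m)"
      unfolding m(1) using m(2) by (simp add: divide_ennreal flip: ennreal_1)
    then show ?thesis using m(2) nonneg[OF M] \<Psi>[OF M] by (simp add: ennreal_mult[symmetric])
  qed
  also have "\<dots> \<le> 1 / emeasure lebesgue \<Omega> * (\<integral>\<^sup>+ x. ennreal (\<Psi> (Dy x)) \<partial>lebesgue_on \<Omega>)"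
    using le by (rule mult_left_mono) simp
  finally show "ennreal (\<Psi> M) \<le> 1 / emeasure lebesgue \<Omega> * (\<integral>\<^sup>+ x. ennreal (\<Psi> (Dy x)) \<partial>lebesgue_on \<Omega>)" .
qed

theorem theorem2:
  fixes \<Psi> :: "real^'n^'n \<Rightarrow> real" and p :: real
  assumes "real CARD('n) < p"
    and "continuous_on {A. 0 < det A} \<Psi>"
    and "\<And>A. 0 < det A \<Longrightarrow> 0 \<le> \<Psi> A"
  shows "(\<forall>\<Omega> M y Dy.
            bounded_lipschitz_domain \<Omega> \<and> 0 < det M \<and>
            orientation_preserving_invertible p \<Omega> ((*v) M ` \<Omega>) y Dy \<longrightarrow>
            1 / emeasure lebesgue \<Omega> * (\<integral>\<^sup>+ x. ennreal (\<Psi> (Dy x)) \<partial>lebesgue_on \<Omega>) \<ge> ennreal (\<Psi> M))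
         \<longleftrightarrow>
         (\<exists>H :: real \<Rightarrow> real. convex_on {0<..} H \<and> (\<forall>A. 0 < det A \<longrightarrow> \<Psi> A = H (det A)))"
  unfolding mean_inequality_def[symmetric]
proof
  assume ineq: "mean_inequality p \<Psi>"
  have p: "0 \<le> p" using assms(1) by (meson le_less_trans less_imp_le of_nat_0_le_iff)
  fix k :: 'n
  show "\<exists>H :: real \<Rightarrow> real. convex_on {0<..} H \<and> (\<forall>A. 0 < det A \<longrightarrow> \<Psi> A = H (det A))"
  \<comment> \<open>The index \<open>k\<close> is arbitrary; only the values at \<open>t > 0\<close>
    enter the claim.\<close>
  proof (intro exI[of _ "\<lambda>t. \<Psi> (dilation k t)"] conjI allI impI)
    show "convex_on {0<..} (\<lambda>t. \<Psi> (dilation k t))"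
      using ineq p assms(3) by (rule mean_inequality_convex)
    show "\<Psi> A = \<Psi> (dilation k (det A))" if "0 < det A" for A
      using ineq p assms(3) that by (rule mean_inequality_depends_on_det)
  qed
next
  assume "\<exists>H :: real \<Rightarrow> real. convex_on {0<..} H \<and> (\<forall>A. 0 < det A \<longrightarrow> \<Psi> A = H (det A))"
  then obtain H :: "real \<Rightarrow> real"
    where "convex_on {0<..} H" "\<And>A. 0 < det A \<Longrightarrow> \<Psi> A = H (det A)" by blast
  then show "mean_inequality p \<Psi>"
    using mean_inequality_of_convex[of p \<Psi> H] assms(1,3) by blast
qed

end
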